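(* Let $\kappa$ be any uncountable cardinal. If there exists an isometrically universal Banach space for $\mathcal B_\kappa$, then there is also an isometrically universal Banach space for $\mathcal B_\kappa$ which is of the form $C(K_A)$ for some Boolean algebra $A$ such that $A$ does not contain well-ordered uncountable chains. In particular, $A$ is not a universal Boolean algebra for $\mathcal A_\kappa$, nor is $K_A$ universal for $\mathcal C_\kappa$.
   Context: Banach spaces are real. For a Boolean algebra $A$, $K_A$ denotes its Stone space, i.e. the compact Hausdorff totally disconnected space such that $A$ is isomorphic to the algebra of all clopen subsets of $K_A$. For a compact Hausdorff space $K$, $C(K)$ is the Banach space of real-valued continuous functions on $K$ with the supremum norm. For an infinite cardinal $\kappa$: $\mathcal B_\kappa$ is the class of Banach spaces of density at most $\kappa$ (density is the least cardinality of a norm-dense subset); $\mathcal C_\kappa$ is the class of compact (Hausdorff) spaces of weight at most $\kappa$; $\mathcal A_\kappa$ is the class of Boolean algebras of cardinality at most $\kappa$. $X\in\mathcal B_\kappa$ is isometrically universal for $\mathcal B_\kappa$ if for every $Y\in\mathcal B_\kappa$ there is a linear isometry $T:Y\to X$ onto its range (not necessarily surjective onto $X$). $K\in\mathcal C_\kappa$ is universal for $\mathcal C_\kappa$ if for every $L\in\mathcal C_\kappa$ there is a continuous surjection $K\to L$. $A\in\mathcal A_\kappa$ is universal for $\mathcal A_\kappa$ if for every $B\in\mathcal A_\kappa$ there is a Boolean isomorphism $h:B\to A$ onto its range (i.e. an injective Boolean homomorphism). A well-ordered uncountable chain in a Boolean algebra is an uncountable subset that is well-ordered by the Boolean order (equivalently,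 up to passing to an initial part, a strictly increasing sequence indexed by $\omega_1$). *)

theory Defs
  imports "HOL-Analysis.Analysis" "HOL-Algebra.Lattice"
begin

unbundle cardinal_syntax

text \<open>
  A cardinal is a relation \<open>\<kappa>\<close> with \<^term>\<open>Card_order \<kappa>\<close>, on an arbitrary type \<open>'k\<close>.
  Banach spaces, compact spaces and Boolean algebras have explicit carriers, so that they can be
  quantified over inside a formula.
\<close>

section \<open>Banach spaces\<close>

record 'a normed_struct = "'a partial_object" +
  vadd :: "'a \<Rightarrow> 'a \<Rightarrow> 'a"
  vzero :: "'a"
  vscale :: "real \<Rightarrow> 'a \<Rightarrow> 'a"
  vnorm :: "'a \<Rightarrow> real"

locale normed_space_on =
  fixes V :: "'a normed_struct"
  assumes add_closed: "\<lbrakk>x \<in> carrier V; y \<in> carrier V\<rbrakk> \<Longrightarrow> vadd V x y \<in> carrier V"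
    and zero_closed: "vzero V \<in> carrier V"
    and scale_closed: "x \<in> carrier V \<Longrightarrow> vscale V a x \<in> carrier V"
    and add_assoc: "\<lbrakk>x \<in> carrier V; y \<in> carrier V; z \<in> carrier V\<rbrakk>
          \<Longrightarrow> vadd V (vadd V x y) z = vadd V x (vadd V y z)"
    and add_commute: "\<lbrakk>x \<in> carrier V; y \<in> carrier V\<rbrakk> \<Longrightarrow> vadd V x y = vadd V y x"
    and add_zero: "x \<in> carrier V \<Longrightarrow> vadd V x (vzero V) = x"
    and add_inverse: "x \<in> carrier V \<Longrightarrow> vadd V x (vscale V (- 1) x) = vzero V"
    and scale_add_right: "\<lbrakk>x \<in> carrier V; y \<in> carrier V\<rbrakk>
          \<Longrightarrow> vscale V a (vadd V x y) = vadd V (vscale V a x) (vscale V a y)"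
    and scale_add_left: "x \<in> carrier V
          \<Longrightarrow> vscale V (a + b) x = vadd V (vscale V a x) (vscale V b x)"
    and scale_scale: "x \<in> carrier V \<Longrightarrow> vscale V a (vscale V b x) = vscale V (a * b) x"
    and scale_one: "x \<in> carrier V \<Longrightarrow> vscale V 1 x = x"
    and norm_eq_zero: "x \<in> carrier V \<Longrightarrow> vnorm V x = 0 \<longleftrightarrow> x = vzero V"
    and norm_triangle: "\<lbrakk>x \<in> carrier V; y \<in> carrier V\<rbrakk>
          \<Longrightarrow> vnorm V (vadd V x y) \<le> vnorm V x + vnorm V y"
    and norm_scale: "x \<in> carrier V \<Longrightarrow> vnorm V (vscale V a x) = \<bar>a\<bar> * vnorm V x"

text \<open>The locale \<^locale>\<open>Metric_space\<close> wants symmetry and nonnegativity off the carrier as well.\<close>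
definition vdist :: "'a normed_struct \<Rightarrow> 'a \<Rightarrow> 'a \<Rightarrow> real" where
  "vdist V x y =
     (if x \<in> carrier V \<and> y \<in> carrier V then vnorm V (vadd V x (vscale V (- 1) y)) else 0)"

lemma normed_space_on_Metric_space:
  assumes "normed_space_on V"
  shows "Metric_space (carrier V) (vdist V)"
proof -
  interpret normed_space_on V by fact
  have n0: "vnorm V (vzero V) = 0" using zero_closed norm_eq_zero by blast
  have pos: "0 \<le> vnorm V x" if x: "x \<in> carrier V" for x
    using norm_triangle[OF x scale_closed[OF x, of "- 1"]] norm_scale[OF x, of "- 1"] 
      add_inverse[OF x] n0 by simp
  have zadd: "vadd V (vzero V) x = x" if "x \<in> carrier V" for x
    using add_commute[OF zero_closed that] add_zero[OF that] by simp
  have neg_add: "vadd V (vscale V (- 1) y) (vadd V y z) = z"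
    if "y \<in> carrier V" "z \<in> carrier V" for y z
    using that by (metis add_assoc add_commute add_inverse scale_closed zadd)
  have sub: "vadd V (vadd V x (vscale V (- 1) y)) (vadd V y (vscale V (- 1) z))
      = vadd V x (vscale V (- 1) z)"
    if "x \<in> carrier V" "y \<in> carrier V" "z \<in> carrier V" for x y z
    using that by (simp add: add_assoc add_closed scale_closed neg_add)
  have uniq: "x = y" if "x \<in> carrier V" "y \<in> carrier V"
    "vadd V x (vscale V (- 1) y) = vzero V" for x y
    using that by (metis add_assoc add_commute add_inverse add_zero scale_closed)
  have neg: "vscale V (- 1) (vadd V x (vscale V (- 1) y)) = vadd V y (vscale V (- 1) x)"
    if "x \<in> carrier V" "y \<in> carrier V" for x y
    using that by (simp add: scale_add_right scale_closed scale_scale scale_one add_commute)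
  show ?thesis
  proof
    show "0 \<le> vdist V x y" for x y
      by (simp add: vdist_def pos add_closed scale_closed)
    show "vdist V x y = vdist V y x" for x y
      using norm_scale[of "vadd V x (vscale V (- 1) y)" "- 1"]
      by (auto simp: vdist_def neg add_closed scale_closed)
    show "vdist V x y = 0 \<longleftrightarrow> x = y" if "x \<in> carrier V" "y \<in> carrier V" for x y
      using that uniq by (auto simp: vdist_def norm_eq_zero add_closed scale_closed add_inverse)
    show "vdist V x z \<le> vdist V x y + vdist V y z"
      if "x \<in> carrier V" "y \<in> carrier V" "z \<in> carrier V" for x y z
      using norm_triangle[of "vadd V x (vscale V (- 1) y)" "vadd V y (vscale V (- 1) z)"] that
      by (simp add: vdist_def sub add_closed scale_closed)
  qed
qed

definition banach_on :: "'a normed_struct \<Rightarrow> bool" where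
  "banach_on V \<longleftrightarrow> normed_space_on V \<and> Metric_space.mcomplete (carrier V) (vdist V)"

definition density_le :: "'a normed_struct \<Rightarrow> 'k rel \<Rightarrow> bool" where
  "density_le V \<kappa> \<longleftrightarrow> (\<exists>D \<subseteq> carrier V. |D| \<le>o \<kappa> \<and>
     Metric_space.mtopology (carrier V) (vdist V) closure_of D = carrier V)"

definition Banach_class :: "'k rel \<Rightarrow> 'a normed_struct set" where
  "Banach_class \<kappa> = {V. banach_on V \<and> density_le V \<kappa>}"

definition linear_isometry :: "'a normed_struct \<Rightarrow> 'b normed_struct \<Rightarrow> ('a \<Rightarrow> 'b) \<Rightarrow> bool" where
  "linear_isometry V W T \<longleftrightarrow>
     T \<in> carrier V \<rightarrow> carrier W \<and>
     (\<forall>x \<in> carrier V. \<forall>y \<in> carrier V. T (vadd V x y) = vadd W (T x) (T y)) \<and>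
     (\<forall>a. \<forall>x \<in> carrier V. T (vscale V a x) = vscale W a (T x)) \<and>
     (\<forall>x \<in> carrier V. vnorm W (T x) = vnorm V x)"

text \<open>
  The spaces \<open>Y\<close> range over carriers in \<^typ>\<open>'k set\<close>. This loses nothing: a space of density at most
  \<open>\<kappa>\<close> has at most \<open>\<kappa>\<^sup>\<omega> \<le> 2\<^sup>\<kappa>\<close> points; see \<open>universal_BanachD\<close> below.
\<close>
definition universal_Banach :: "'k rel \<Rightarrow> 'a normed_struct \<Rightarrow> bool" where
  "universal_Banach \<kappa> X \<longleftrightarrow> X \<in> Banach_class \<kappa> \<and>
     (\<forall>Y \<in> (Banach_class \<kappa> :: 'k set normed_struct set). \<exists>T. linear_isometry Y X T)"

lemma Banach_class_transport:
  fixes Y :: "'y normed_struct" and f :: "'y \<Rightarrow> 'z"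
  assumes Y: "Y \<in> Banach_class \<kappa>" and f: "inj_on f (carrier Y)"
  shows "\<exists>Z. Z \<in> Banach_class \<kappa> \<and> linear_isometry Y Z f"
proof -
  define g where "g = the_inv_into (carrier Y) f"
  define Z where "Z = \<lparr>carrier = f ` carrier Y,
     vadd = (\<lambda>x y. f (vadd Y (g x) (g y))), vzero = f (vzero Y),
     vscale = (\<lambda>a x. f (vscale Y a (g x))), vnorm = (\<lambda>x. vnorm Y (g x))\<rparr>"
  have gf: "g (f x) = x" if "x \<in> carrier Y" for x
    using that f by (simp add: g_def the_inv_into_f_f)
  have fg: "f x = f y \<longleftrightarrow> x = y" if "x \<in> carrier Y" "y \<in> carrier Y" for x y
    using that f by (auto dest: inj_onD)
  have nY: "normed_space_on Y" and cY: "Metric_space.mcomplete (carrier Y) (vdist Y)"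
    using Y by (auto simp: Banach_class_def banach_on_def)
  interpret Y: normed_space_on Y by fact
  note cl = Y.add_closed Y.zero_closed Y.scale_closed
  have carZ: "carrier Z = f ` carrier Y" by (simp add: Z_def)
  have nZ: "normed_space_on Z"
    by unfold_locales
      (auto simp: Z_def gf fg cl Y.add_assoc Y.add_zero Y.add_inverse Y.scale_add_right
        Y.scale_add_left Y.scale_scale Y.scale_one Y.norm_eq_zero Y.norm_triangle Y.norm_scale
        intro: arg_cong[OF Y.add_commute])
  interpret MY: Metric_space "carrier Y" "vdist Y" by (rule normed_space_on_Metric_space[OF nY])
  interpret MZ: Metric_space "carrier Z" "vdist Z" by (rule normed_space_on_Metric_space[OF nZ])
  have d: "vdist Z (f x) (f y) = vdist Y x y" if "x \<in> carrier Y" "y \<in> carrier Y" for x y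
    using that by (simp add: vdist_def Z_def gf cl)
  have "MZ.mcomplete"
    unfolding MZ.mcomplete_def
  proof (intro allI impI)
    fix \<sigma> assume \<sigma>: "MZ.MCauchy \<sigma>"
    then have "\<sigma> n \<in> f ` carrier Y" for n
      by (auto simp: MZ.MCauchy_def simp flip: carZ)
    then have s: "g (\<sigma> n) \<in> carrier Y" "f (g (\<sigma> n)) = \<sigma> n" for n
      by (metis gf imageE)+
    have ds: "vdist Z (\<sigma> m) (f y) = vdist Y (g (\<sigma> m)) y" if "y \<in> carrier Y" for m y
      by (metis d s that)
    have dss: "vdist Z (\<sigma> m) (\<sigma> n) = vdist Y (g (\<sigma> m)) (g (\<sigma> n))" for m n
      by (metis ds s)
    have "MY.MCauchy (\<lambda>n. g (\<sigma> n))"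
      using \<sigma> s(1) unfolding MZ.MCauchy_def MY.MCauchy_def dss by blast
    then obtain y where "limitin MY.mtopology (\<lambda>n. g (\<sigma> n)) y sequentially"
      using cY MY.mcomplete_def by blast
    then have y: "y \<in> carrier Y" "\<forall>\<epsilon>>0. \<exists>N. \<forall>n\<ge>N. vdist Y (g (\<sigma> n)) y < \<epsilon>"
      unfolding MY.limit_metric_sequentially by blast+
    have "f y \<in> carrier Z" "\<sigma> n \<in> carrier Z" for n
      using y(1) s imageI[of "g (\<sigma> n)" "carrier Y" f] by (simp_all add: carZ)
    then have "limitin MZ.mtopology \<sigma> (f y) sequentially"
      unfolding MZ.limit_metric_sequentially ds[OF y(1)] using y(2) by blast
    then show "\<exists>x. limitin MZ.mtopology \<sigma> x sequentially" by blast
  qed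
  moreover have "density_le Z \<kappa>"
  proof -
    obtain D where D: "D \<subseteq> carrier Y" "|D| \<le>o \<kappa>" "MY.mtopology closure_of D = carrier Y"
      using Y by (auto simp: Banach_class_def density_le_def)
    have "|f ` D| \<le>o \<kappa>" using D(2) card_of_image ordLeq_transitive by blast
    moreover have near: "\<exists>y\<in>D. vdist Y x y < r" if "x \<in> carrier Y" "r > 0" for x r
      using D(3) that unfolding MY.metric_closure_of by (auto simp: MY.in_mball)
    have "\<exists>z\<in>f ` D. z \<in> MZ.mball (f x) r" if xr: "x \<in> carrier Y" "r > 0" for x r
    proof -
      obtain y where y: "y \<in> D" "vdist Y x y < r" using near xr by blast
      then have "y \<in> carrier Y" using D(1) by blast
      then have "f y \<in> MZ.mball (f x) r"
        using y(2) xr(1) unfolding MZ.in_mball by (simp add: carZ d)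
      then show ?thesis using y(1) by blast
    qed
    then have "MZ.mtopology closure_of (f ` D) = carrier Z"
      unfolding MZ.metric_closure_of unfolding carZ by blast
    ultimately show ?thesis
      using D(1) unfolding density_le_def by (intro exI[of _ "f ` D"]) (auto simp: carZ)
  qed
  ultimately have "Z \<in> Banach_class \<kappa>" using nZ by (simp add: Banach_class_def banach_on_def)
  moreover have "linear_isometry Y Z f" by (auto simp: linear_isometry_def Z_def gf)
  ultimately show ?thesis by blast
qed

lemma Banach_class_inj:
  fixes \<kappa> :: "'k rel" and Y :: "'y normed_struct"
  assumes \<kappa>: "Card_order \<kappa>" "infinite (Field \<kappa>)" and Y: "Y \<in> Banach_class \<kappa>"
  shows "\<exists>f :: 'y \<Rightarrow> 'k set. inj_on f (carrier Y)"
proof -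
  have nY: "normed_space_on Y" using Y by (auto simp: Banach_class_def banach_on_def)
  interpret MY: Metric_space "carrier Y" "vdist Y" by (rule normed_space_on_Metric_space[OF nY])
  obtain D where D: "D \<subseteq> carrier Y" "|D| \<le>o \<kappa>" "MY.mtopology closure_of D = carrier Y"
    using Y by (auto simp: Banach_class_def density_le_def)
  have "|D| \<le>o |UNIV :: 'k set|"
    using D(2) \<kappa>(1) card_of_Field_ordIso card_of_mono1[of "Field \<kappa>" UNIV]
    by (meson ordIso_symmetric ordLeq_ordIso_trans ordLeq_transitive subset_UNIV)
  then obtain i :: "'y \<Rightarrow> 'k" where i: "inj_on i D" by (auto simp flip: card_of_ordLeq)
  have inf: "infinite (UNIV :: 'k set)" using \<kappa>(2) infinite_super subset_UNIV by blast
  have "|UNIV :: nat set| \<le>o |UNIV :: 'k set|" using inf by (simp add: infinite_iff_card_of_nat)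
  then have "|(UNIV :: 'k set) \<times> (UNIV :: nat set)| \<le>o |UNIV :: 'k set|"
    using card_of_Times_infinite[OF inf, of "UNIV :: nat set"] by (simp add: ordIso_imp_ordLeq)
  then obtain p :: "'k \<times> nat \<Rightarrow> 'k" where p: "inj p" by (auto simp flip: card_of_ordLeq)
  define f where "f y = {p (i d, n) | d n. d \<in> D \<and> vdist Y y d < 1 / Suc n}" for y
  have mem: "p (i d, n) \<in> f y \<longleftrightarrow> vdist Y y d < 1 / Suc n" if "d \<in> D" for d n y
    using that p i by (auto simp: f_def inj_on_eq_iff)
  have "y = z" if yz: "y \<in> carrier Y" "z \<in> carrier Y" "f y = f z" for y z
  proof (rule ccontr)
    assume "y \<noteq> z"
    then have "vdist Y y z / 2 > 0" using yz by simp
    then obtain n where n: "1 / Suc n < vdist Y y z / 2" using nat_approx_posE by blast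
    obtain d where d: "d \<in> D" "vdist Y y d < 1 / Suc n"
    proof -
      have r: "\<forall>r>0. \<exists>d\<in>D. d \<in> MY.mball y r"
        using D(3) yz(1) by (auto simp: MY.metric_closure_of)
      have "0 < 1 / real (Suc n)" by simp
      then obtain d where "d \<in> D" "d \<in> MY.mball y (1 / Suc n)" using r by blast
      then show ?thesis using that[of d] unfolding MY.in_mball by blast
    qed
    then have "vdist Y z d < 1 / Suc n" using mem yz(3) by blast
    moreover have "vdist Y y z \<le> vdist Y y d + vdist Y z d"
      using MY.triangle'[of y d z] d D(1) yz by blast
    ultimately show False using d(2) n by linarith
  qed
  then show ?thesis unfolding inj_on_def by blast
qed

lemma universal_BanachD:
  fixes \<kappa> :: "'k rel" and X :: "'x normed_struct" and Y :: "'y normed_struct"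
  assumes "Card_order \<kappa>" "infinite (Field \<kappa>)" "universal_Banach \<kappa> X" "Y \<in> Banach_class \<kappa>"
  shows "\<exists>T. linear_isometry Y X T"
proof -
  obtain f :: "'y \<Rightarrow> 'k set" where "inj_on f (carrier Y)" using Banach_class_inj assms by blast
  then obtain Z :: "'k set normed_struct"
    where Z: "Z \<in> Banach_class \<kappa>" "linear_isometry Y Z f"
    using Banach_class_transport assms(4) by blast
  then obtain T where "linear_isometry Z X T" using assms(3) by (auto simp: universal_Banach_def)
  then have "linear_isometry Y X (T \<circ> f)"
    using Z(2) by (auto simp: linear_isometry_def Pi_iff)
  then show ?thesis by blast
qed

section \<open>Compact spaces\<close>

definition weight_le :: "'a topology \<Rightarrow> 'k rel \<Rightarrow> bool" where
  "weight_le K \<kappa> \<longleftrightarrow> (\<exists>\<B>. |\<B>| \<le>o \<kappa> \<and> (\<forall>B \<in> \<B>. openin K B) \<and>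
     (\<forall>U x. openin K U \<and> x \<in> U \<longrightarrow> (\<exists>B \<in> \<B>. x \<in> B \<and> B \<subseteq> U)))"

text \<open>
  Compact spaces are nonempty, and Boolean algebras are nondegenerate. Admitting the empty space
  (the one-element algebra) would make universality unattainable, since no nonempty space maps to
  the empty one.
\<close>
definition compact_class :: "'k rel \<Rightarrow> 'a topology set" where
  "compact_class \<kappa> =
     {K. topspace K \<noteq> {} \<and> compact_space K \<and> Hausdorff_space K \<and> weight_le K \<kappa>}"

text \<open>A Hausdorff space of weight at most \<open>\<kappa>\<close> has at most \<open>2\<^sup>\<kappa>\<close> points, so it has a copy on
  \<^typ>\<open>'k set\<close>.\<close>
definition universal_compact :: "'k rel \<Rightarrow> 'a topology \<Rightarrow> bool" where
  "universal_compact \<kappa> K \<longleftrightarrow> K \<in> compact_class \<kappa> \<and>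
     (\<forall>L \<in> (compact_class \<kappa> :: 'k set topology set).
        \<exists>f. continuous_map K L f \<and> f ` topspace K = topspace L)"

text \<open>Functions are normalised to \<^const>\<open>undefined\<close> off the space. Only nonempty \<open>K\<close> are relevant.\<close>
definition C_space :: "'a topology \<Rightarrow> ('a \<Rightarrow> real) normed_struct" where
  "C_space K = \<lparr>
     carrier = {f \<in> extensional (topspace K). continuous_map K euclideanreal f},
     vadd = (\<lambda>f g. restrict (\<lambda>x. f x + g x) (topspace K)),
     vzero = restrict (\<lambda>x. 0) (topspace K),
     vscale = (\<lambda>a f. restrict (\<lambda>x. a * f x) (topspace K)),
     vnorm = (\<lambda>f. SUP x \<in> topspace K. \<bar>f x\<bar>)\<rparr>"

section \<open>Boolean algebras\<close>

locale boolean_algebra_on = bounded_lattice +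
  assumes meet_join_distrib: "\<lbrakk>x \<in> carrier L; y \<in> carrier L; z \<in> carrier L\<rbrakk>
          \<Longrightarrow> x \<sqinter> (y \<squnion> z) = (x \<sqinter> y) \<squnion> (x \<sqinter> z)"
    and complemented: "x \<in> carrier L \<Longrightarrow> \<exists>y \<in> carrier L. x \<sqinter> y = \<bottom> \<and> x \<squnion> y = \<top>"
    and nondegenerate: "\<bottom> \<noteq> \<top>"

text \<open>Preservation of complements follows from the other clauses.\<close>
definition boolean_hom :: "'a gorder \<Rightarrow> 'b gorder \<Rightarrow> ('a \<Rightarrow> 'b) \<Rightarrow> bool" where
  "boolean_hom A B h \<longleftrightarrow> h \<in> carrier A \<rightarrow> carrier B \<and> join_pres A B h \<and> meet_pres A B h \<and>
     h \<bottom>\<^bsub>A\<^esub> = \<bottom>\<^bsub>B\<^esub> \<and> h \<top>\<^bsub>A\<^esub> = \<top>\<^bsub>B\<^esub>"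

definition boolean_class :: "'k rel \<Rightarrow> 'a gorder set" where
  "boolean_class \<kappa> = {A. boolean_algebra_on A \<and> |carrier A| \<le>o \<kappa>}"

text \<open>An algebra with at most \<open>\<kappa>\<close> elements has a copy with carrier in \<^typ>\<open>'k\<close>.\<close>
definition universal_boolean :: "'k rel \<Rightarrow> 'a gorder \<Rightarrow> bool" where
  "universal_boolean \<kappa> A \<longleftrightarrow> A \<in> boolean_class \<kappa> \<and>
     (\<forall>B \<in> (boolean_class \<kappa> :: 'k gorder set).
        \<exists>h. boolean_hom B A h \<and> inj_on h (carrier B))"

definition wellordered_chain :: "'a gorder \<Rightarrow> 'a set \<Rightarrow> bool" where
  "wellordered_chain A C \<longleftrightarrow> C \<subseteq> carrier A \<and>
     well_order_on C {(x, y). x \<in> C \<and> y \<in> C \<and> x \<sqsubseteq>\<^bsub>A\<^esub> y}"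

section \<open>Stone spaces\<close>

definition clopen_algebra :: "'a topology \<Rightarrow> 'a set gorder" where
  "clopen_algebra K = \<lparr>carrier = {U. openin K U \<and> closedin K U}, eq = (=), le = (\<subseteq>)\<rparr>"

text \<open>This determines \<open>K\<close> up to homeomorphism; points of \<open>K\<close> need not be ultrafilters.\<close>
definition Stone_space_of :: "'a gorder \<Rightarrow> 'b topology \<Rightarrow> bool" where
  "Stone_space_of A K \<longleftrightarrow> compact_space K \<and> Hausdorff_space K \<and>
     (\<forall>x \<in> topspace K. connected_component_of_set K x = {x}) \<and>
     (\<exists>h. boolean_hom A (clopen_algebra K) h \<and>
          bij_betw h (carrier A) (carrier (clopen_algebra K)))"

end

theory Submission
  imports Defs
begin

text \<open>
  Let \<open>X\<close> be isometrically universal, \<open>D\<close> a dense subset of \<open>X\<close> with at most \<open>\<kappa>\<close> elements, and \<open>B\<close> the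
  unit ball of the dual of \<open>X\<close> with the topology of pointwise convergence. By Hahn--Banach, evaluation
  embeds \<open>X\<close> isometrically into the continuous functions on \<open>B\<close>, hence into \<open>C(K)\<close> for every compact
  \<open>K\<close> that maps continuously onto \<open>B\<close> (\<open>isometry_into_C_space\<close>). So \<open>C(K)\<close> is universal once \<open>K\<close> has
  few clopen sets and is zero-dimensional. The values at the points of \<open>D\<close>, rescaled to the unit
  interval, exhibit \<open>B\<close> as a closed convex subset of \<open>[0,1]\<^sup>D\<close>. The space \<open>K\<close> consists of all ways to
  write the coordinates of a point of \<open>B\<close> in binary; it is a closed subspace of the Cantor cube on
  \<open>D \<times> \<nat>\<close>. The Boolean algebra \<open>A\<close> is the algebra of clopen subsets of \<open>K\<close>.

  Convexity of \<open>B\<close> is what prevents uncountable well-ordered chains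
  (\<open>no_uncountable_wellordered_clopen_chain\<close>). A clopen subset of \<open>K\<close> depends on finitely many
  coordinates only, and after a Delta-system argument one may assume that the clopen sets of the chain
  pairwise share, up to countably many exceptions for each of them, only the coordinates of a fixed
  finite set \<open>R\<close>, and that only points with prescribed leading digits on \<open>R\<close> matter. Suppose that
  \<open>U \<subset> V\<close> are two such sets and that a point of \<open>U\<close> and a point outside \<open>V\<close> were expansions of the
  same element of \<open>B\<close>. The expansion of an element of \<open>B\<close> may be chosen separately in each coordinate,
  so one could use the digits of the second point on the coordinates of \<open>V\<close> and those of the first
  elsewhere, and obtain a point of \<open>U\<close> outside \<open>V\<close>, although \<open>U \<subset> V\<close>
  (\<open>points_separated\<close>). By compactness such pairs lie over points of \<open>B\<close> at a distance at least
  \<open>\<epsilon> = \<epsilon>(U,V) > 0\<close> (\<open>uniformly_separated\<close>), and one value of \<open>\<epsilon>\<close> serves uncountably many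
  sets of the chain. Now take \<open>U\<^sub>0 \<subset> V\<^sub>0 \<subset> U\<^sub>1 \<subset> V\<^sub>1 \<subset> \<dots> \<subset> V\<^sub>N\<close> in the chain with \<open>N > 1/\<epsilon>\<close> and walk
  along the segment in \<open>B\<close> from a point of \<open>U\<^sub>0\<close> to a point outside \<open>V\<^sub>N\<close> in \<open>N\<close> equal steps. Each step is
  shorter than \<open>\<epsilon>\<close>, so after \<open>i\<close> steps the walk is still in \<open>V\<^sub>i\<close>; its end would be in \<open>V\<^sub>N\<close>, a
  contradiction.

  The space of initial segments of \<open>\<kappa>\<close> has a chain of clopen sets of order type \<open>\<kappa>\<close>. A Boolean
  embedding of its clopen algebra into \<open>A\<close>, or a continuous surjection from \<open>K\<close> onto it, would carry
  that chain over to \<open>A\<close> or to the clopen algebra of \<open>K\<close>. This gives the two failures of universality.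
\<close>

section \<open>Cardinality of the set of finite lists\<close>

lemma card_of_lists_ordLeq:
  assumes "Card_order \<kappa>" "infinite (Field \<kappa>)" "|A| \<le>o \<kappa>"
  shows "|lists A| \<le>o \<kappa>"
proof -
  have nil: "|{[] :: 'b list}| \<le>o \<kappa>"
    using assms(1,2) by (metis Card_order_singl_ordLeq finite.emptyI)
  have len: "|{xs \<in> lists A. length xs = n}| \<le>o \<kappa>" for n
  proof (induction n)
    case 0
    have "{xs \<in> lists A. length xs = 0} = {[]}" by auto
    then show ?case using nil by simp
  next
    case (Suc n)
    have "{xs \<in> lists A. length xs = Suc n}
        = (\<lambda>(x, xs). x # xs) ` (A \<times> {xs \<in> lists A. length xs = n})"
      by (force simp: length_Suc_conv)
    moreover have "|A \<times> {xs \<in> lists A. length xs = n}| \<le>o \<kappa>"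
      using card_of_Times_ordLeq_infinite_Field[OF assms(2,3) Suc assms(1)] .
    ultimately show ?case by (simp only: ordLeq_transitive[OF card_of_image])
  qed
  have "lists A = (\<Union>n. {xs \<in> lists A. length xs = n})" by auto
  moreover have "|UNIV :: nat set| \<le>o \<kappa>"
    using assms(1,2) by (meson card_of_Field_ordIso infinite_iff_card_of_nat ordLeq_ordIso_trans)
  ultimately show ?thesis
    using card_of_UNION_ordLeq_infinite_Field[OF assms(2,1), of UNIV "\<lambda>n. {xs \<in> lists A. length xs = n}"]
      len by simp
qed

section \<open>Cantor cubes and their closed subspaces\<close>

text \<open>
  The power set of \<open>I\<close> with the topology of \<open>2\<^sup>I\<close>. Points are sets rather than characteristic
  functions, because the compact spaces of the theorem live on \<^typ>\<open>'k set\<close>.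
\<close>
definition cantor_cube :: "'a set \<Rightarrow> 'a set topology" where
  "cantor_cube I = topology (\<lambda>\<U>. \<U> \<subseteq> Pow I \<and>
     (\<forall>S \<in> \<U>. \<exists>E. finite E \<and> E \<subseteq> I \<and> (\<forall>S'. S' \<subseteq> I \<and> S' \<inter> E = S \<inter> E \<longrightarrow> S' \<in> \<U>)))"

lemma openin_cantor_cube:
  "openin (cantor_cube I) \<U> \<longleftrightarrow> \<U> \<subseteq> Pow I \<and>
     (\<forall>S \<in> \<U>. \<exists>E. finite E \<and> E \<subseteq> I \<and> (\<forall>S'. S' \<subseteq> I \<and> S' \<inter> E = S \<inter> E \<longrightarrow> S' \<in> \<U>))"
proof -
  let ?P = "\<lambda>\<U>. \<U> \<subseteq> Pow I \<and>
     (\<forall>S \<in> \<U>. \<exists>E. finite E \<and> E \<subseteq> I \<and> (\<forall>S'. S' \<subseteq> I \<and> S' \<inter> E = S \<inter> E \<longrightarrow> S' \<in> \<U>))"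
  have "istopology ?P"
    unfolding istopology_def
  proof (intro conjI allI impI)
    fix \<U> \<V> assume U: "?P \<U>" and V: "?P \<V>"
    show "\<U> \<inter> \<V> \<subseteq> Pow I" using U by blast
    show "\<forall>S\<in>\<U> \<inter> \<V>. \<exists>E. finite E \<and> E \<subseteq> I \<and> (\<forall>S'. S' \<subseteq> I \<and> S' \<inter> E = S \<inter> E \<longrightarrow> S' \<in> \<U> \<inter> \<V>)"
    proof
      fix S assume S: "S \<in> \<U> \<inter> \<V>"
      obtain E where E: "finite E" "E \<subseteq> I" "\<And>S'. S' \<subseteq> I \<Longrightarrow> S' \<inter> E = S \<inter> E \<Longrightarrow> S' \<in> \<U>"
        using U S by (meson IntD1)
      obtain F where F: "finite F" "F \<subseteq> I" "\<And>S'. S' \<subseteq> I \<Longrightarrow> S' \<inter> F = S \<inter> F \<Longrightarrow> S' \<in> \<V>"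
        using V S by (meson IntD2)
      have "S' \<in> \<U> \<inter> \<V>" if "S' \<subseteq> I" "S' \<inter> (E \<union> F) = S \<inter> (E \<union> F)" for S'
        using E(3)[of S'] F(3)[of S'] that by blast
      then show "\<exists>E. finite E \<and> E \<subseteq> I \<and> (\<forall>S'. S' \<subseteq> I \<and> S' \<inter> E = S \<inter> E \<longrightarrow> S' \<in> \<U> \<inter> \<V>)"
        using E(1,2) F(1,2) by (metis finite_UnI Un_subset_iff)
    qed
  next
    fix \<K> assume K: "\<forall>K\<in>\<K>. ?P K"
    then show "\<Union>\<K> \<subseteq> Pow I" by blast
    show "\<forall>S\<in>\<Union>\<K>. \<exists>E. finite E \<and> E \<subseteq> I \<and> (\<forall>S'. S' \<subseteq> I \<and> S' \<inter> E = S \<inter> E \<longrightarrow> S' \<in> \<Union>\<K>)"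
    proof
      fix S assume "S \<in> \<Union>\<K>"
      then obtain \<U> where \<U>: "\<U> \<in> \<K>" "S \<in> \<U>" by blast
      from bspec[OF conjunct2[OF bspec[OF K \<U>(1)]] \<U>(2)] obtain E where E: "finite E" "E \<subseteq> I"
          "\<forall>S'. S' \<subseteq> I \<and> S' \<inter> E = S \<inter> E \<longrightarrow> S' \<in> \<U>"
        by (elim exE conjE)
      have "\<forall>S'. S' \<subseteq> I \<and> S' \<inter> E = S \<inter> E \<longrightarrow> S' \<in> \<Union>\<K>"
        using E(3) \<U>(1) by (meson UnionI)
      then show "\<exists>E. finite E \<and> E \<subseteq> I \<and> (\<forall>S'. S' \<subseteq> I \<and> S' \<inter> E = S \<inter> E \<longrightarrow> S' \<in> \<Union>\<K>)"
        using E(1,2) by (intro exI[of _ E] conjI)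
    qed
  qed
  then show ?thesis by (simp add: cantor_cube_def)
qed

lemma topspace_cantor_cube [simp]: "topspace (cantor_cube I) = Pow I"
proof -
  have "openin (cantor_cube I) (Pow I)" by (auto simp: openin_cantor_cube)
  then show ?thesis
    by (metis openin_cantor_cube openin_subset openin_topspace subset_antisym)
qed

text \<open>Tychonoff's theorem, carried over along the map that sends a characteristic function to its set.\<close>
lemma compact_cantor_cube: "compact_space (cantor_cube I)"
proof -
  let ?P = "product_topology (\<lambda>_. discrete_topology (UNIV :: bool set)) I"
  let ?f = "\<lambda>x. {i \<in> I. x i}"
  have cont: "continuous_map ?P (cantor_cube I) ?f"
  proof (unfold continuous_map_def, intro conjI allI impI)
    show "?f \<in> topspace ?P \<rightarrow> topspace (cantor_cube I)" by auto
    fix \<U> assume U: "openin (cantor_cube I) \<U>"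
    show "openin ?P {x \<in> topspace ?P. ?f x \<in> \<U>}"
      unfolding openin_product_topology_alt
    proof (intro ballI)
      fix x assume x: "x \<in> {x \<in> topspace ?P. ?f x \<in> \<U>}"
      obtain E where E: "finite E" "E \<subseteq> I"
          "\<And>S'. S' \<subseteq> I \<Longrightarrow> S' \<inter> E = ?f x \<inter> E \<Longrightarrow> S' \<in> \<U>"
        using U x unfolding openin_cantor_cube by (metis (no_types, lifting) mem_Collect_eq)
      let ?U = "\<lambda>i. if i \<in> E then {x i} else UNIV"
      have fin: "finite {i \<in> I. ?U i \<noteq> topspace (discrete_topology (UNIV :: bool set))}"
        by (rule finite_subset[OF _ E(1)]) (auto split: if_splits)
      have xin: "x \<in> Pi\<^sub>E I ?U" using x by (auto simp: PiE_iff)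
      have "y \<in> {x \<in> topspace ?P. ?f x \<in> \<U>}" if y: "y \<in> Pi\<^sub>E I ?U" for y
      proof -
        have "y i = x i" if "i \<in> E" for i
          using PiE_mem[OF y, of i] that E(2) by auto
        then have "?f y \<in> \<U>" by (intro E(3)) auto
        then show ?thesis using y by (simp add: PiE_iff)
      qed
      then have sub: "Pi\<^sub>E I ?U \<subseteq> {x \<in> topspace ?P. ?f x \<in> \<U>}" by (rule subsetI)
      show "\<exists>U. finite {i \<in> I. U i \<noteq> topspace (discrete_topology (UNIV :: bool set))} \<and>
          (\<forall>i\<in>I. openin (discrete_topology UNIV) (U i)) \<and> x \<in> Pi\<^sub>E I U \<and>
          Pi\<^sub>E I U \<subseteq> {x \<in> topspace ?P. ?f x \<in> \<U>}"
        by (rule exI[of _ ?U], intro conjI fin xin sub) simp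
    qed
  qed
  moreover have "compact_space ?P"
    by (simp add: compact_space_product_topology compact_space_discrete_topology)
  moreover have "?f ` topspace ?P = topspace (cantor_cube I)"
  proof -
    have "S \<in> ?f ` topspace ?P" if "S \<subseteq> I" for S
      using that by (intro image_eqI[of _ _ "restrict (\<lambda>i. i \<in> S) I"]) auto
    then show ?thesis by auto
  qed
  ultimately show ?thesis
    using image_compactin[OF _ cont, of "topspace ?P"] unfolding compact_space_def by simp
qed

lemma clopen_membership:
  assumes "i \<in> I"
  shows "openin (cantor_cube I) {S. S \<subseteq> I \<and> i \<in> S}" "openin (cantor_cube I) {S. S \<subseteq> I \<and> i \<notin> S}"
  using assms unfolding openin_cantor_cube by (auto intro!: exI[of _ "{i}"])

lemma Hausdorff_cantor_cube: "Hausdorff_space (cantor_cube I)"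
  unfolding Hausdorff_space_def
proof (intro allI impI)
  fix S T assume ST: "S \<in> topspace (cantor_cube I) \<and> T \<in> topspace (cantor_cube I) \<and> S \<noteq> T"
  then obtain i where i: "i \<in> I" "i \<in> S \<longleftrightarrow> i \<notin> T" by auto
  define A B where "A = {S. S \<subseteq> I \<and> i \<in> S}" and "B = {S. S \<subseteq> I \<and> i \<notin> S}"
  have "openin (cantor_cube I) A" "openin (cantor_cube I) B" "disjnt A B" "disjnt B A"
    using clopen_membership[OF i(1)] by (auto simp: A_def B_def disjnt_def)
  moreover have "S \<in> A \<and> T \<in> B \<or> S \<in> B \<and> T \<in> A"
    using i ST by (auto simp: A_def B_def)
  ultimately show "\<exists>U V. openin (cantor_cube I) U \<and> openin (cantor_cube I) V \<and> S \<in> U \<and> T \<in> V \<and> disjnt U V"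
    by metis
qed

lemma openin_finite_pattern:
  assumes "finite E" "E \<subseteq> I" "P \<subseteq> I"
  shows "openin (cantor_cube I) {S. S \<subseteq> I \<and> S \<inter> E = P \<inter> E}"
  using assms unfolding openin_cantor_cube by (auto intro!: exI[of _ E])

lemma continuous_map_cantor_cube:
  assumes "\<And>S e. S \<subseteq> I \<Longrightarrow> 0 < (e::real) \<Longrightarrow>
    \<exists>E. finite E \<and> E \<subseteq> I \<and> (\<forall>S'. S' \<subseteq> I \<and> S' \<inter> E = S \<inter> E \<longrightarrow> \<bar>f S' - f S\<bar> < e)"
  shows "continuous_map (cantor_cube I) euclideanreal f"
  unfolding continuous_map_def
proof (intro conjI allI impI)
  fix U :: "real set" assume "openin euclideanreal U"
  then have U: "open U" by simp
  show "openin (cantor_cube I) {S \<in> topspace (cantor_cube I). f S \<in> U}"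
    unfolding openin_cantor_cube
  proof (intro conjI ballI)
    fix S assume "S \<in> {S \<in> topspace (cantor_cube I). f S \<in> U}"
    then have S: "S \<subseteq> I" "f S \<in> U" by auto
    then obtain e where e: "0 < e" "\<And>y. dist y (f S) < e \<Longrightarrow> y \<in> U"
      using U open_dist by metis
    then obtain E where E: "finite E" "E \<subseteq> I"
        "\<forall>S'. S' \<subseteq> I \<and> S' \<inter> E = S \<inter> E \<longrightarrow> \<bar>f S' - f S\<bar> < e"
      using assms S(1) by meson
    then have "\<forall>S'. S' \<subseteq> I \<and> S' \<inter> E = S \<inter> E \<longrightarrow> S' \<in> {S \<in> topspace (cantor_cube I). f S \<in> U}"
      using e(2) by (simp add: dist_real_def)
    with E(1,2) show "\<exists>E. finite E \<and> E \<subseteq> I \<and>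
        (\<forall>S'. S' \<subseteq> I \<and> S' \<inter> E = S \<inter> E \<longrightarrow> S' \<in> {S \<in> topspace (cantor_cube I). f S \<in> U})"
      by (intro exI[of _ E] conjI)
  qed auto
qed simp

locale cantor_closed =
  fixes I :: "'a set" and K :: "'a set topology" and Z :: "'a set set"
  assumes K: "K = subtopology (cantor_cube I) Z" and Z: "closedin (cantor_cube I) Z"
begin

lemma topspace_K: "topspace K = Z"
  using K Z closedin_subset by fastforce

lemma Z_subset: "S \<in> Z \<Longrightarrow> S \<subseteq> I"
  using closedin_subset[OF Z] by auto

lemma compact_K: "compact_space K"
  using K Z compact_cantor_cube closedin_compact_space compact_space_subtopology by blast

lemma Hausdorff_K: "Hausdorff_space K"
  using K Hausdorff_cantor_cube Hausdorff_space_subtopology by blast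

text \<open>For finite \<open>E \<subseteq> I\<close> these are the basic clopen sets of the subspace.\<close>
definition pattern :: "'a set \<Rightarrow> 'a set \<Rightarrow> 'a set set" where
  "pattern E P = {S \<in> Z. S \<inter> E = P \<inter> E}"

lemma openin_pattern:
  assumes "finite E" "E \<subseteq> I" "P \<subseteq> I"
  shows "openin K (pattern E P)"
proof -
  have "pattern E P = {S. S \<subseteq> I \<and> S \<inter> E = P \<inter> E} \<inter> Z"
    using Z_subset by (auto simp: pattern_def)
  then show ?thesis
    using K openin_finite_pattern[OF assms] by (simp add: openin_subtopology_Int)
qed

lemma openin_K_pattern:
  assumes "openin K U" "S \<in> U"
  obtains E where "finite E" "E \<subseteq> I" "pattern E S \<subseteq> U"
proof -
  obtain V where V: "openin (cantor_cube I) V" "U = V \<inter> Z"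
    using assms(1) K by (auto simp: openin_subtopology)
  obtain E where E: "finite E" "E \<subseteq> I" "\<forall>S'. S' \<subseteq> I \<and> S' \<inter> E = S \<inter> E \<longrightarrow> S' \<in> V"
    using V assms(2) unfolding openin_cantor_cube by (metis IntD1)
  have "T \<in> U" if "T \<in> pattern E S" for T
    using that E(3) V(2) Z_subset[of T] by (simp add: pattern_def)
  then show ?thesis using that[OF E(1,2)] by blast
qed

lemma closedin_pattern:
  assumes "finite E" "E \<subseteq> I" "P \<subseteq> I"
  shows "closedin K (pattern E P)"
proof -
  have "topspace K - pattern E P = (\<Union>S \<in> Z - pattern E P. pattern E S)"
    by (auto simp: topspace_K pattern_def)
  moreover have "openin K (\<Union>S \<in> Z - pattern E P. pattern E S)"
    using openin_pattern assms Z_subset by (intro openin_Union) auto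
  ultimately show ?thesis
    unfolding closedin_def by (auto simp: topspace_K pattern_def)
qed

lemma clopen_finite_Union_patterns:
  assumes "openin K U" "closedin K U"
  obtains \<F> where "finite \<F>" "\<forall>(E, S) \<in> \<F>. finite E \<and> E \<subseteq> I \<and> S \<in> Z"
    "U = (\<Union>(E, S) \<in> \<F>. pattern E S)"
proof -
  have "\<forall>S \<in> U. \<exists>E. finite E \<and> E \<subseteq> I \<and> pattern E S \<subseteq> U"
    using openin_K_pattern[OF assms(1)] by metis
  then obtain E where E: "\<And>S. S \<in> U \<Longrightarrow> finite (E S) \<and> E S \<subseteq> I \<and> pattern (E S) S \<subseteq> U"
    by metis
  have UZ: "U \<subseteq> Z" using assms(1) openin_subset topspace_K by blast
  have "compactin K U" using assms(2) compact_K closedin_compact_space by blast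
  moreover have "openin K (pattern (E S) S)" if "S \<in> U" for S
    using E[OF that] Z_subset[of S] UZ that by (intro openin_pattern) auto
  then have "\<forall>V \<in> (\<lambda>S. pattern (E S) S) ` U. openin K V" by blast
  moreover have "U \<subseteq> \<Union>((\<lambda>S. pattern (E S) S) ` U)"
    using UZ by (auto simp: pattern_def)
  ultimately obtain \<G> where \<G>: "finite \<G>" "\<G> \<subseteq> (\<lambda>S. pattern (E S) S) ` U" "U \<subseteq> \<Union>\<G>"
    unfolding compactin_def by meson
  then obtain W where W: "W \<subseteq> U" "finite W" "\<G> = (\<lambda>S. pattern (E S) S) ` W"
    by (meson finite_subset_image)
  show ?thesis
  proof (rule that[of "(\<lambda>S. (E S, S)) ` W"])
    show "U = (\<Union>(E, S) \<in> (\<lambda>S. (E S, S)) ` W. pattern E S)"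
    proof -
      have "U \<subseteq> (\<Union>S\<in>W. pattern (E S) S)" using \<G>(3) W(3) by simp
      moreover have "(\<Union>S\<in>W. pattern (E S) S) \<subseteq> U"
        using W(1) E by (intro UN_least) blast
      ultimately show ?thesis by simp
    qed
  qed (use W E UZ in auto)
qed

text \<open>
  A clopen set is compact, hence a finite union of basic sets; the finitely many indices that occur in
  them decide membership.
\<close>
lemma clopen_finite_support:
  assumes "openin K U" "closedin K U"
  obtains E where "finite E" "E \<subseteq> I"
    "\<And>S S'. S \<in> U \<Longrightarrow> S' \<in> Z \<Longrightarrow> S \<inter> E = S' \<inter> E \<Longrightarrow> S' \<in> U"
proof -
  obtain \<F> where F: "finite \<F>" "\<forall>(E, S) \<in> \<F>. finite E \<and> E \<subseteq> I \<and> S \<in> Z"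
    "U = (\<Union>(E, S) \<in> \<F>. pattern E S)"
    by (rule clopen_finite_Union_patterns[OF assms])
  show ?thesis
  proof (rule that[of "\<Union>(fst ` \<F>)"])
    show "finite (\<Union>(fst ` \<F>))" "\<Union>(fst ` \<F>) \<subseteq> I" using F(1,2) by (auto, blast+)
    fix S S' assume S: "S \<in> U" "S' \<in> Z" "S \<inter> \<Union>(fst ` \<F>) = S' \<inter> \<Union>(fst ` \<F>)"
    then obtain E P where EP: "(E, P) \<in> \<F>" "S \<in> pattern E P" using F(3) by auto
    then have "E \<subseteq> \<Union>(fst ` \<F>)" by force
    then have "S \<inter> E = S' \<inter> E" using S(3) by blast
    then have "S' \<in> pattern E P" using EP(2) S(2) by (auto simp: pattern_def)
    then show "S' \<in> U" using F(3) EP(1) by blast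
  qed
qed

text \<open>Finite unions of patterns are coded by finite lists of pairs of finite lists of indices.\<close>
lemma card_of_clopen:
  assumes "Card_order \<kappa>" "infinite (Field \<kappa>)" "|I| \<le>o \<kappa>"
  shows "|carrier (clopen_algebra K)| \<le>o \<kappa>"
proof -
  let ?L = "lists (lists I \<times> lists I)"
  let ?f = "\<lambda>l. \<Union>(e, q) \<in> set l. pattern (set e) (set q)"
  have "U \<in> ?f ` ?L" if U: "openin K U" "closedin K U" for U
  proof -
    obtain \<F> where F: "finite \<F>" "\<forall>(E, S) \<in> \<F>. finite E \<and> E \<subseteq> I \<and> S \<in> Z"
      "U = (\<Union>(E, S) \<in> \<F>. pattern E S)"
      by (rule clopen_finite_Union_patterns[OF U])
    have "\<exists>e q. e \<in> lists I \<and> q \<in> lists I \<and> pattern (set e) (set q) = pattern E S"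
      if ES: "(E, S) \<in> \<F>" for E S
    proof -
      have E: "finite E" "E \<subseteq> I" "S \<in> Z" using F(2) ES by auto
      then have "finite (S \<inter> E)" by blast
      then obtain e q where "set e = E" "set q = S \<inter> E" using finite_list E(1) by meson
      then show ?thesis using E
        by (intro exI[of _ e] exI[of _ q]) (auto simp: pattern_def)
    qed
    then obtain e q where eq: "\<And>E S. (E, S) \<in> \<F> \<Longrightarrow>
       e E S \<in> lists I \<and> q E S \<in> lists I \<and> pattern (set (e E S)) (set (q E S)) = pattern E S"
      by metis
    obtain l where l: "set l = \<F>" using finite_list[OF F(1)] by blast
    let ?l = "map (\<lambda>(E, S). (e E S, q E S)) l"
    have "(e (fst x) (snd x), q (fst x) (snd x)) \<in> lists I \<times> lists I" if "x \<in> set l" for x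
      using eq[of "fst x" "snd x"] that l by simp
    then have "?l \<in> ?L" by (simp add: case_prod_beta lists_eq_set image_subset_iff)
    moreover have "?f ?l = (\<Union>(E, S) \<in> \<F>. pattern E S)"
      unfolding l[symmetric] using eq l by (auto simp: case_prod_beta)
    then have "U = ?f ?l" using F(3) by simp
    ultimately show ?thesis by blast
  qed
  then have "carrier (clopen_algebra K) \<subseteq> ?f ` ?L" by (auto simp: clopen_algebra_def)
  moreover have "|?L| \<le>o \<kappa>"
    using assms by (intro card_of_lists_ordLeq card_of_Times_ordLeq_infinite_Field)
  ultimately show ?thesis
    by (meson card_of_image card_of_mono1 ordLeq_transitive)
qed

lemma clopen_base:
  assumes "openin K U" "S \<in> U"
  obtains V where "openin K V" "closedin K V" "S \<in> V" "V \<subseteq> U"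
proof -
  obtain E where E: "finite E" "E \<subseteq> I" "pattern E S \<subseteq> U"
    by (rule openin_K_pattern[OF assms])
  have S: "S \<in> Z" using assms openin_subset topspace_K by blast
  have "S \<in> pattern E S" using S by (simp add: pattern_def)
  then show ?thesis
    using that openin_pattern[OF E(1,2) Z_subset[OF S]] closedin_pattern[OF E(1,2) Z_subset[OF S]] E(3)
    by blast
qed

lemma weight_le_K:
  assumes "Card_order \<kappa>" "infinite (Field \<kappa>)" "|I| \<le>o \<kappa>"
  shows "weight_le K \<kappa>"
  unfolding weight_le_def
proof (intro exI[of _ "carrier (clopen_algebra K)"] conjI ballI allI impI)
  show "|carrier (clopen_algebra K)| \<le>o \<kappa>" using card_of_clopen[OF assms] .
  show "openin K B" if "B \<in> carrier (clopen_algebra K)" for B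
    using that by (simp add: clopen_algebra_def)
  fix U S assume "openin K U \<and> S \<in> U"
  then obtain V where "openin K V" "closedin K V" "S \<in> V" "V \<subseteq> U"
    using clopen_base[of U S] by blast
  then show "\<exists>B\<in>carrier (clopen_algebra K). S \<in> B \<and> B \<subseteq> U"
    by (auto simp: clopen_algebra_def)
qed

lemma connected_component_K:
  assumes "S \<in> topspace K"
  shows "connected_component_of_set K S = {S}"
proof -
  have "T = S" if T: "connected_component_of K S T" for T
  proof (rule ccontr)
    assume "T \<noteq> S"
    from T obtain C where C: "connectedin K C" "S \<in> C" "T \<in> C"
      unfolding connected_component_of_def by (elim exE conjE)
    have SZ: "S \<in> Z" "T \<in> Z"
      using C(2,3) subsetD[OF connectedin_subset_topspace[OF C(1)]] topspace_K by simp_all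
    then obtain i where i: "i \<in> I" "i \<in> S \<longleftrightarrow> i \<notin> T"
      using \<open>T \<noteq> S\<close> Z_subset[OF SZ(1)] Z_subset[OF SZ(2)] by blast
    have iS: "finite {i}" "{i} \<subseteq> I" "S \<subseteq> I" using i(1) Z_subset[OF SZ(1)] by simp_all
    have "S \<in> pattern {i} S" "T \<notin> pattern {i} S" using SZ i(2) by (auto simp: pattern_def)
    moreover have "C \<subseteq> pattern {i} S \<or> disjnt C (pattern {i} S)"
      by (rule connectedin_clopen_cases[OF C(1) closedin_pattern[OF iS] openin_pattern[OF iS]])
    ultimately show False
      using C(2,3) unfolding disjnt_iff by blast
  qed
  then show ?thesis using assms connected_component_of_refl[of K S] by blast
qed

end

section \<open>Binary expansions\<close>

definition binary_value :: "(nat \<Rightarrow> bool) \<Rightarrow> real" where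
  "binary_value b = (\<Sum>n. of_bool (b n) * (1/2) ^ Suc n)"

lemma summable_binary: "summable (\<lambda>n. of_bool (b n) * (1/2 :: real) ^ Suc n)"
proof (rule summable_comparison_test'[of "\<lambda>n. (1/2 :: real) ^ Suc n" 0])
  show "summable (\<lambda>n. (1/2 :: real) ^ Suc n)" using power_half_series sums_summable by blast
qed simp

lemma binary_value_bounds: "0 \<le> binary_value b" "binary_value b \<le> 1"
proof -
  show "0 \<le> binary_value b" unfolding binary_value_def
    by (rule suminf_nonneg[OF summable_binary]) simp
  have "binary_value b \<le> (\<Sum>n. (1/2 :: real) ^ Suc n)" unfolding binary_value_def
    by (rule suminf_le[OF _ summable_binary sums_summable[OF power_half_series]]) simp
  then show "binary_value b \<le> 1" using power_half_series sums_unique by metis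
qed

lemma binary_value_split:
  "binary_value b = (\<Sum>n<m. of_bool (b n) * (1/2) ^ Suc n) + (1/2) ^ m * binary_value (\<lambda>n. b (n + m))"
proof -
  have "(\<Sum>n. of_bool (b (n + m)) * (1/2 :: real) ^ Suc (n + m))
      = (1/2) ^ m * (\<Sum>n. of_bool (b (n + m)) * (1/2) ^ Suc n)"
    by (subst suminf_mult[OF summable_binary, symmetric]) (simp add: power_add algebra_simps)
  then show ?thesis
    unfolding binary_value_def using suminf_split_initial_segment[OF summable_binary, of b m] by simp
qed

lemma binary_value_close:
  assumes "\<And>n. n < m \<Longrightarrow> b n = c n"
  shows "\<bar>binary_value b - binary_value c\<bar> \<le> (1/2) ^ m"
proof -
  have "binary_value b - binary_value c
      = (1/2) ^ m * (binary_value (\<lambda>n. b (n + m)) - binary_value (\<lambda>n. c (n + m)))"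
    using assms by (simp add: binary_value_split[of b m] binary_value_split[of c m] algebra_simps)
  moreover have "\<bar>binary_value (\<lambda>n. b (n + m)) - binary_value (\<lambda>n. c (n + m))\<bar> \<le> 1"
    using binary_value_bounds[of "\<lambda>n. b (n + m)"] binary_value_bounds[of "\<lambda>n. c (n + m)"] by linarith
  ultimately show ?thesis
    by (simp add: abs_mult mult_left_le)
qed

text \<open>
  The digits of \<open>r < 1\<close> are the carries between consecutive floors \<open>\<lfloor>2\<^sup>n r\<rfloor>\<close>, and the partial sums
  telescope. The number \<open>1\<close> needs the constant sequence of ones.
\<close>
lemma binary_value_surj:
  assumes "0 \<le> r" "r \<le> 1"
  obtains b where "binary_value b = r"
proof (cases "r = 1")
  case True
  have "binary_value (\<lambda>_. True) = 1"
    unfolding binary_value_def using sums_unique[OF power_half_series] by simp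
  then show ?thesis using that True by blast
next
  case False
  define a where "a n = of_int \<lfloor>2 ^ n * r\<rfloor> / (2 ^ n :: real)" for n
  define b where "b n \<longleftrightarrow> \<lfloor>2 ^ Suc n * r\<rfloor> \<noteq> 2 * \<lfloor>2 ^ n * r\<rfloor>" for n
  have step: "of_bool (b n) * (1/2 :: real) ^ Suc n = a (Suc n) - a n" for n
  proof -
    define y where "y = 2 ^ n * r"
    have "2 ^ Suc n * r = 2 * y" by (simp add: y_def)
    moreover have "2 * \<lfloor>y\<rfloor> \<le> \<lfloor>2 * y\<rfloor>" "\<lfloor>2 * y\<rfloor> \<le> 2 * \<lfloor>y\<rfloor> + 1"
      by linarith+
    ultimately have "\<lfloor>2 ^ Suc n * r\<rfloor> = 2 * \<lfloor>2 ^ n * r\<rfloor> \<or> \<lfloor>2 ^ Suc n * r\<rfloor> = 2 * \<lfloor>2 ^ n * r\<rfloor> + 1"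
      unfolding y_def by presburger
    then have "\<lfloor>2 ^ Suc n * r\<rfloor> = 2 * \<lfloor>2 ^ n * r\<rfloor> + of_bool (b n)"
      by (auto simp: b_def)
    then have "real_of_int \<lfloor>2 ^ Suc n * r\<rfloor> = 2 * real_of_int \<lfloor>2 ^ n * r\<rfloor> + of_bool (b n)"
      by simp
    then show ?thesis unfolding a_def by (simp add: diff_divide_distrib add_divide_distrib power_one_over)
  qed
  have "a \<longlonglongrightarrow> r"
  proof (rule tendsto_sandwich[of "\<lambda>n. r - (1/2) ^ n" _ _ "\<lambda>_. r"])
    have "r - (1/2) ^ n \<le> a n \<and> a n \<le> r" for n
    proof -
      have "2 ^ n * r - 1 \<le> of_int \<lfloor>2 ^ n * r\<rfloor>" "of_int \<lfloor>2 ^ n * r\<rfloor> \<le> 2 ^ n * r"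
        by linarith+
      then have "(2 ^ n * r - 1) / 2 ^ n \<le> a n" "a n \<le> 2 ^ n * r / 2 ^ n"
        unfolding a_def by (simp_all only: divide_right_mono zero_le_power zero_le_numeral)
      then show ?thesis by (simp add: diff_divide_distrib power_one_over)
    qed
    then show "\<forall>\<^sub>F n in sequentially. r - (1/2) ^ n \<le> a n" "\<forall>\<^sub>F n in sequentially. a n \<le> r" by simp_all
    have "(\<lambda>n. (1/2 :: real) ^ n) \<longlonglongrightarrow> 0" by (rule LIMSEQ_power_zero) simp
    from tendsto_diff[OF tendsto_const this] show "(\<lambda>n. r - (1/2) ^ n) \<longlonglongrightarrow> r" by simp
  qed simp
  from telescope_sums[OF this] have "(\<lambda>n. of_bool (b n) * (1/2 :: real) ^ Suc n) sums (r - a 0)"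
    by (simp only: step)
  moreover have "a 0 = 0"
    using assms False by (simp add: a_def floor_eq_iff)
  ultimately have "binary_value b = r"
    unfolding binary_value_def using sums_unique by fastforce
  then show ?thesis using that by blast
qed

text \<open>
  The sequences with prescribed first \<open>m\<close> digits have an interval as their set of values. This is why
  fixing leading digits keeps the set of represented points convex.
\<close>
lemma binary_value_interpolate:
  assumes "\<And>n. n < m \<Longrightarrow> b n = c n" "0 \<le> t" "t \<le> 1"
  obtains d where "\<And>n. n < m \<Longrightarrow> d n = b n"
    "binary_value d = (1 - t) * binary_value b + t * binary_value c"
proof -
  define r where
    "r = (1 - t) * binary_value (\<lambda>n. b (n + m)) + t * binary_value (\<lambda>n. c (n + m))"
  have "0 \<le> r" "r \<le> 1"
    using assms binary_value_bounds unfolding r_def by (auto intro!: convex_bound_le)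
  then obtain e where e: "binary_value e = r" using binary_value_surj by blast
  define d where "d n = (if n < m then b n else e (n - m))" for n
  have "binary_value d = (\<Sum>n<m. of_bool (b n) * (1/2) ^ Suc n) + (1/2) ^ m * r"
    unfolding binary_value_split[of d m] using e by (simp add: d_def)
  also have "\<dots> = (1 - t) * binary_value b + t * binary_value c"
  proof -
    have "(\<Sum>n<m. of_bool (c n) * (1/2 :: real) ^ Suc n) = (\<Sum>n<m. of_bool (b n) * (1/2) ^ Suc n)"
      using assms(1) by (intro sum.cong) auto
    then show ?thesis
      unfolding binary_value_split[of b m] binary_value_split[of c m] r_def
      by (simp only:) (simp add: algebra_simps)
  qed
  finally show ?thesis using that[of d] by (simp add: d_def)
qed

section \<open>The binary lift of a compact convex set\<close>

lemma Int_eq_on_subset: "S \<inter> A = T \<inter> A \<Longrightarrow> E \<subseteq> A \<Longrightarrow> S \<inter> E = T \<inter> E"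
  by blast

text \<open>
  A compact convex set \<open>B\<close> of functions \<open>J \<rightarrow> [0,1]\<close>, lifted to the Cantor cube: the digit number \<open>n\<close> of the
  coordinate \<open>j\<close> of \<open>S\<close> is one if and only if \<open>p (j, n) \<in> S\<close>. The coding \<open>p\<close> places the lift in a cube
  over the type that the theorem asks for.
\<close>
locale convex_lift =
  fixes p :: "'j \<times> nat \<Rightarrow> 'k" and J :: "'j set" and B :: "('j \<Rightarrow> real) set"
  assumes inj_p: "inj_on p (J \<times> UNIV)"
    and B_bounds: "B \<subseteq> J \<rightarrow>\<^sub>E {0..1}"
    and B_convex: "\<lbrakk>b \<in> B; c \<in> B; 0 \<le> t; t \<le> 1\<rbrakk> \<Longrightarrow> restrict (\<lambda>j. (1 - t) * b j + t * c j) J \<in> B"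
    and B_closed: "closedin (product_topology (\<lambda>_. euclideanreal) J) B"
begin

definition coord :: "'k set \<Rightarrow> 'j \<Rightarrow> real" where
  "coord S j = binary_value (\<lambda>n. p (j, n) \<in> S)"

definition lift :: "'k set set" where
  "lift = {S. S \<subseteq> p ` (J \<times> UNIV) \<and> restrict (coord S) J \<in> B}"

definition lift_space :: "'k set topology" where
  "lift_space = subtopology (cantor_cube (p ` (J \<times> UNIV))) lift"

lemma p_eq_iff: "j \<in> J \<Longrightarrow> j' \<in> J \<Longrightarrow> p (j, n) = p (j', n') \<longleftrightarrow> j = j' \<and> n = n'"
  using inj_on_eq_iff[OF inj_p, of "(j, n)" "(j', n')"] by simp

lemma coord_continuous:
  assumes j: "j \<in> J"
  shows "continuous_map (cantor_cube (p ` (J \<times> UNIV))) euclideanreal (\<lambda>S. coord S j)"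
proof (rule continuous_map_cantor_cube)
  fix S and e :: real assume "0 < e"
  then obtain m where m: "(1/2) ^ m < e" using real_arch_pow_inv[of e "1/2"] by auto
  show "\<exists>E. finite E \<and> E \<subseteq> p ` (J \<times> UNIV) \<and>
      (\<forall>S'. S' \<subseteq> p ` (J \<times> UNIV) \<and> S' \<inter> E = S \<inter> E \<longrightarrow> \<bar>coord S' j - coord S j\<bar> < e)"
  proof (intro exI[of _ "p ` ({j} \<times> {..<m})"] conjI allI impI)
    fix S' assume S': "S' \<subseteq> p ` (J \<times> UNIV) \<and> S' \<inter> p ` ({j} \<times> {..<m}) = S \<inter> p ` ({j} \<times> {..<m})"
    have "p (j, n) \<in> S' \<longleftrightarrow> p (j, n) \<in> S" if "n < m" for n
    proof -
      have "p (j, n) \<in> p ` ({j} \<times> {..<m})" using that by blast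
      then show ?thesis using S' by blast
    qed
    then have "\<bar>coord S' j - coord S j\<bar> \<le> (1/2) ^ m"
      unfolding coord_def by (rule binary_value_close)
    then show "\<bar>coord S' j - coord S j\<bar> < e" using m by linarith
  qed (use j in auto)
qed

sublocale lift: cantor_closed "p ` (J \<times> UNIV)" lift_space lift
proof
  let ?P = "product_topology (\<lambda>_. euclideanreal) J"
  let ?I = "p ` (J \<times> UNIV)"
  have "continuous_map (cantor_cube ?I) ?P (\<lambda>S. restrict (coord S) J)"
    unfolding continuous_map_componentwise using coord_continuous by (auto intro: continuous_map_eq)
  from closedin_continuous_map_preimage[OF this B_closed]
  show "closedin (cantor_cube ?I) lift"
    by (simp add: lift_def Pow_def)
qed (rule lift_space_def)

lemma liftI: "S \<subseteq> p ` (J \<times> UNIV) \<Longrightarrow> restrict (coord S) J \<in> B \<Longrightarrow> S \<in> lift"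
  by (simp add: lift_def)

lemma coord_lift_in_B: "S \<in> lift \<Longrightarrow> restrict (coord S) J \<in> B"
  by (simp add: lift_def)

abbreviation prefix_bits :: "'j set \<Rightarrow> nat \<Rightarrow> 'k set" where
  "prefix_bits F m \<equiv> p ` (F \<times> {..<m})"

text \<open>
  Segments of \<open>B\<close> lift to the cube, even with prescribed leading digits on \<open>R\<close>: each coordinate is
  interpolated on its own, and convexity of \<open>B\<close> puts the resulting point into the lift.
\<close>
lemma interpolate_lift:
  assumes S: "S \<in> lift" and T: "T \<in> lift" and R: "R \<subseteq> J" and t: "0 \<le> t" "t \<le> 1"
    and agree: "S \<inter> prefix_bits R m = T \<inter> prefix_bits R m"
  obtains W where "W \<in> lift" "W \<inter> prefix_bits R m = S \<inter> prefix_bits R m"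
    "\<forall>j \<in> J. coord W j = (1 - t) * coord S j + t * coord T j"
proof -
  have "\<exists>d. (j \<in> R \<longrightarrow> (\<forall>n<m. d n \<longleftrightarrow> p (j, n) \<in> S)) \<and>
      binary_value d = (1 - t) * coord S j + t * coord T j" for j
  proof -
    define m' where "m' = (if j \<in> R then m else 0)"
    have "p (j, n) \<in> S \<longleftrightarrow> p (j, n) \<in> T" if "n < m'" for n
    proof -
      have "p (j, n) \<in> prefix_bits R m" using that by (auto simp: m'_def split: if_splits)
      then show ?thesis using agree by blast
    qed
    then obtain d where "\<And>n. n < m' \<Longrightarrow> d n = (p (j, n) \<in> S)"
        "binary_value d = (1 - t) * coord S j + t * coord T j"
      using binary_value_interpolate[OF _ t, of m' "\<lambda>n. p (j, n) \<in> S" "\<lambda>n. p (j, n) \<in> T"]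
      unfolding coord_def by metis
    then show ?thesis by (intro exI[of _ d]) (auto simp: m'_def)
  qed
  then obtain d where d: "\<And>j n. j \<in> R \<Longrightarrow> n < m \<Longrightarrow> d j n \<longleftrightarrow> p (j, n) \<in> S"
      "\<And>j. binary_value (d j) = (1 - t) * coord S j + t * coord T j"
    by metis
  define W where "W = p ` {(j, n). j \<in> J \<and> d j n}"
  have memW: "p (j, n) \<in> W \<longleftrightarrow> d j n" if "j \<in> J" for j n
    unfolding W_def using p_eq_iff that by auto
  have coordW: "coord W j = (1 - t) * coord S j + t * coord T j" if "j \<in> J" for j
    unfolding coord_def memW[OF that] using d(2) by (simp add: coord_def)
  have "restrict (coord W) J
      = restrict (\<lambda>j. (1 - t) * restrict (coord S) J j + t * restrict (coord T) J j) J"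
    by (rule restrict_ext) (simp add: coordW)
  moreover have "restrict (\<lambda>j. (1 - t) * restrict (coord S) J j + t * restrict (coord T) J j) J \<in> B"
    by (rule B_convex[OF coord_lift_in_B[OF S] coord_lift_in_B[OF T] t])
  ultimately have "restrict (coord W) J \<in> B" by simp
  moreover have "W \<subseteq> p ` (J \<times> UNIV)" by (auto simp: W_def)
  ultimately have "W \<in> lift" by (intro liftI)
  moreover have "p (j, n) \<in> W \<longleftrightarrow> p (j, n) \<in> S" if "j \<in> R" "n < m" for j n
    using memW d(1) that R by blast
  then have "W \<inter> prefix_bits R m = S \<inter> prefix_bits R m" by blast
  ultimately show ?thesis using that coordW by blast
qed

lemma lift_surj:
  assumes "b \<in> B"
  obtains S where "S \<in> lift" "restrict (coord S) J = b"
proof -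
  have b: "b j \<in> {0..1}" if "j \<in> J" for j using assms B_bounds that by (auto simp: PiE_iff)
  have "\<exists>d. binary_value d = b j" if j: "j \<in> J" for j
  proof -
    have "0 \<le> b j" "b j \<le> 1" using b[OF j] by simp_all
    then show ?thesis using binary_value_surj by blast
  qed
  then obtain d where d: "\<And>j. j \<in> J \<Longrightarrow> binary_value (d j) = b j" by metis
  define S where "S = p ` {(j, n). j \<in> J \<and> d j n}"
  have memS: "p (j, n) \<in> S \<longleftrightarrow> d j n" if "j \<in> J" for j n
    unfolding S_def using p_eq_iff that by auto
  have "restrict (coord S) J = b"
  proof (rule extensionalityI[of _ J])
    show "b \<in> extensional J" using assms B_bounds by (auto simp: PiE_iff)
    show "restrict (coord S) J j = b j" if "j \<in> J" for j
      using that by (simp add: coord_def memS d)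
  qed simp
  moreover have "S \<subseteq> p ` (J \<times> UNIV)" by (auto simp: S_def)
  ultimately show ?thesis using that liftI assms by blast
qed

text \<open>Membership in \<open>U\<close> is decided by the first \<open>m\<close> digits of the coordinates in \<open>F\<close>.\<close>
definition supported :: "'k set set \<Rightarrow> 'j set \<Rightarrow> nat \<Rightarrow> bool" where
  "supported U F m \<longleftrightarrow> finite F \<and> F \<subseteq> J \<and>
     (\<forall>S \<in> lift. \<forall>T \<in> lift. S \<inter> prefix_bits F m = T \<inter> prefix_bits F m \<longrightarrow> (S \<in> U \<longleftrightarrow> T \<in> U))"

lemma supportedD:
  "supported U F m \<Longrightarrow> S \<in> lift \<Longrightarrow> T \<in> lift \<Longrightarrow> S \<inter> prefix_bits F m = T \<inter> prefix_bits F m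
    \<Longrightarrow> S \<in> U \<longleftrightarrow> T \<in> U"
  unfolding supported_def by (elim conjE) (drule (1) bspec, drule (1) bspec, drule (1) mp)

lemma clopen_supported:
  assumes U: "openin lift_space U" "closedin lift_space U"
  obtains F m where "supported U F m"
proof -
  obtain E where E: "finite E" "E \<subseteq> p ` (J \<times> UNIV)"
    "\<And>S T. S \<in> U \<Longrightarrow> T \<in> lift \<Longrightarrow> S \<inter> E = T \<inter> E \<Longrightarrow> T \<in> U"
    using lift.clopen_finite_support[OF U] by blast
  obtain C where C: "C \<subseteq> J \<times> UNIV" "finite C" "E = p ` C"
    using finite_subset_image[OF E(1,2)] by blast
  obtain m where m: "\<forall>n \<in> snd ` C. n < m"
    using C(2) finite_nat_set_iff_bounded by blast
  have "C \<subseteq> fst ` C \<times> {..<m}" using m by force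
  then have sub: "E \<subseteq> prefix_bits (fst ` C) m" using C(3) by blast
  have "S \<in> U \<longleftrightarrow> T \<in> U"
    if "S \<in> lift" "T \<in> lift" "S \<inter> prefix_bits (fst ` C) m = T \<inter> prefix_bits (fst ` C) m" for S T
  proof -
    have "S \<inter> E = T \<inter> E" by (rule Int_eq_on_subset[OF that(3) sub])
    then show ?thesis using E(3)[of S T] E(3)[of T S] that(1,2) by blast
  qed
  moreover have "finite (fst ` C)" "fst ` C \<subseteq> J" using C(1,2) by (simp, fastforce)
  ultimately have "supported U (fst ` C) m" unfolding supported_def by (intro conjI ballI impI)
  then show ?thesis by (rule that)
qed

text \<open>
  If \<open>S\<close> and \<open>T\<close> had the same coordinates, then the point \<open>W\<close> with the digits of \<open>T\<close> on \<open>G\<close> and those of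
  \<open>S\<close> elsewhere would be another lift of the same element of \<open>B\<close>. On the coordinates in \<open>F \<inter> G \<subseteq> R\<close> the
  relevant digits of \<open>S\<close> and \<open>T\<close> agree, so \<open>W\<close> looks like \<open>S\<close> to \<open>U\<close> and like \<open>T\<close> to \<open>V\<close>.
\<close>
lemma points_separated:
  assumes UV: "U \<subseteq> V" and U: "supported U F m" and V: "supported V G m" and FG: "F \<inter> G \<subseteq> R"
    and S: "S \<in> U" "S \<in> lift" and T: "T \<in> lift" "T \<notin> V"
    and agree: "S \<inter> prefix_bits R m = T \<inter> prefix_bits R m"
  shows "\<exists>j \<in> J. coord S j \<noteq> coord T j"
proof (rule ccontr)
  assume "\<not> ?thesis"
  then have eq: "coord S j = coord T j" if "j \<in> J" for j using that by blast
  have FJ: "F \<subseteq> J" "G \<subseteq> J" using U V by (auto simp: supported_def)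
  define W where "W = p ` {(j, n). j \<in> J \<and> p (j, n) \<in> (if j \<in> G then T else S)}"
  have memW: "p (j, n) \<in> W \<longleftrightarrow> p (j, n) \<in> (if j \<in> G then T else S)" if "j \<in> J" for j n
    unfolding W_def using p_eq_iff that by auto
  have "coord W j = coord S j" if "j \<in> J" for j
  proof -
    have "coord W j = (if j \<in> G then coord T j else coord S j)"
      unfolding coord_def memW[OF that] by simp
    then show ?thesis using eq[OF that] by simp
  qed
  then have "restrict (coord W) J = restrict (coord S) J" by (intro restrict_ext)
  moreover have "W \<subseteq> p ` (J \<times> UNIV)" by (auto simp: W_def)
  ultimately have W: "W \<in> lift" using liftI coord_lift_in_B[OF S(2)] by simp
  have "p (j, n) \<in> W \<longleftrightarrow> p (j, n) \<in> S" if "j \<in> F" "n < m" for j n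
  proof (cases "j \<in> G")
    case True
    then have "p (j, n) \<in> prefix_bits R m" using that FG by blast
    then have "p (j, n) \<in> T \<longleftrightarrow> p (j, n) \<in> S" using agree by blast
    then show ?thesis using memW[of j n] FJ that(1) True by auto
  next
    case False
    then show ?thesis using memW[of j n] FJ that(1) by auto
  qed
  then have "W \<inter> prefix_bits F m = S \<inter> prefix_bits F m" by blast
  then have "W \<in> V" using supportedD[OF U W S(2)] S(1) UV by blast
  moreover have "p (j, n) \<in> W \<longleftrightarrow> p (j, n) \<in> T" if "j \<in> G" for j n
    using memW[of j n] FJ that by auto
  then have "W \<inter> prefix_bits G m = T \<inter> prefix_bits G m" by blast
  ultimately show False using supportedD[OF V W T(1)] T(2) by blast
qed

text \<open>
  Among the points that agree with \<open>P\<close> on \<open>E\<close>, moving each coordinate by less than \<open>e\<close> does not lead from \<open>U\<close>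
  out of \<open>V\<close>.
\<close>
definition separates :: "'k set \<Rightarrow> 'k set \<Rightarrow> 'k set set \<Rightarrow> 'k set set \<Rightarrow> real \<Rightarrow> bool" where
  "separates E P U V e \<longleftrightarrow> (\<forall>S \<in> U. \<forall>T. S \<in> lift \<longrightarrow> T \<in> lift \<longrightarrow> S \<inter> E = P \<inter> E \<longrightarrow> T \<inter> E = P \<inter> E \<longrightarrow>
     (\<forall>j \<in> J. \<bar>coord S j - coord T j\<bar> < e) \<longrightarrow> T \<in> V)"

text \<open>
  The pairs to be separated form a compact set, which is covered by the open sets of pairs whose
  \<open>j\<close>-th coordinates differ by more than \<open>1/(k+1)\<close>.
\<close>
lemma uniformly_separated:
  assumes UV: "U \<subseteq> V" and F: "supported U F m" and G: "supported V G m" and FG: "F \<inter> G \<subseteq> R"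
    and U: "closedin lift_space U" and V: "openin lift_space V" and R: "finite R" "R \<subseteq> J"
    and P: "P \<subseteq> p ` (J \<times> UNIV)"
  obtains k :: nat where "separates (prefix_bits R m) P U V (1 / Suc k)"
proof -
  let ?D = "prod_topology lift_space lift_space"
  let ?A = "lift.pattern (prefix_bits R m) P"
  define O' where "O' = (\<lambda>(j, k::nat). {x \<in> topspace ?D. coord (fst x) j - coord (snd x) j \<in> {r. \<bar>r\<bar> > 1 / Suc k}})"
  have "closedin lift_space ?A"
    using R P by (intro lift.closedin_pattern) auto
  then have "closedin lift_space (U \<inter> ?A)" "closedin lift_space (?A - V)"
    using U V by (auto intro: closedin_diff)
  then have "compactin lift_space (U \<inter> ?A)" "compactin lift_space (?A - V)"
    using lift.compact_K closedin_compact_space by blast+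
  then have "compactin ?D ((U \<inter> ?A) \<times> (?A - V))"
    by (simp add: compactin_Times)
  moreover have "openin ?D (O' x)" if xJ: "x \<in> J \<times> UNIV" for x
  proof -
    obtain j k where x: "x = (j, k)" "j \<in> J" using xJ by blast
    have c: "continuous_map lift_space euclideanreal (\<lambda>S. coord S j)"
      unfolding lift_space_def using coord_continuous[OF x(2)] by (rule continuous_map_from_subtopology)
    have "continuous_map ?D euclideanreal (\<lambda>x. coord (fst x) j - coord (snd x) j)"
      using continuous_map_compose[OF continuous_map_fst c] continuous_map_compose[OF continuous_map_snd c]
      by (intro continuous_map_diff) (simp_all add: o_def)
    moreover have "open {r::real. \<bar>r\<bar> > 1 / Suc k}"
      by (intro open_Collect_less continuous_intros)
    then have "openin euclideanreal {r::real. \<bar>r\<bar> > 1 / Suc k}" by (simp only: open_openin)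
    ultimately show ?thesis
      unfolding O'_def x(1) case_prod_conv by (rule openin_continuous_map_preimage)
  qed
  then have "\<forall>W \<in> O' ` (J \<times> UNIV). openin ?D W" by blast
  moreover have "(U \<inter> ?A) \<times> (?A - V) \<subseteq> \<Union>(O' ` (J \<times> UNIV))"
  proof
    fix x assume "x \<in> (U \<inter> ?A) \<times> (?A - V)"
    then obtain S T where x: "x = (S, T)" "S \<in> U" "S \<in> ?A" "T \<in> ?A" "T \<notin> V" by blast
    then have ST: "S \<in> lift" "T \<in> lift" "S \<inter> prefix_bits R m = T \<inter> prefix_bits R m"
      by (auto simp: lift.pattern_def)
    obtain j where j: "j \<in> J" "coord S j \<noteq> coord T j"
      using points_separated[OF UV F G FG x(2) ST(1,2) x(5) ST(3)] by blast
    then have "0 < \<bar>coord S j - coord T j\<bar>" by simp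
    then obtain k where "1 / Suc k < \<bar>coord S j - coord T j\<bar>" using nat_approx_posE by blast
    then have "x \<in> O' (j, k)" using ST x(1) by (simp add: O'_def lift.topspace_K)
    then show "x \<in> \<Union>(O' ` (J \<times> UNIV))" using j(1) by blast
  qed
  ultimately obtain \<G> where "finite \<G>" "\<G> \<subseteq> O' ` (J \<times> UNIV)" "(U \<inter> ?A) \<times> (?A - V) \<subseteq> \<Union>\<G>"
    unfolding compactin_def by meson
  then obtain X where X: "X \<subseteq> J \<times> UNIV" "finite X" "(U \<inter> ?A) \<times> (?A - V) \<subseteq> \<Union>(O' ` X)"
    by (metis finite_subset_image)
  obtain k where k: "\<forall>n \<in> snd ` X. n < k"
    using X(2) finite_nat_set_iff_bounded by blast
  show ?thesis
  proof (rule that[of k], unfold separates_def, intro ballI allI impI, rule ccontr)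
    fix S T assume S: "S \<in> U" "S \<in> lift" "T \<in> lift" "S \<inter> prefix_bits R m = P \<inter> prefix_bits R m"
      "T \<inter> prefix_bits R m = P \<inter> prefix_bits R m" "T \<notin> V"
      and close: "\<forall>j \<in> J. \<bar>coord S j - coord T j\<bar> < 1 / Suc k"
    then have "(S, T) \<in> (U \<inter> ?A) \<times> (?A - V)" by (simp add: lift.pattern_def)
    then obtain j n where jn: "(j, n) \<in> X" "(S, T) \<in> O' (j, n)" using X(3) by fast
    then have "n < k" using k by force
    then have "1 / real (Suc k) \<le> 1 / Suc n" by (simp add: field_simps)
    moreover have "1 / Suc n < \<bar>coord S j - coord T j\<bar>" using jn(2) by (simp add: O'_def)
    moreover have "j \<in> J" using jn(1) X(1) by blast
    ultimately show False using close by fastforce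
  qed
qed

end

section \<open>Uncountable well-ordered chains of sets\<close>

lemma uncountable_nonempty: "uncountable A \<Longrightarrow> A \<noteq> {}"
  by auto

lemma uncountable_fibre:
  assumes "uncountable A" "countable (f ` A)"
  obtains b where "uncountable {x \<in> A. f x = b}"
proof (rule ccontr)
  assume "\<not> thesis"
  then have "countable {x \<in> A. f x = b}" for b using that by blast
  then have "countable (\<Union>b \<in> f ` A. {x \<in> A. f x = b})" using assms(2) by blast
  moreover have "(\<Union>b \<in> f ` A. {x \<in> A. f x = b}) = A" by blast
  ultimately show False using assms(1) by simp
qed

text \<open>
  Either every element of the chain has countably many predecessors, or the predecessors of the
  least element that has uncountably many of them form the required part. In \<open>C'\<close> every property of
  all but countably many elements therefore holds arbitrarily high up.
\<close>
lemma omega1_part_of_inclusion_chain: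
  fixes C :: "'a set set"
  assumes wo: "well_order_on C {(U, V). U \<in> C \<and> V \<in> C \<and> U \<subseteq> V}" and unc: "uncountable C"
  obtains C' where "C' \<subseteq> C" "uncountable C'" "\<forall>V \<in> C'. countable {U \<in> C'. U \<subset> V}"
    "\<forall>U \<in> C'. \<forall>V \<in> C'. U \<subset> V \<or> U = V \<or> V \<subset> U"
    "\<forall>D \<subseteq> C'. D \<noteq> {} \<longrightarrow> (\<exists>U \<in> D. \<forall>V \<in> D. U \<subseteq> V)"
proof -
  let ?r = "{(U, V). U \<in> C \<and> V \<in> C \<and> U \<subseteq> V}"
  have tot: "U \<subset> V \<or> U = V \<or> V \<subset> U" if "U \<in> C" "V \<in> C" for U V
  proof -
    have "total_on C ?r" using wo by (simp add: well_order_on_def linear_order_on_def)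
    then show ?thesis using that by (auto simp: total_on_def)
  qed
  have least: "\<exists>U \<in> D. \<forall>V \<in> D. U \<subseteq> V" if D: "D \<subseteq> C" "D \<noteq> {}" for D
  proof -
    have "wf (?r - Id)" using wo by (simp add: well_order_on_def)
    moreover obtain W where "W \<in> D" using D(2) by blast
    ultimately obtain U where U: "U \<in> D" "\<forall>V. (V, U) \<in> ?r - Id \<longrightarrow> V \<notin> D"
      by (rule wfE_min) blast
    have "U \<subseteq> V" if V: "V \<in> D" for V
      using tot[of U V] U V D(1) by blast
    then show ?thesis using U(1) by blast
  qed
  show ?thesis
  proof (cases "\<exists>V \<in> C. uncountable {U \<in> C. U \<subset> V}")
    case False
    show ?thesis
    proof (rule that[of C])
      show "\<forall>V \<in> C. countable {U \<in> C. U \<subset> V}" using False by blast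
      show "\<forall>U \<in> C. \<forall>V \<in> C. U \<subset> V \<or> U = V \<or> V \<subset> U" by (intro ballI tot)
      show "\<forall>D \<subseteq> C. D \<noteq> {} \<longrightarrow> (\<exists>U \<in> D. \<forall>V \<in> D. U \<subseteq> V)" by (intro allI impI least)
    qed (use unc in simp_all)
  next
    case True
    then have ne: "{V \<in> C. uncountable {U \<in> C. U \<subset> V}} \<noteq> {}" by blast
    have "{V \<in> C. uncountable {U \<in> C. U \<subset> V}} \<subseteq> C" by blast
    from least[OF this ne] obtain V where V: "V \<in> {V \<in> C. uncountable {U \<in> C. U \<subset> V}}"
        "\<forall>W \<in> {V \<in> C. uncountable {U \<in> C. U \<subset> V}}. V \<subseteq> W"
      by (elim bexE)
    show ?thesis
    proof (rule that[of "{U \<in> C. U \<subset> V}"])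
      show "uncountable {U \<in> C. U \<subset> V}" using V by blast
      have "countable {U \<in> {U \<in> C. U \<subset> V}. U \<subset> W}" if "W \<in> {U \<in> C. U \<subset> V}" for W
      proof -
        have "countable {U \<in> C. U \<subset> W}" using V(2) that by blast
        then show ?thesis by (rule countable_subset[rotated]) blast
      qed
      then show "\<forall>W \<in> {U \<in> C. U \<subset> V}. countable {U \<in> {U \<in> C. U \<subset> V}. U \<subset> W}" by (rule ballI)
      show "\<forall>U \<in> {U \<in> C. U \<subset> V}. \<forall>W \<in> {U \<in> C. U \<subset> V}. U \<subset> W \<or> U = W \<or> W \<subset> U"
        using tot by (intro ballI) simp
      show "\<forall>D \<subseteq> {U \<in> C. U \<subset> V}. D \<noteq> {} \<longrightarrow> (\<exists>U \<in> D. \<forall>W \<in> D. U \<subseteq> W)"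
      proof (intro allI impI)
        fix D assume D: "D \<subseteq> {U \<in> C. U \<subset> V}" "D \<noteq> {}"
        then have "D \<subseteq> C" by blast
        then show "\<exists>U \<in> D. \<forall>W \<in> D. U \<subseteq> W" using D(2) by (rule least)
      qed
    qed blast
  qed
qed

section \<open>Chains of clopen sets in the lift\<close>

context convex_lift begin

text \<open>
  The chain is thinned out several times, always keeping it uncountable, until one finite set \<open>R\<close> of
  common coordinates, one pattern of leading digits on \<open>R\<close> and one distance \<open>1/(n+1)\<close> serve all its
  members. Then a segment of \<open>B\<close> is divided into steps shorter than this distance.
\<close>
theorem no_uncountable_wellordered_clopen_chain:
  assumes clopen: "C \<subseteq> carrier (clopen_algebra lift_space)"
    and wo: "well_order_on C {(U, V). U \<in> C \<and> V \<in> C \<and> U \<subseteq> V}"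
  shows "countable C"
proof (rule ccontr)
  assume "uncountable C"
  then obtain C1 where C1: "C1 \<subseteq> C" "uncountable C1"
      and below: "\<forall>V \<in> C1. countable {U \<in> C1. U \<subset> V}"
      and chain: "\<forall>U \<in> C1. \<forall>V \<in> C1. U \<subset> V \<or> U = V \<or> V \<subset> U"
      and least: "\<forall>D \<subseteq> C1. D \<noteq> {} \<longrightarrow> (\<exists>U \<in> D. \<forall>V \<in> D. U \<subseteq> V)"
    by (rule omega1_part_of_inclusion_chain[OF wo])
  have clop: "openin lift_space U" "closedin lift_space U" if "U \<in> C1" for U
    using that C1(1) clopen by (auto simp: clopen_algebra_def)
  have inlift: "S \<in> lift" if "U \<in> C1" "S \<in> U" for U S
    using openin_subset[OF clop(1)[OF that(1)]] that(2) lift.topspace_K by blast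
  have "\<exists>F m. supported U F m" if "U \<in> C1" for U
    using clopen_supported[OF clop[OF that]] by blast
  then obtain F m where Fm: "\<And>U. U \<in> C1 \<Longrightarrow> supported U (F U) (m U)" by metis
  have "countable (range (\<lambda>U. (m U, card (F U))))" by simp
  then have "countable ((\<lambda>U. (m U, card (F U))) ` C1)" by (rule countable_subset[rotated]) blast
  then obtain mn where "uncountable {U \<in> C1. (m U, card (F U)) = mn}"
    by (rule uncountable_fibre[OF C1(2)])
  moreover obtain M N where "mn = (M, N)" by fastforce
  ultimately have unc2: "uncountable {U \<in> C1. m U = M \<and> card (F U) = N}" by simp
  define C2 where "C2 = {U \<in> C1. m U = M \<and> card (F U) = N}"
  \<comment> \<open>The root \<open>R\<close> of the Delta-system is a set of maximal size that is contained in uncountably many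
    supports; by maximality any further coordinate is in countably many of them.\<close>
  define good where "good R \<longleftrightarrow> finite R \<and> uncountable {U \<in> C2. R \<subseteq> F U}" for R
  have bound: "card R \<le> N \<and> R \<subseteq> J" if "good R" for R
  proof -
    have "{U \<in> C2. R \<subseteq> F U} \<noteq> {}" using that unfolding good_def by (intro uncountable_nonempty) simp
    then obtain U where U: "U \<in> C2" "R \<subseteq> F U" by blast
    then have "supported U (F U) (m U)" "card (F U) = N" using Fm by (auto simp: C2_def)
    then show ?thesis using U(2) card_mono[of "F U" R] unfolding supported_def by auto
  qed
  have "good {}" using unc2 by (simp add: good_def C2_def)
  moreover have "\<forall>R. good R \<longrightarrow> card R < Suc N" using bound by (simp add: less_Suc_eq_le)
  ultimately obtain R where R: "good R" "\<forall>R'. good R' \<longrightarrow> card R' \<le> card R"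
    using ex_has_greatest_nat[of good "{}" card "Suc N"] by blast
  have finR: "finite R" "R \<subseteq> J" using R(1) bound by (auto simp: good_def)
  define C3 where "C3 = {U \<in> C2. R \<subseteq> F U}"
  have C3: "uncountable C3" "C3 \<subseteq> C1" using R(1) by (auto simp: good_def C3_def C2_def)
  have supp: "supported U (F U) M" if "U \<in> C3" for U
    using that Fm[of U] by (auto simp: C3_def C2_def)
  have rare: "countable {U \<in> C3. d \<in> F U}" if d: "d \<notin> R" for d
  proof (rule ccontr)
    assume "uncountable {U \<in> C3. d \<in> F U}"
    moreover have "{U \<in> C3. d \<in> F U} = {U \<in> C2. insert d R \<subseteq> F U}" by (auto simp: C3_def)
    ultimately have "good (insert d R)" using finR by (simp add: good_def)
    then have "card (insert d R) \<le> card R" using R(2) by blast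
    then show False using finR d by simp
  qed
  have overlap: "countable {V \<in> C3. \<not> F U \<inter> F V \<subseteq> R}" if U: "U \<in> C3" for U
  proof -
    have "finite (F U)" using supp[OF U] by (simp add: supported_def)
    then have "countable (\<Union>d \<in> F U - R. {V \<in> C3. d \<in> F V})"
      using rare by (intro countable_UN) (auto intro: countable_finite)
    then show ?thesis by (rule countable_subset[rotated]) blast
  qed
  have above: "uncountable {V \<in> D. U \<subset> V}" if D: "D \<subseteq> C3" "uncountable D" and U: "U \<in> C3" for D U
  proof
    assume "countable {V \<in> D. U \<subset> V}"
    moreover have "countable ({V \<in> C1. V \<subset> U} \<union> {U})"
      using below U C3(2) by (simp add: subsetD)
    ultimately have "countable ({V \<in> D. U \<subset> V} \<union> ({V \<in> C1. V \<subset> U} \<union> {U}))" by (rule countable_Un)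
    moreover have sub: "D \<subseteq> {V \<in> D. U \<subset> V} \<union> ({V \<in> C1. V \<subset> U} \<union> {U})"
    proof
      fix V assume "V \<in> D"
      then show "V \<in> {V \<in> D. U \<subset> V} \<union> ({V \<in> C1. V \<subset> U} \<union> {U})"
        using bspec[OF bspec[OF chain, of U], of V] U D(1) C3(2) by blast
    qed
    ultimately show False using D(2) countable_subset[OF sub] by simp
  qed
  \<comment> \<open>A point in the successor of \<open>U\<close> that is not in \<open>U\<close> lies in all later sets at once. These points
    provide both ends of the segment.\<close>
  have "\<exists>x \<in> lift. x \<notin> U \<and> (\<forall>V \<in> C3. U \<subset> V \<longrightarrow> x \<in> V)" if U: "U \<in> C3" for U
  proof -
    have ne: "{V \<in> C3. U \<subset> V} \<noteq> {}" by (rule uncountable_nonempty[OF above[OF subset_refl C3(1) U]])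
    have "{V \<in> C3. U \<subset> V} \<subseteq> C1" using C3(2) by blast
    from least[rule_format, OF this ne] obtain W where
      W: "W \<in> {V \<in> C3. U \<subset> V}" "\<forall>V \<in> {V \<in> C3. U \<subset> V}. W \<subseteq> V"
      by (elim bexE)
    then obtain x where x: "x \<in> W" "x \<notin> U" by blast
    then have "x \<in> lift" using inlift W(1) C3(2) by blast
    then show ?thesis using x W(2) by blast
  qed
  then obtain \<psi> where \<psi>: "\<And>U. U \<in> C3 \<Longrightarrow> \<psi> U \<in> lift \<and> \<psi> U \<notin> U"
      "\<And>U V. U \<in> C3 \<Longrightarrow> V \<in> C3 \<Longrightarrow> U \<subset> V \<Longrightarrow> \<psi> U \<in> V"
    by metis
  let ?E = "prefix_bits R M"
  have "finite (Pow ?E)" using finR by simp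
  then have "finite ((\<lambda>U. \<psi> U \<inter> ?E) ` C3)" by (rule finite_subset[rotated]) blast
  then have "countable ((\<lambda>U. \<psi> U \<inter> ?E) ` C3)" by (rule countable_finite)
  then obtain P where unc4: "uncountable {U \<in> C3. \<psi> U \<inter> ?E = P}"
    by (rule uncountable_fibre[OF C3(1)])
  define C4 where "C4 = {U \<in> C3. \<psi> U \<inter> ?E = P}"
  have C4: "uncountable C4" "C4 \<subseteq> C3" using unc4 by (auto simp: C4_def)
  have "C4 \<noteq> {}" by (rule uncountable_nonempty[OF C4(1)])
  then have PE: "P \<inter> ?E = P" by (auto simp: C4_def)
  have PI: "P \<subseteq> p ` (J \<times> UNIV)"
    using PE finR(2) by blast
  have "\<exists>V \<in> C4. \<exists>k :: nat. U \<subset> V \<and> separates ?E P U V (1 / Suc k)" if U: "U \<in> C4" for U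
  proof -
    have "U \<in> C3" using U C4(2) by blast
    have "\<not> {V \<in> C4. U \<subset> V} \<subseteq> {V \<in> C3. \<not> F U \<inter> F V \<subseteq> R}"
    proof
      assume "{V \<in> C4. U \<subset> V} \<subseteq> {V \<in> C3. \<not> F U \<inter> F V \<subseteq> R}"
      from countable_subset[OF this overlap[OF \<open>U \<in> C3\<close>]] above[OF C4(2,1) \<open>U \<in> C3\<close>]
      show False by simp
    qed
    then obtain V where V: "V \<in> C4" "U \<subset> V" "F U \<inter> F V \<subseteq> R" using C4(2) by blast
    have "V \<in> C3" using V(1) C4(2) by blast
    obtain k where "separates ?E P U V (1 / Suc k)"
    proof (rule uniformly_separated)
      show "U \<subseteq> V" using V(2) by blast
      show "supported U (F U) M" "supported V (F V) M" using supp \<open>U \<in> C3\<close> \<open>V \<in> C3\<close> by blast+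
      show "F U \<inter> F V \<subseteq> R" by fact
      show "closedin lift_space U" "openin lift_space V"
        using clop \<open>U \<in> C3\<close> \<open>V \<in> C3\<close> C3(2) by blast+
    qed (use finR PI in auto)
    then show ?thesis using V by blast
  qed
  then obtain \<beta> k where \<beta>: "\<And>U. U \<in> C4 \<Longrightarrow> \<beta> U \<in> C4 \<and> U \<subset> \<beta> U \<and> separates ?E P U (\<beta> U) (1 / Suc (k U))" by metis
  have "countable (k ` C4)" by simp
  then obtain n where unc5: "uncountable {U \<in> C4. k U = n}"
    by (rule uncountable_fibre[OF C4(1)])
  define C5 where "C5 = {U \<in> C4. k U = n}"
  have C5: "uncountable C5" "C5 \<subseteq> C4" using unc5 by (auto simp: C5_def)
  have "\<exists>u. \<forall>i. u i \<in> C5 \<and> \<beta> (u i) \<subset> u (Suc i)"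
  proof (rule dependent_nat_choice)
    show "\<exists>U. U \<in> C5" using uncountable_nonempty[OF C5(1)] by blast
    fix U and i :: nat assume "U \<in> C5"
    then have "\<beta> U \<in> C3" using \<beta> C5(2) C4(2) by blast
    then have "{V \<in> C5. \<beta> U \<subset> V} \<noteq> {}"
      by (rule uncountable_nonempty[OF above[OF subset_trans[OF C5(2) C4(2)] C5(1)]])
    then show "\<exists>V. V \<in> C5 \<and> \<beta> U \<subset> V" by blast
  qed
  then obtain u where u: "\<And>i. u i \<in> C5" "\<And>i. \<beta> (u i) \<subset> u (Suc i)" by metis
  have u4: "u i \<in> C4" "u i \<in> C3" for i using u(1) C5(2) C4(2) by blast+
  have usep: "separates ?E P (u i) (\<beta> (u i)) (1 / Suc n)" for i
    using \<beta>[OF u4(1)[of i]] u(1)[of i] by (simp add: C5_def)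
  \<comment> \<open>\<open>N'\<close> steps of length \<open>1/N'\<close> are each shorter than \<open>1/(n+1)\<close>. The first set in use is \<open>u 1\<close>, since
    \<open>S0 = \<psi> (u 0)\<close> avoids \<open>u 0\<close>; the last one is \<open>\<beta> (u (N' + 1))\<close>, which is below \<open>u (N' + 2)\<close> and so
    misses \<open>S1\<close>.\<close>
  define N' where "N' = n + 2"
  define S0 where "S0 = \<psi> (u 0)"
  define S1 where "S1 = \<psi> (u (N' + 2))"
  have S0: "S0 \<in> lift" "S0 \<inter> ?E = P" and S1: "S1 \<in> lift" "S1 \<inter> ?E = P"
    using \<psi>(1)[OF u4(2)] u4(1) by (auto simp: S0_def S1_def C4_def)
  have agree: "S0 \<inter> ?E = S1 \<inter> ?E" using S0 S1 by simp
  have S0in: "S0 \<in> u 1"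
  proof -
    have "u 0 \<subset> u 1" using \<beta>[OF u4(1)[of 0]] u(2)[of 0] by auto
    then show ?thesis unfolding S0_def by (rule \<psi>(2)[OF u4(2) u4(2)])
  qed
  define path where "path t j = (1 - t) * coord S0 j + t * coord S1 j" for t j
  have path_step: "\<bar>path s j - path t j\<bar> \<le> \<bar>s - t\<bar>" for s t j
  proof -
    have "path s j - path t j = (s - t) * (coord S1 j - coord S0 j)"
      by (simp add: path_def algebra_simps)
    moreover have "\<bar>coord S1 j - coord S0 j\<bar> \<le> 1"
      unfolding coord_def
      using binary_value_bounds[of "\<lambda>n. p (j, n) \<in> S0"] binary_value_bounds[of "\<lambda>n. p (j, n) \<in> S1"]
      by linarith
    ultimately show ?thesis by (simp add: abs_mult mult_left_le)
  qed
  have walk: "\<forall>S \<in> lift. S \<inter> ?E = P \<longrightarrow> (\<forall>j \<in> J. coord S j = path (real i / N') j) \<longrightarrow> S \<in> \<beta> (u (Suc i))"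
    if "i \<le> N'" for i
    using that
  proof (induction i)
    case 0
    show ?case
    proof (intro ballI impI)
      fix S assume S: "S \<in> lift" "S \<inter> ?E = P" "\<forall>j\<in>J. coord S j = path (real 0 / N') j"
      then have "\<forall>j \<in> J. \<bar>coord S0 j - coord S j\<bar> < 1 / Suc n" by (simp add: path_def)
      then show "S \<in> \<beta> (u (Suc 0))"
        using usep[of 1] S0in S0 S(1,2) unfolding separates_def PE by simp
    qed
  next
    case (Suc i)
    show ?case
    proof (intro ballI impI)
      fix S assume S: "S \<in> lift" "S \<inter> ?E = P" "\<forall>j\<in>J. coord S j = path (real (Suc i) / N') j"
      have "0 \<le> real i / N'" "real i / N' \<le> 1" using Suc.prems by (auto simp: N'_def)
      then obtain T where T: "T \<in> lift" "T \<inter> ?E = S0 \<inter> ?E"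
          "\<forall>j \<in> J. coord T j = path (real i / N') j"
        unfolding path_def by (rule interpolate_lift[OF S0(1) S1(1) finR(2) _ _ agree])
      then have "T \<in> \<beta> (u (Suc i))" using Suc S0(2) by simp
      then have Tu: "T \<in> u (Suc (Suc i))" using u(2)[of "Suc i"] by blast
      have "\<bar>coord T j - coord S j\<bar> < 1 / Suc n" if "j \<in> J" for j
      proof -
        have "\<bar>coord T j - coord S j\<bar> \<le> \<bar>real i / N' - real (Suc i) / N'\<bar>"
          using path_step S(3) T(3) that by simp
        also have "\<dots> = 1 / N'" by (simp add: add_divide_distrib)
        also have "\<dots> < 1 / Suc n" by (simp add: N'_def field_simps)
        finally show ?thesis .
      qed
      then show "S \<in> \<beta> (u (Suc (Suc i)))"
        using usep[of "Suc (Suc i)"] Tu T(1,2) S0(2) S(1,2) unfolding separates_def PE by simp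
    qed
  qed
  have "\<forall>j \<in> J. coord S1 j = path (real N' / N') j" by (simp add: path_def N'_def)
  then have "S1 \<in> \<beta> (u (Suc N'))" using walk[of N'] S1 by simp
  then have "S1 \<in> u (N' + 2)" using u(2)[of "Suc N'"] by auto
  then show False using \<psi>(1)[OF u4(2)] by (auto simp: S1_def)
qed

end

section \<open>The dual unit ball\<close>

context normed_space_on begin

lemma norm_zero: "vnorm V (vzero V) = 0"
  using zero_closed norm_eq_zero by blast

lemma norm_nonneg: "x \<in> carrier V \<Longrightarrow> 0 \<le> vnorm V x"
  using norm_triangle[of x "vscale V (- 1) x"] norm_scale[of x "- 1"]
    add_inverse[of x] norm_zero scale_closed[of x "- 1"] by simp

lemma scale_zero: "x \<in> carrier V \<Longrightarrow> vscale V 0 x = vzero V"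
  using norm_eq_zero[of "vscale V 0 x"] norm_scale[of x 0] scale_closed by simp

lemma zero_add: "x \<in> carrier V \<Longrightarrow> vadd V (vzero V) x = x"
  using add_commute zero_closed add_zero by metis

lemma inverse_add: "x \<in> carrier V \<Longrightarrow> vadd V (vscale V (- 1) x) x = vzero V"
  using add_commute scale_closed add_inverse by metis

lemma inverse_add_cancel:
  "x \<in> carrier V \<Longrightarrow> y \<in> carrier V \<Longrightarrow> vadd V (vscale V (- 1) x) (vadd V x y) = y"
  using add_assoc[of "vscale V (- 1) x" x y] by (simp add: scale_closed inverse_add zero_add)

lemma add_add_swap:
  assumes "x \<in> carrier V" "y \<in> carrier V" "z \<in> carrier V" "w \<in> carrier V"
  shows "vadd V (vadd V x y) (vadd V z w) = vadd V (vadd V x z) (vadd V y w)"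
proof -
  have "vadd V (vadd V x y) (vadd V z w) = vadd V x (vadd V (vadd V y z) w)"
    using assms by (simp add: add_assoc add_closed)
  also have "vadd V y z = vadd V z y" using assms add_commute by blast
  finally show ?thesis using assms by (simp add: add_assoc add_closed)
qed

definition sublinear :: "('a \<Rightarrow> real) \<Rightarrow> bool" where
  "sublinear q \<longleftrightarrow> q \<in> extensional (carrier V) \<and>
     (\<forall>x \<in> carrier V. \<forall>y \<in> carrier V. q (vadd V x y) \<le> q x + q y) \<and>
     (\<forall>x \<in> carrier V. \<forall>a \<ge> 0. q (vscale V a x) = a * q x)"

lemma sublinearI:
  assumes "q \<in> extensional (carrier V)"
    "\<And>x y. x \<in> carrier V \<Longrightarrow> y \<in> carrier V \<Longrightarrow> q (vadd V x y) \<le> q x + q y"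
    "\<And>x a. x \<in> carrier V \<Longrightarrow> 0 < a \<Longrightarrow> q (vscale V a x) \<le> a * q x"
    "q (vzero V) = 0"
  shows "sublinear q"
  unfolding sublinear_def
proof (intro conjI ballI allI impI)
  fix x and a :: real assume x: "x \<in> carrier V" and a: "0 \<le> a"
  show "q (vscale V a x) = a * q x"
  proof (cases "a = 0")
    case True
    then show ?thesis using assms(4) x by (simp add: scale_zero)
  next
    case False
    then have a: "0 < a" using a by simp
    have "q (vscale V (1/a) (vscale V a x)) \<le> (1/a) * q (vscale V a x)"
      using a x scale_closed by (intro assms(3)) auto
    then have "q x \<le> q (vscale V a x) / a" using a x by (simp add: scale_scale scale_one)
    then have "a * q x \<le> q (vscale V a x)" using a by (simp add: field_simps)
    then show ?thesis using assms(3)[OF x a] by simp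
  qed
qed (use assms in auto)

lemma sublinear_add: "sublinear q \<Longrightarrow> x \<in> carrier V \<Longrightarrow> y \<in> carrier V \<Longrightarrow> q (vadd V x y) \<le> q x + q y"
  by (simp add: sublinear_def)

lemma sublinear_scale: "sublinear q \<Longrightarrow> x \<in> carrier V \<Longrightarrow> 0 \<le> a \<Longrightarrow> q (vscale V a x) = a * q x"
  by (simp add: sublinear_def)

lemma sublinear_zero: "sublinear q \<Longrightarrow> q (vzero V) = 0"
  using sublinear_scale[of q "vzero V" 0] zero_closed scale_zero by simp

lemma sublinear_lower: 
  assumes "sublinear q" "x \<in> carrier V" 
  shows "- q (vscale V (- 1) x) \<le> q x"
  using sublinear_add[OF assms(1,2), of "vscale V (- 1) x"] assms
  by (simp add: scale_closed add_inverse sublinear_zero)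

lemma sublinear_norm: "sublinear (restrict (vnorm V) (carrier V))"
  unfolding sublinear_def by (simp add: add_closed scale_closed norm_triangle norm_scale)

text \<open>
  The largest sublinear functional below \<open>q\<close> that takes a value of at most \<open>- q y\<close> at \<open>- y\<close>. It serves
  twice: a minimal sublinear functional is not changed by it, hence linear; and tilting the norm in
  direction \<open>z\<close> prepares a functional that attains its norm at \<open>z\<close>.
\<close>
definition tilt :: "('a \<Rightarrow> real) \<Rightarrow> 'a \<Rightarrow> 'a \<Rightarrow> real" where
  "tilt q y = restrict (\<lambda>x. INF t \<in> {0..}. q (vadd V x (vscale V t y)) - t * q y) (carrier V)"

context
  fixes q y assumes q: "sublinear q" and y: "y \<in> carrier V"
begin

lemma tilt_bdd:
  assumes x: "x \<in> carrier V"
  shows "bdd_below ((\<lambda>t. q (vadd V x (vscale V t y)) - t * q y) ` {0..})"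
proof (rule bdd_belowI2)
  fix t :: real assume "t \<in> {0..}"
  then have t: "0 \<le> t" by simp
  have "q (vscale V t y) = q (vadd V (vscale V (- 1) x) (vadd V x (vscale V t y)))"
    using x y by (simp add: inverse_add_cancel scale_closed)
  also have "\<dots> \<le> q (vscale V (- 1) x) + q (vadd V x (vscale V t y))"
    using x y by (intro sublinear_add[OF q]) (simp_all add: scale_closed add_closed)
  finally show "- q (vscale V (- 1) x) \<le> q (vadd V x (vscale V t y)) - t * q y"
    using sublinear_scale[OF q y t] by simp
qed

lemma tilt_le:
  assumes "x \<in> carrier V" "0 \<le> t"
  shows "tilt q y x \<le> q (vadd V x (vscale V t y)) - t * q y"
  unfolding tilt_def using assms by (simp add: cINF_lower[OF tilt_bdd])

lemma tilt_greatest: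
  assumes "x \<in> carrier V" "\<And>t. 0 \<le> t \<Longrightarrow> c \<le> q (vadd V x (vscale V t y)) - t * q y"
  shows "c \<le> tilt q y x"
  using cINF_greatest[of "{0..}" c "\<lambda>t. q (vadd V x (vscale V t y)) - t * q y"] assms
  by (simp add: tilt_def)

lemma tilt_le_self: "x \<in> carrier V \<Longrightarrow> tilt q y x \<le> q x"
  using tilt_le[of x 0] y by (simp add: scale_zero add_zero)

lemma sublinear_tilt: "sublinear (tilt q y)"
proof (rule sublinearI)
  show "tilt q y \<in> extensional (carrier V)" by (simp add: tilt_def)
next
  fix x z assume xz: "x \<in> carrier V" "z \<in> carrier V"
  have bound: "tilt q y (vadd V x z) \<le> (q (vadd V x (vscale V s y)) - s * q y) + (q (vadd V z (vscale V t y)) - t * q y)"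
    if "0 \<le> s" "0 \<le> t" for s t
  proof -
    have "tilt q y (vadd V x z) \<le> q (vadd V (vadd V x z) (vscale V (s + t) y)) - (s + t) * q y"
      using xz that by (intro tilt_le) (simp_all add: add_closed)
    also have "vadd V (vadd V x z) (vscale V (s + t) y)
        = vadd V (vadd V x (vscale V s y)) (vadd V z (vscale V t y))"
      using xz y by (simp add: scale_add_left add_add_swap scale_closed)
    also have "q \<dots> \<le> q (vadd V x (vscale V s y)) + q (vadd V z (vscale V t y))"
      using xz y by (intro sublinear_add[OF q]) (simp_all add: add_closed scale_closed)
    finally show ?thesis by (simp add: algebra_simps)
  qed
  have "tilt q y (vadd V x z) - tilt q y z \<le> q (vadd V x (vscale V s y)) - s * q y" if s: "0 \<le> s" for s
  proof -
    have "tilt q y (vadd V x z) - (q (vadd V x (vscale V s y)) - s * q y) \<le> tilt q y z"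
      using bound[OF s] by (intro tilt_greatest[OF xz(2)]) (simp only: diff_le_eq add.commute)
    then show ?thesis by linarith
  qed
  then have "tilt q y (vadd V x z) - tilt q y z \<le> tilt q y x"
    by (rule tilt_greatest[OF xz(1)])
  then show "tilt q y (vadd V x z) \<le> tilt q y x + tilt q y z" by simp
next
  fix x and a :: real assume x: "x \<in> carrier V" and a: "0 < a"
  have "tilt q y (vscale V a x) / a \<le> q (vadd V x (vscale V t y)) - t * q y" if t: "0 \<le> t" for t
  proof -
    have "tilt q y (vscale V a x) \<le> q (vadd V (vscale V a x) (vscale V (a * t) y)) - (a * t) * q y"
      using x a t by (intro tilt_le) (simp_all add: scale_closed)
    also have "vadd V (vscale V a x) (vscale V (a * t) y) = vscale V a (vadd V x (vscale V t y))"
      using x y by (simp add: scale_add_right scale_scale scale_closed)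
    also have "q \<dots> = a * q (vadd V x (vscale V t y))"
      using x y a by (intro sublinear_scale[OF q]) (simp_all add: add_closed scale_closed)
    finally have "tilt q y (vscale V a x) \<le> (q (vadd V x (vscale V t y)) - t * q y) * a"
      by (simp add: algebra_simps)
    then show ?thesis using a by (simp add: divide_le_eq)
  qed
  then have "tilt q y (vscale V a x) / a \<le> tilt q y x" by (intro tilt_greatest[OF x])
  then show "tilt q y (vscale V a x) \<le> a * tilt q y x" using a by (simp add: divide_le_eq mult.commute)
next
  have "0 \<le> tilt q y (vzero V)"
    using zero_closed y by (intro tilt_greatest) (simp_all add: zero_add scale_closed sublinear_scale[OF q])
  moreover have "tilt q y (vzero V) \<le> 0"
    using tilt_le_self[OF zero_closed] sublinear_zero[OF q] by simp
  ultimately show "tilt q y (vzero V) = 0" by simp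
qed

end

text \<open>Zorn's lemma; the pointwise infimum of a chain of sublinear functionals is sublinear.\<close>
lemma minimal_sublinear_below:
  assumes q: "sublinear q"
  obtains m where "sublinear m" "\<forall>x \<in> carrier V. m x \<le> q x"
    "\<forall>r. sublinear r \<longrightarrow> (\<forall>x \<in> carrier V. r x \<le> m x) \<longrightarrow> r = m"
proof -
  define A where "A = {r. sublinear r \<and> (\<forall>x \<in> carrier V. r x \<le> q x)}"
  define P where "P r s \<longleftrightarrow> (\<forall>x \<in> carrier V. s x \<le> r x)" for r s :: "'a \<Rightarrow> real"
  have ext: "r = s" if "r \<in> A" "s \<in> A" "P r s" "P s r" for r s
  proof (rule extensionalityI[of _ "carrier V"])
    show "r \<in> extensional (carrier V)" "s \<in> extensional (carrier V)"
      using that by (auto simp: A_def sublinear_def)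
    show "r x = s x" if "x \<in> carrier V" for x
      using \<open>P r s\<close> \<open>P s r\<close> that by (simp add: P_def order_antisym)
  qed
  have po: "partial_order_on A (relation_of P A)"
  proof (rule partial_order_on_relation_ofI)
    show "P a a" if "a \<in> A" for a by (simp add: P_def)
    show "P a c" if "P a b" "P b c" for a b c using that unfolding P_def by (meson order_trans)
    show "a = b" if "a \<in> A" "b \<in> A" "P a b" "P b a" for a b using ext that .
  qed
  have "\<exists>m \<in> A. \<forall>a \<in> A. P m a \<longrightarrow> a = m"
  proof (rule predicate_Zorn[OF po])
    fix C assume C: "C \<in> Chains (relation_of P A)"
    have CA: "r \<in> A" if "r \<in> C" for r
      using C that by (auto simp: Chains_def relation_of_def)
    have chain: "P r s \<or> P s r" if "r \<in> C" "s \<in> C" for r s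
      using C that unfolding Chains_def relation_of_def by blast
    show "\<exists>u \<in> A. \<forall>a \<in> C. P a u"
    proof (cases "C = {}")
      case True
      then show ?thesis using q by (auto simp: A_def)
    next
      case False
      define u where "u = restrict (\<lambda>x. INF r \<in> C. r x) (carrier V)"
      have bdd: "bdd_below ((\<lambda>r. r x) ` C)" if x: "x \<in> carrier V" for x
      proof (rule bdd_belowI2)
        fix r assume "r \<in> C"
        then have "sublinear r" "r (vscale V (- 1) x) \<le> q (vscale V (- 1) x)"
          using CA x scale_closed by (auto simp: A_def)
        then show "- q (vscale V (- 1) x) \<le> r x" using sublinear_lower[of r x] x by simp
      qed
      have lower: "u x \<le> r x" if "x \<in> carrier V" "r \<in> C" for x r
        unfolding u_def using that by (simp add: cINF_lower[OF bdd])
      have greatest: "c \<le> u x" if "x \<in> carrier V" "\<And>r. r \<in> C \<Longrightarrow> c \<le> r x" for c x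
        unfolding u_def using that False by (simp add: cINF_greatest)
      have "sublinear u"
      proof (rule sublinearI)
        show "u \<in> extensional (carrier V)" by (simp add: u_def)
      next
        fix x y assume xy: "x \<in> carrier V" "y \<in> carrier V"
        have bound: "u (vadd V x y) \<le> r x + s y" if rs: "r \<in> C" "s \<in> C" for r s
        proof -
          obtain t where t: "t \<in> C" "t x \<le> r x" "t y \<le> s y"
            using chain[OF rs] rs xy unfolding P_def by blast
          have "u (vadd V x y) \<le> t (vadd V x y)" using xy t(1) by (intro lower) (simp_all add: add_closed)
          also have "\<dots> \<le> t x + t y" using CA[OF t(1)] xy by (intro sublinear_add) (simp_all add: A_def)
          finally show ?thesis using t by linarith
        qed
        have "u (vadd V x y) - u y \<le> r x" if r: "r \<in> C" for r
        proof -
          have "u (vadd V x y) - r x \<le> u y"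
            using bound[OF r] by (intro greatest[OF xy(2)]) (simp only: diff_le_eq add.commute)
          then show ?thesis by linarith
        qed
        then have "u (vadd V x y) - u y \<le> u x" by (rule greatest[OF xy(1)])
        then show "u (vadd V x y) \<le> u x + u y" by simp
      next
        fix x and a :: real assume x: "x \<in> carrier V" and a: "0 < a"
        have "u (vscale V a x) / a \<le> r x" if r: "r \<in> C" for r
        proof -
          have "u (vscale V a x) \<le> r (vscale V a x)" using x r by (intro lower) (simp_all add: scale_closed)
          also have "\<dots> = a * r x" using CA[OF r] x a by (intro sublinear_scale) (simp_all add: A_def)
          finally show ?thesis using a by (simp add: divide_le_eq mult.commute)
        qed
        then have "u (vscale V a x) / a \<le> u x" by (intro greatest[OF x])
        then show "u (vscale V a x) \<le> a * u x" using a by (simp add: divide_le_eq mult.commute)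
      next
        have z: "r (vzero V) = 0" if "r \<in> C" for r
          using CA[OF that] sublinear_zero by (simp add: A_def)
        obtain r where "r \<in> C" using False by blast
        then have "u (vzero V) \<le> 0" using lower[OF zero_closed] z by fastforce
        moreover have "0 \<le> u (vzero V)" by (rule greatest[OF zero_closed]) (simp add: z)
        ultimately show "u (vzero V) = 0" by simp
      qed
      moreover have "u x \<le> q x" if x: "x \<in> carrier V" for x
      proof -
        obtain r where r: "r \<in> C" using False by blast
        then have "r x \<le> q x" using CA x by (simp add: A_def)
        then show ?thesis using lower[OF x r] by linarith
      qed
      ultimately have "u \<in> A" by (simp add: A_def)
      moreover have "\<forall>a \<in> C. P a u" using lower by (simp add: P_def)
      ultimately show ?thesis by blast
    qed
  qed
  then obtain m where m: "m \<in> A" "\<forall>a \<in> A. P m a \<longrightarrow> a = m" by blast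
  have "r = m" if r: "sublinear r" "\<forall>x \<in> carrier V. r x \<le> m x" for r
  proof -
    have "\<forall>x \<in> carrier V. r x \<le> q x" using r(2) m(1) unfolding A_def by (auto intro: order_trans)
    then have "r \<in> A" "P m r" using r by (simp_all add: A_def P_def)
    then show ?thesis using m(2) by blast
  qed
  then show ?thesis using that[of m] m(1) by (simp add: A_def)
qed

definition dual_ball :: "('a \<Rightarrow> real) set" where
  "dual_ball = {f \<in> extensional (carrier V).
     (\<forall>x \<in> carrier V. \<forall>y \<in> carrier V. f (vadd V x y) = f x + f y) \<and>
     (\<forall>x \<in> carrier V. \<forall>a. f (vscale V a x) = a * f x) \<and>
     (\<forall>x \<in> carrier V. \<bar>f x\<bar> \<le> vnorm V x)}"

text \<open>
  Let \<open>m\<close> be a minimal sublinear functional below the norm tilted in direction \<open>z\<close>. Minimality forces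
  \<open>tilt m y = m\<close> for all \<open>y\<close>, which gives \<open>m x + m y \<le> m (x + y)\<close>. The tilt gives \<open>m (- z) \<le> - \<parallel>z\<parallel>\<close>.
\<close>
theorem Hahn_Banach_norming:
  assumes z: "z \<in> carrier V"
  obtains f where "f \<in> dual_ball" "f z = vnorm V z"
proof -
  define N where "N = restrict (vnorm V) (carrier V)"
  have N: "sublinear N" using sublinear_norm by (simp add: N_def)
  obtain m where m: "sublinear m" "\<forall>x \<in> carrier V. m x \<le> tilt N z x"
      and min: "\<forall>r. sublinear r \<longrightarrow> (\<forall>x \<in> carrier V. r x \<le> m x) \<longrightarrow> r = m"
    using minimal_sublinear_below[OF sublinear_tilt[OF N z]] by blast
  have add: "m (vadd V x y) = m x + m y" if xy: "x \<in> carrier V" "y \<in> carrier V" for x y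
  proof -
    have "tilt m y = m"
      using min sublinear_tilt[OF m(1) xy(2)] tilt_le_self[OF m(1) xy(2)] by blast
    then have "m x \<le> m (vadd V x y) - m y"
      using tilt_le[OF m(1) xy(2) xy(1), of 1] xy by (simp add: scale_one)
    then show ?thesis using sublinear_add[OF m(1) xy] by simp
  qed
  have neg: "m (vscale V (- 1) x) = - m x" if x: "x \<in> carrier V" for x
    using add[OF x scale_closed[OF x, of "- 1"]] x by (simp add: add_inverse sublinear_zero[OF m(1)])
  have scale: "m (vscale V a x) = a * m x" if x: "x \<in> carrier V" for a x
  proof (cases "0 \<le> a")
    case True
    then show ?thesis using sublinear_scale[OF m(1) x] by simp
  next
    case False
    have "m (vscale V (- 1) (vscale V (- a) x)) = - m (vscale V (- a) x)"
      by (rule neg[OF scale_closed[OF x]])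
    also have "m (vscale V (- a) x) = - a * m x" using False sublinear_scale[OF m(1) x, of "- a"] by simp
    finally show ?thesis using x by (simp add: scale_scale)
  qed
  have le: "m x \<le> vnorm V x" if "x \<in> carrier V" for x
    using m(2) tilt_le_self[OF N z that] that by (force simp: N_def)
  have "\<bar>m x\<bar> \<le> vnorm V x" if x: "x \<in> carrier V" for x
    using le[OF x] le[OF scale_closed[OF x, of "- 1"]] neg[OF x] norm_scale[OF x, of "- 1"] by simp
  then have ball: "m \<in> dual_ball" using m(1) add scale by (simp add: dual_ball_def sublinear_def)
  have "m (vscale V (- 1) z) \<le> tilt N z (vscale V (- 1) z)" using m(2) scale_closed[OF z] by blast
  also have "\<dots> \<le> N (vadd V (vscale V (- 1) z) (vscale V 1 z)) - 1 * N z"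
    using scale_closed[OF z] by (intro tilt_le[OF N z]) simp_all
  also have "\<dots> = - vnorm V z"
    using z by (simp add: scale_one inverse_add N_def norm_zero zero_closed)
  finally have "m z = vnorm V z" using neg[OF z] le[OF z] by simp
  then show ?thesis using that ball by blast
qed

lemma dual_ball_add: "f \<in> dual_ball \<Longrightarrow> x \<in> carrier V \<Longrightarrow> y \<in> carrier V \<Longrightarrow> f (vadd V x y) = f x + f y"
  by (simp add: dual_ball_def)

lemma dual_ball_scale: "f \<in> dual_ball \<Longrightarrow> x \<in> carrier V \<Longrightarrow> f (vscale V a x) = a * f x"
  by (simp add: dual_ball_def)

lemma dual_ball_bound: "f \<in> dual_ball \<Longrightarrow> x \<in> carrier V \<Longrightarrow> \<bar>f x\<bar> \<le> vnorm V x"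
  by (simp add: dual_ball_def)

lemma dual_ball_Lipschitz:
  assumes "f \<in> dual_ball" "x \<in> carrier V" "y \<in> carrier V"
  shows "\<bar>f x - f y\<bar> \<le> vdist V x y"
proof -
  have "f (vadd V x (vscale V (- 1) y)) = f x - f y"
    using assms by (simp add: dual_ball_add dual_ball_scale scale_closed)
  then show ?thesis
    using dual_ball_bound[OF assms(1), of "vadd V x (vscale V (- 1) y)"] assms
    by (simp add: vdist_def add_closed scale_closed)
qed

lemma zero_in_dual_ball: "restrict (\<lambda>_. 0) (carrier V) \<in> dual_ball"
  by (simp add: dual_ball_def add_closed scale_closed norm_nonneg)

lemma dual_ball_convex:
  assumes "f \<in> dual_ball" "g \<in> dual_ball" "0 \<le> t" "t \<le> 1"
  shows "restrict (\<lambda>x. (1 - t) * f x + t * g x) (carrier V) \<in> dual_ball"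
  unfolding dual_ball_def mem_Collect_eq
proof (intro conjI ballI allI)
  fix x assume x: "x \<in> carrier V"
  have "\<bar>(1 - t) * f x + t * g x\<bar> \<le> (1 - t) * \<bar>f x\<bar> + t * \<bar>g x\<bar>"
    using assms(3,4) abs_triangle_ineq[of "(1 - t) * f x" "t * g x"] by (simp add: abs_mult)
  also have "\<dots> \<le> (1 - t) * vnorm V x + t * vnorm V x"
    using assms x dual_ball_bound by (intro add_mono mult_left_mono) auto
  finally show "\<bar>restrict (\<lambda>x. (1 - t) * f x + t * g x) (carrier V) x\<bar> \<le> vnorm V x"
    using x by (simp add: algebra_simps)
qed (use assms in \<open>auto simp: dual_ball_add dual_ball_scale add_closed scale_closed algebra_simps\<close>)

text \<open>The Banach--Alaoglu theorem: linearity is a closed condition in a compact box.\<close>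
lemma compactin_dual_ball:
  "compactin (product_topology (\<lambda>_. euclideanreal) (carrier V)) dual_ball"
proof -
  let ?P = "product_topology (\<lambda>_. euclideanreal) (carrier V)"
  let ?box = "\<Pi>\<^sub>E x \<in> carrier V. {- vnorm V x .. vnorm V x}"
  let ?A = "\<lambda>x y. {f \<in> topspace ?P. f (vadd V x y) - (f x + f y) \<in> {0}}"
  let ?S = "\<lambda>x a. {f \<in> topspace ?P. f (vscale V a x) - a * f x \<in> {0}}"
  have ev: "continuous_map ?P euclideanreal (\<lambda>f. f x)" if "x \<in> carrier V" for x
    using that by (rule continuous_map_product_projection)
  have A: "closedin ?P (?A x y)" if "x \<in> carrier V" "y \<in> carrier V" for x y
    using that ev add_closed
    by (intro closedin_continuous_map_preimage[of ?P euclideanreal] continuous_map_diff continuous_map_add) auto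
  have S: "closedin ?P (?S x a)" if "x \<in> carrier V" for x a
    using that ev scale_closed
    by (intro closedin_continuous_map_preimage[of ?P euclideanreal] continuous_map_diff
        continuous_map_real_mult_left) auto
  have ne: "carrier V \<noteq> {}" using zero_closed by blast
  have "closedin ?P (\<Inter>x \<in> carrier V. (\<Inter>y \<in> carrier V. ?A x y) \<inter> (\<Inter>a. ?S x a))"
    using A S ne by (intro closedin_INT closedin_Int) auto
  moreover have "compactin ?P ?box" by (auto simp: compactin_PiE)
  ultimately have "compactin ?P (?box \<inter> (\<Inter>x \<in> carrier V. (\<Inter>y \<in> carrier V. ?A x y) \<inter> (\<Inter>a. ?S x a)))"
    using compact_Int_closedin by blast
  moreover have "f \<in> dual_ball \<longleftrightarrow> f \<in> ?box \<inter> (\<Inter>x \<in> carrier V. (\<Inter>y \<in> carrier V. ?A x y) \<inter> (\<Inter>a. ?S x a))" for f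
  proof -
    have "f \<in> ?box \<longleftrightarrow> f \<in> extensional (carrier V) \<and> (\<forall>x \<in> carrier V. \<bar>f x\<bar> \<le> vnorm V x)"
      by (auto simp: PiE_iff abs_le_iff)
    moreover have "f \<in> topspace ?P" if "f \<in> extensional (carrier V)" using that by (simp add: PiE_iff)
    ultimately show ?thesis using ne unfolding dual_ball_def by auto
  qed
  then have "dual_ball = ?box \<inter> (\<Inter>x \<in> carrier V. (\<Inter>y \<in> carrier V. ?A x y) \<inter> (\<Inter>a. ?S x a))"
    by blast
  ultimately show ?thesis by simp
qed

text \<open>
  The affine change of scale from \<open>[- \<parallel>d\<parallel>, \<parallel>d\<parallel>]\<close> to \<open>[0,1]\<close> in each coordinate. If \<open>\<parallel>d\<parallel> = 0\<close>, division by
  zero yields the constant value \<open>1/2\<close>, which is harmless because then \<open>f d = 0\<close>.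
\<close>
definition rescaled :: "'a set \<Rightarrow> ('a \<Rightarrow> real) \<Rightarrow> 'a \<Rightarrow> real" where
  "rescaled D f = restrict (\<lambda>d. (1 + f d / vnorm V d) / 2) D"

lemma rescaled_inverse:
  assumes "f \<in> dual_ball" "d \<in> D" "D \<subseteq> carrier V"
  shows "f d = vnorm V d * (2 * rescaled D f d - 1)"
proof (cases "vnorm V d = 0")
  case True
  then show ?thesis using dual_ball_bound[of f d] assms by auto
next
  case False
  then show ?thesis using assms(2) by (simp add: rescaled_def field_simps)
qed

lemma rescaled_bounds:
  assumes "f \<in> dual_ball" "D \<subseteq> carrier V"
  shows "rescaled D f \<in> D \<rightarrow>\<^sub>E {0..1}"
proof -
  have bound: "\<bar>f d / vnorm V d\<bar> \<le> 1" if "d \<in> D" for d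
    using dual_ball_bound[OF assms(1), of d] norm_nonneg[of d] that assms(2)
    by (cases "vnorm V d = 0") (auto simp: abs_divide divide_le_eq)
  have "(1 + f d / vnorm V d) / 2 \<in> {0..1}" if "d \<in> D" for d
    using abs_le_D1[OF bound[OF that]] abs_le_D2[OF bound[OF that]] by simp
  then show ?thesis by (simp add: rescaled_def PiE_iff)
qed

lemma closedin_rescaled:
  assumes D: "D \<subseteq> carrier V"
  shows "closedin (product_topology (\<lambda>_. euclideanreal) D) (rescaled D ` dual_ball)"
proof -
  let ?P = "product_topology (\<lambda>_. euclideanreal) (carrier V)"
  let ?Q = "product_topology (\<lambda>_. euclideanreal :: real topology) D"
  have "continuous_map ?P euclideanreal (\<lambda>f. (1 + f d / vnorm V d) / 2)" if "d \<in> D" for d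
  proof -
    have "continuous_map ?P euclideanreal (\<lambda>f. f d)"
      using that D by (intro continuous_map_product_projection) auto
    then have "continuous_map ?P euclideanreal (\<lambda>f. 1/2 + (1 / (2 * vnorm V d)) * f d)"
      by (intro continuous_map_add continuous_map_real_mult_left) auto
    then show ?thesis by (simp add: add_divide_distrib mult.commute)
  qed
  then have "continuous_map ?P ?Q (rescaled D)"
    unfolding continuous_map_componentwise by (auto simp: rescaled_def intro: continuous_map_eq)
  then have "compactin ?Q (rescaled D ` dual_ball)"
    using compactin_dual_ball image_compactin by blast
  then show ?thesis
    by (intro compactin_imp_closedin) (simp_all add: Hausdorff_space_product_topology)
qed

lemma rescaled_convex:
  assumes "b \<in> rescaled D ` dual_ball" "c \<in> rescaled D ` dual_ball" "0 \<le> t" "t \<le> 1" "D \<subseteq> carrier V"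
  shows "restrict (\<lambda>d. (1 - t) * b d + t * c d) D \<in> rescaled D ` dual_ball"
proof -
  obtain f g where f: "f \<in> dual_ball" "b = rescaled D f" and g: "g \<in> dual_ball" "c = rescaled D g"
    using assms(1,2) by blast
  let ?h = "restrict (\<lambda>x. (1 - t) * f x + t * g x) (carrier V)"
  have "restrict (\<lambda>d. (1 - t) * b d + t * c d) D = rescaled D ?h"
  proof (rule extensionalityI[of _ D])
    fix d assume d: "d \<in> D"
    define F G where "F = f d / vnorm V d" and "G = g d / vnorm V d"
    have "restrict (\<lambda>d. (1 - t) * b d + t * c d) D d = (1 - t) * ((1 + F) / 2) + t * ((1 + G) / 2)"
      using d by (simp add: f g rescaled_def F_def G_def)
    also have "\<dots> = (1 + ((1 - t) * F + t * G)) / 2" by (simp add: field_simps)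
    also have "(1 - t) * F + t * G = ((1 - t) * f d + t * g d) / vnorm V d"
      by (simp add: F_def G_def add_divide_distrib)
    also have "(1 + \<dots>) / 2 = rescaled D ?h d"
      using d assms(5) by (simp add: rescaled_def subsetD)
    finally show "restrict (\<lambda>d. (1 - t) * b d + t * c d) D d = rescaled D ?h d" .
  qed (simp_all add: rescaled_def)
  then show ?thesis using dual_ball_convex[OF f(1) g(1) assms(3,4)] by simp
qed

lemma rescaled_inj:
  assumes fg: "f \<in> dual_ball" "g \<in> dual_ball" and eq: "rescaled D f = rescaled D g"
    and D: "D \<subseteq> carrier V"
    and dense: "Metric_space.mtopology (carrier V) (vdist V) closure_of D = carrier V"
  shows "f = g"
proof (rule extensionalityI[of _ "carrier V"])
  show "f \<in> extensional (carrier V)" "g \<in> extensional (carrier V)"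
    using fg by (simp_all add: dual_ball_def)
  interpret M: Metric_space "carrier V" "vdist V"
    by (rule normed_space_on_Metric_space) (rule normed_space_on_axioms)
  fix x assume x: "x \<in> carrier V"
  have close: "\<bar>f x - g x\<bar> \<le> 0 + e" if e: "0 < e" for e
  proof -
    have "0 < e / 2" using e by simp
    then obtain d where d: "d \<in> D" "d \<in> M.mball x (e / 2)"
      using dense x unfolding M.metric_closure_of by blast
    then have dV: "d \<in> carrier V" using D by blast
    have "f d = g d" using rescaled_inverse[OF fg(1) d(1) D] rescaled_inverse[OF fg(2) d(1) D] eq by simp
    moreover have "\<bar>f x - f d\<bar> < e / 2" "\<bar>g x - g d\<bar> < e / 2"
      using dual_ball_Lipschitz[OF fg(1) x dV] dual_ball_Lipschitz[OF fg(2) x dV] d(2) by simp_all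
    ultimately show ?thesis by linarith
  qed
  have "\<bar>f x - g x\<bar> \<le> 0" by (rule field_le_epsilon) (rule close)
  then show "f x = g x" by simp
qed

end

section \<open>Banach spaces of continuous functions\<close>

lemma continuous_map_real_approx:
  fixes f :: "'a \<Rightarrow> real"
  assumes "\<And>e. 0 < e \<Longrightarrow> \<exists>g. continuous_map X euclideanreal g \<and> (\<forall>x \<in> topspace X. \<bar>f x - g x\<bar> < e)"
  shows "continuous_map X euclideanreal f"
proof -
  have "\<forall>n. \<exists>g. continuous_map X euclideanreal g \<and> (\<forall>x \<in> topspace X. \<bar>f x - g x\<bar> < 1 / Suc n)"
    using assms by simp
  then obtain g where g: "\<And>n. continuous_map X euclideanreal (g n)"
      "\<And>n x. x \<in> topspace X \<Longrightarrow> \<bar>f x - g n x\<bar> < 1 / Suc n"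
    by metis
  have "continuous_map X Met_TC.mtopology f"
  proof (rule Met_TC.continuous_map_uniform_limit_alt[where F = sequentially and f = g])
    show "\<forall>\<^sub>F n in sequentially. continuous_map X Met_TC.mtopology (g n)" using g(1) by simp
    fix e :: real assume "0 < e"
    then obtain N where N: "1 / Suc N < e" using nat_approx_posE by blast
    have "dist (g n x) (f x) < e" if "N \<le> n" "x \<in> topspace X" for n x
    proof -
      have "1 / real (Suc n) \<le> 1 / Suc N" using that(1) by (simp add: field_simps)
      then show ?thesis using g(2)[OF that(2), of n] N by (simp add: dist_real_def abs_minus_commute)
    qed
    then show "\<forall>\<^sub>F n in sequentially. \<forall>x \<in> topspace X. dist (g n x) (f x) < e"
      unfolding eventually_sequentially by blast
  qed auto
  then show ?thesis by simp
qed

locale C_space_on =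
  fixes K :: "'a topology"
  assumes compact: "compact_space K" and nonempty: "topspace K \<noteq> {}"
begin

lemma carrier_C: "f \<in> carrier (C_space K) \<longleftrightarrow> f \<in> extensional (topspace K) \<and> continuous_map K euclideanreal f"
  by (simp add: C_space_def)

lemma restrict_in_C: "continuous_map K euclideanreal f \<Longrightarrow> restrict f (topspace K) \<in> carrier (C_space K)"
  unfolding carrier_C by (auto intro: continuous_map_eq)

lemma C_bounded:
  assumes "f \<in> carrier (C_space K)"
  shows "bdd_above ((\<lambda>x. \<bar>f x\<bar>) ` topspace K)"
proof -
  have "compactin euclideanreal (f ` topspace K)"
    using assms compact image_compactin unfolding carrier_C compact_space_def by blast
  then have "bounded (f ` topspace K)" using compact_imp_bounded by simp
  then obtain B where "\<forall>y \<in> f ` topspace K. \<bar>y\<bar> \<le> B" by (auto simp: bounded_iff)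
  then show ?thesis by (intro bdd_aboveI2[of _ _ B]) blast
qed

lemma C_norm_upper: "f \<in> carrier (C_space K) \<Longrightarrow> x \<in> topspace K \<Longrightarrow> \<bar>f x\<bar> \<le> vnorm (C_space K) f"
  using cSUP_upper[OF _ C_bounded] by (fastforce simp: C_space_def)

lemma C_norm_least:
  assumes "\<And>x. x \<in> topspace K \<Longrightarrow> \<bar>f x\<bar> \<le> c"
  shows "vnorm (C_space K) f \<le> c"
  using cSUP_least[OF nonempty, of "\<lambda>x. \<bar>f x\<bar>" c] assms by (simp add: C_space_def)

lemma normed_space_C: "normed_space_on (C_space K)"
proof
  note ops = C_space_def
  show closed_add: "vadd (C_space K) f g \<in> carrier (C_space K)"
    if "f \<in> carrier (C_space K)" "g \<in> carrier (C_space K)" for f g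
    using that restrict_in_C[OF continuous_map_add, of f g] by (simp add: ops)
  show closed_zero: "vzero (C_space K) \<in> carrier (C_space K)"
    using restrict_in_C[of "\<lambda>_. 0"] by (simp add: ops)
  show closed_scale: "vscale (C_space K) a f \<in> carrier (C_space K)" if "f \<in> carrier (C_space K)" for a f
    using that restrict_in_C[OF continuous_map_real_mult_left, of f a] by (simp add: ops)
  show "vadd (C_space K) (vadd (C_space K) f g) h = vadd (C_space K) f (vadd (C_space K) g h)" for f g h
    by (auto simp: ops)
  show "vadd (C_space K) f g = vadd (C_space K) g f" for f g by (auto simp: ops add.commute)
  show "vadd (C_space K) f (vzero (C_space K)) = f" if "f \<in> carrier (C_space K)" for f
    using that by (auto simp: ops extensional_def)
  show "vadd (C_space K) f (vscale (C_space K) (- 1) f) = vzero (C_space K)" for f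
    by (auto simp: ops)
  show "vscale (C_space K) a (vadd (C_space K) f g)
      = vadd (C_space K) (vscale (C_space K) a f) (vscale (C_space K) a g)" for a f g
    by (auto simp: ops distrib_left)
  show "vscale (C_space K) (a + b) f
      = vadd (C_space K) (vscale (C_space K) a f) (vscale (C_space K) b f)" for a b f
    by (auto simp: ops distrib_right)
  show "vscale (C_space K) a (vscale (C_space K) b f) = vscale (C_space K) (a * b) f" for a b f
    by (auto simp: ops)
  show "vscale (C_space K) 1 f = f" if "f \<in> carrier (C_space K)" for f
    using that by (auto simp: ops extensional_def)
  show "vnorm (C_space K) f = 0 \<longleftrightarrow> f = vzero (C_space K)" if f: "f \<in> carrier (C_space K)" for f
  proof
    assume 0: "vnorm (C_space K) f = 0"
    show "f = vzero (C_space K)"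
    proof (rule extensionalityI[of _ "topspace K"])
      show "f x = vzero (C_space K) x" if "x \<in> topspace K" for x
        using C_norm_upper[OF f that] 0 that by (simp add: ops)
    qed (use f in \<open>simp_all add: ops\<close>)
  next
    assume "f = vzero (C_space K)"
    then show "vnorm (C_space K) f = 0" using nonempty by (simp add: ops)
  qed
  show "vnorm (C_space K) (vadd (C_space K) f g) \<le> vnorm (C_space K) f + vnorm (C_space K) g"
    if fg: "f \<in> carrier (C_space K)" "g \<in> carrier (C_space K)" for f g
  proof (rule C_norm_least)
    fix x assume x: "x \<in> topspace K"
    then have "\<bar>vadd (C_space K) f g x\<bar> \<le> \<bar>f x\<bar> + \<bar>g x\<bar>" by (simp add: ops)
    then show "\<bar>vadd (C_space K) f g x\<bar> \<le> vnorm (C_space K) f + vnorm (C_space K) g"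
      using C_norm_upper[OF fg(1) x] C_norm_upper[OF fg(2) x] by linarith
  qed
  show "vnorm (C_space K) (vscale (C_space K) a f) = \<bar>a\<bar> * vnorm (C_space K) f"
    if f: "f \<in> carrier (C_space K)" for a f
  proof (rule antisym)
    have le: "vnorm (C_space K) (vscale (C_space K) b h) \<le> \<bar>b\<bar> * vnorm (C_space K) h"
      if h: "h \<in> carrier (C_space K)" for b h
    proof (rule C_norm_least)
      fix x assume x: "x \<in> topspace K"
      then have "\<bar>vscale (C_space K) b h x\<bar> = \<bar>b\<bar> * \<bar>h x\<bar>" by (simp add: ops abs_mult)
      then show "\<bar>vscale (C_space K) b h x\<bar> \<le> \<bar>b\<bar> * vnorm (C_space K) h"
        using mult_left_mono[OF C_norm_upper[OF h x], of "\<bar>b\<bar>"] by simp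
    qed
    show "vnorm (C_space K) (vscale (C_space K) a f) \<le> \<bar>a\<bar> * vnorm (C_space K) f" using le f .
    show "\<bar>a\<bar> * vnorm (C_space K) f \<le> vnorm (C_space K) (vscale (C_space K) a f)"
    proof (cases "a = 0")
      case True
      obtain x where x: "x \<in> topspace K" using nonempty by blast
      then show ?thesis
        using True C_norm_upper[OF closed_scale[OF f, of a] x] by simp
    next
      case False
      have "vscale (C_space K) (1/a) (vscale (C_space K) a f) = f"
      proof (rule extensionalityI[of _ "topspace K"])
        show "vscale (C_space K) (1/a) (vscale (C_space K) a f) x = f x" if "x \<in> topspace K" for x
          using False that by (simp add: ops)
      qed (use f in \<open>simp_all add: ops\<close>)
      then have "vnorm (C_space K) f \<le> \<bar>1/a\<bar> * vnorm (C_space K) (vscale (C_space K) a f)"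
        using le[OF closed_scale[OF f, of a], of "1/a"] by simp
      then show ?thesis using False by (simp add: field_simps)
    qed
  qed
qed

lemma vdist_C:
  assumes "f \<in> carrier (C_space K)" "g \<in> carrier (C_space K)"
  shows "vdist (C_space K) f g = (SUP x \<in> topspace K. \<bar>f x - g x\<bar>)"
  using assms by (simp add: vdist_def C_space_def cong: SUP_cong_simp)

lemma vdist_C_less:
  assumes "f \<in> carrier (C_space K)" "g \<in> carrier (C_space K)" "0 < e"
    "\<And>x. x \<in> topspace K \<Longrightarrow> \<bar>f x - g x\<bar> < e"
  shows "vdist (C_space K) f g \<le> e"
  unfolding vdist_C[OF assms(1,2)] by (rule cSUP_least[OF nonempty]) (use assms(4) in force)

text \<open>
  The distance of \<open>C(K)\<close> agrees on continuous functions with that of the complete metric space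
  \<open>cfunspace\<close>.
\<close>
lemma mcomplete_C: "Metric_space.mcomplete (carrier (C_space K)) (vdist (C_space K))"
proof -
  let ?m = "cfunspace K (euclidean_metric :: real metric)"
  interpret C: Metric_space "carrier (C_space K)" "vdist (C_space K)"
    by (rule normed_space_on_Metric_space[OF normed_space_C])
  interpret F: Metric_space "mspace ?m" "mdist ?m" by (rule Metric_space_mspace_mdist)
  have "Met_TC.mcomplete TYPE(real)" using complete_UNIV by simp
  then have complete: "F.mcomplete"
    using Met_TC.mcomplete_cfunspace[where 'a = real, of K] 
    unfolding mcomplete_of_def euclidean_metric_def Met_TC.Self_def by simp
  have sp: "mspace ?m = carrier (C_space K)"
    using compactin_mspace_cfunspace[of K "euclidean_metric :: real metric"] compact
    by (auto simp: compact_space_def C_space_def)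
  have dist: "mdist ?m f g = vdist (C_space K) f g" if "f \<in> mspace ?m" "g \<in> mspace ?m" for f g
  proof -
    have "f \<in> Met_TC.fspace (topspace K)" "g \<in> Met_TC.fspace (topspace K)"
      using cfunspace_subset_funspace[of K "euclidean_metric :: real metric"] that by auto
    then have "mdist ?m f g = (SUP x \<in> topspace K. dist (f x) (g x))"
      using nonempty unfolding mdist_cfunspace_eq_mdist_funspace by (simp add: Met_TC.fdist_def)
    then show ?thesis using that unfolding sp by (simp add: vdist_C dist_real_def)
  qed
  show ?thesis
    unfolding C.mcomplete_def
  proof (intro allI impI)
    fix \<sigma> assume \<sigma>: "C.MCauchy \<sigma>"
    then have ran: "\<sigma> n \<in> mspace ?m" for n unfolding C.MCauchy_def sp by blast
    have "F.MCauchy \<sigma>"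
      unfolding F.MCauchy_def dist[OF ran ran] using \<sigma> unfolding C.MCauchy_def sp .
    then obtain f where "limitin F.mtopology \<sigma> f sequentially"
      using complete unfolding F.mcomplete_def by (meson allE)
    then have f: "f \<in> mspace ?m" "\<forall>e>0. \<exists>N. \<forall>n\<ge>N. \<sigma> n \<in> mspace ?m \<and> mdist ?m (\<sigma> n) f < e"
      unfolding F.limit_metric_sequentially by (rule conjunct1, rule conjunct2)
    have "limitin C.mtopology \<sigma> f sequentially"
      using f unfolding C.limit_metric_sequentially dist[OF ran f(1)] unfolding sp by (rule conjI)
    then show "\<exists>f. limitin C.mtopology \<sigma> f sequentially" by blast
  qed
qed

lemma banach_C: "banach_on (C_space K)"
  using normed_space_C mcomplete_C by (simp add: banach_on_def)

end

primrec step_function :: "(rat \<times> 'a set) list \<Rightarrow> 'a \<Rightarrow> real" where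
  "step_function [] x = 0"
| "step_function (a # l) x = (if x \<in> snd a then of_rat (fst a) else step_function l x)"

lemma continuous_map_if_clopen:
  fixes g :: "'a \<Rightarrow> real"
  assumes U: "openin X U" "closedin X U" and g: "continuous_map X euclideanreal g"
  shows "continuous_map X euclideanreal (\<lambda>x. if x \<in> U then c else g x)"
  unfolding continuous_map_def
proof (intro conjI allI impI)
  fix W :: "real set" assume W: "openin euclideanreal W"
  have "{x \<in> topspace X. (if x \<in> U then c else g x) \<in> W}
      = (if c \<in> W then U else {}) \<union> ((topspace X - U) \<inter> {x \<in> topspace X. g x \<in> W})"
    using openin_subset[OF U(1)] by auto
  moreover have "openin X \<dots>"
    using U openin_continuous_map_preimage[OF g W] by (intro openin_Un openin_Int) auto
  ultimately show "openin X {x \<in> topspace X. (if x \<in> U then c else g x) \<in> W}" by simp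
qed simp

lemma continuous_map_step_function:
  assumes "\<forall>a \<in> set l. openin X (snd a) \<and> closedin X (snd a)"
  shows "continuous_map X euclideanreal (step_function l)"
  using assms
proof (induction l)
  case Nil
  have "step_function [] = (\<lambda>x::'a. 0)" by (rule ext) simp
  then show ?case by simp
next
  case (Cons a l)
  then have "continuous_map X euclideanreal (\<lambda>x. if x \<in> snd a then of_rat (fst a) else step_function l x)"
    by (intro continuous_map_if_clopen) auto
  moreover have "step_function (a # l) = (\<lambda>x. if x \<in> snd a then of_rat (fst a) else step_function l x)"
    by (rule ext) simp
  ultimately show ?case by simp
qed

lemma step_function_close:
  assumes "\<forall>a \<in> set l. \<forall>x \<in> snd a. \<bar>f x - of_rat (fst a)\<bar> < e" "x \<in> \<Union>(snd ` set l)"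
  shows "\<bar>f x - step_function l x\<bar> < e"
  using assms by (induction l) auto

context C_space_on begin

text \<open>
  If the clopen sets form a base, a finite cover by clopen sets on which a given function varies
  little shows that the step functions with rational values are dense.
\<close>
lemma density_le_C:
  assumes \<kappa>: "Card_order \<kappa>" "infinite (Field \<kappa>)"
    and small: "|carrier (clopen_algebra K)| \<le>o \<kappa>"
    and base: "\<And>U x. openin K U \<Longrightarrow> x \<in> U \<Longrightarrow> \<exists>B. openin K B \<and> closedin K B \<and> x \<in> B \<and> B \<subseteq> U"
  shows "density_le (C_space K) \<kappa>"
  unfolding density_le_def
proof (intro exI conjI)
  interpret C: Metric_space "carrier (C_space K)" "vdist (C_space K)"
    by (rule normed_space_on_Metric_space[OF normed_space_C])
  let ?L = "lists ((UNIV :: rat set) \<times> carrier (clopen_algebra K))"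
  let ?D = "(\<lambda>l. restrict (step_function l) (topspace K)) ` ?L"
  have clop: "\<forall>a \<in> set l. openin K (snd a) \<and> closedin K (snd a)" if "l \<in> ?L" for l
    using that by (fastforce simp: clopen_algebra_def)
  show D: "?D \<subseteq> carrier (C_space K)"
    using restrict_in_C continuous_map_step_function clop by blast
  have "|UNIV :: nat set| \<le>o \<kappa>"
    using \<kappa> by (meson card_of_Field_ordIso infinite_iff_card_of_nat ordLeq_ordIso_trans)
  moreover have "|UNIV :: rat set| \<le>o |UNIV :: nat set|"
    using card_of_ordLeq[of "UNIV :: rat set" "UNIV :: nat set"] countableI_type[of "UNIV :: rat set"]
    unfolding countable_def by blast
  ultimately have "|UNIV :: rat set| \<le>o \<kappa>" using ordLeq_transitive by blast
  then have "|?L| \<le>o \<kappa>"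
    using small \<kappa> by (intro card_of_lists_ordLeq card_of_Times_ordLeq_infinite_Field)
  then show "|?D| \<le>o \<kappa>" by (rule ordLeq_transitive[OF card_of_image])
  show "C.mtopology closure_of ?D = carrier (C_space K)"
    unfolding C.metric_closure_of
  proof (intro equalityI subsetI CollectI conjI allI impI)
    fix f and r :: real assume f: "f \<in> carrier (C_space K)" and r: "0 < r"
    define \<G> where "\<G> = {B. openin K B \<and> closedin K B \<and> (\<exists>q. \<forall>y \<in> B. \<bar>f y - of_rat q\<bar> < r/2)}"
    have "x \<in> \<Union>\<G>" if x: "x \<in> topspace K" for x
    proof -
      obtain q where q: "f x - r/2 < of_rat q" "of_rat q < f x + r/2"
        using of_rat_dense[of "f x - r/2" "f x + r/2"] r by auto
      let ?U = "{y \<in> topspace K. f y \<in> {of_rat q - r/2 <..< of_rat q + r/2}}"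
      have "openin K ?U"
        using f unfolding carrier_C by (intro openin_continuous_map_preimage[of K euclideanreal]) auto
      moreover have "x \<in> ?U" using x q by auto
      ultimately obtain B where B: "openin K B" "closedin K B" "x \<in> B" "B \<subseteq> ?U" using base by blast
      have "\<forall>y \<in> B. \<bar>f y - of_rat q\<bar> < r/2"
      proof
        fix y assume "y \<in> B"
        then have "f y \<in> {of_rat q - r/2 <..< of_rat q + r/2}" using B(4) by blast
        then show "\<bar>f y - of_rat q\<bar> < r/2"
            by (simp only: greaterThanLessThan_iff abs_less_iff) linarith
      qed
      then have "B \<in> \<G>" using B unfolding \<G>_def by blast
      then show ?thesis using B(3) by blast
    qed
    then have "topspace K \<subseteq> \<Union>\<G>" by blast
    moreover have "\<forall>B \<in> \<G>. openin K B" by (simp add: \<G>_def)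
    ultimately obtain \<F> where \<F>: "finite \<F>" "\<F> \<subseteq> \<G>" "topspace K \<subseteq> \<Union>\<F>"
      using compact unfolding compact_space_alt by meson
    have "\<forall>B \<in> \<G>. \<exists>q. \<forall>y \<in> B. \<bar>f y - of_rat q\<bar> < r/2" by (simp add: \<G>_def)
    then obtain q where q: "\<forall>B \<in> \<G>. \<forall>y \<in> B. \<bar>f y - of_rat (q B)\<bar> < r/2"
      using bchoice by meson
    obtain bs where bs: "set bs = \<F>" using finite_list[OF \<F>(1)] by blast
    define l where "l = map (\<lambda>B. (q B, B)) bs"
    have l: "l \<in> ?L" using bs \<F>(2) by (auto simp: l_def lists_eq_set clopen_algebra_def \<G>_def)
    have un: "\<Union>(snd ` set l) = \<Union>\<F>" using bs by (auto simp: l_def)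
    have close: "\<forall>a \<in> set l. \<forall>x \<in> snd a. \<bar>f x - of_rat (fst a)\<bar> < r/2"
      using q bs \<F>(2) by (auto simp: l_def)
    let ?g = "restrict (step_function l) (topspace K)"
    have g: "?g \<in> ?D" using l by blast
    have "vdist (C_space K) f ?g \<le> r/2"
    proof (rule vdist_C_less)
      show "?g \<in> carrier (C_space K)" using D g by blast
      show "\<bar>f x - ?g x\<bar> < r/2" if "x \<in> topspace K" for x
        using step_function_close[OF close, unfolded un, OF subsetD[OF \<F>(3) that]] that by simp
    qed (use f r in auto)
    then have "?g \<in> C.mball f r" using f D g r by (auto simp: C.in_mball)
    then show "\<exists>y \<in> ?D. y \<in> C.mball f r" using g by blast
  qed auto
qed

end

context normed_space_on begin

text \<open>
  Evaluation at \<open>x\<close>, composed with a map \<open>\<phi>\<close> of \<open>K\<close> onto the dual ball. Continuity has to be assumed for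
  \<open>x \<in> D\<close> only, since evaluation at \<open>x\<close> is a uniform limit of evaluations at points of \<open>D\<close>.
\<close>
lemma isometry_into_C_space:
  assumes K: "C_space_on K" and D: "D \<subseteq> carrier V"
    and dense: "Metric_space.mtopology (carrier V) (vdist V) closure_of D = carrier V"
    and onto: "\<phi> ` topspace K = dual_ball"
    and cont: "\<And>d. d \<in> D \<Longrightarrow> continuous_map K euclideanreal (\<lambda>s. \<phi> s d)"
  shows "linear_isometry V (C_space K) (\<lambda>x. restrict (\<lambda>s. \<phi> s x) (topspace K))"
proof -
  interpret K: C_space_on K by fact
  interpret M: Metric_space "carrier V" "vdist V"
    by (rule normed_space_on_Metric_space) (rule normed_space_on_axioms)
  have ball: "\<phi> s \<in> dual_ball" if "s \<in> topspace K" for s using onto that by blast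
  have cont_all: "continuous_map K euclideanreal (\<lambda>s. \<phi> s x)" if x: "x \<in> carrier V" for x
  proof (rule continuous_map_real_approx)
    fix e :: real assume "0 < e"
    then obtain d where d: "d \<in> D" "d \<in> M.mball x e"
      using dense x unfolding M.metric_closure_of by blast
    then have "\<bar>\<phi> s x - \<phi> s d\<bar> < e" if "s \<in> topspace K" for s
      using dual_ball_Lipschitz[OF ball[OF that] x, of d] D by auto
    then show "\<exists>g. continuous_map K euclideanreal g \<and> (\<forall>s \<in> topspace K. \<bar>\<phi> s x - g s\<bar> < e)"
      using cont[OF d(1)] by blast
  qed
  let ?T = "\<lambda>x. restrict (\<lambda>s. \<phi> s x) (topspace K)"
  have T: "?T x \<in> carrier (C_space K)" if "x \<in> carrier V" for x
    by (rule K.restrict_in_C[OF cont_all[OF that]])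
  have "vnorm (C_space K) (?T x) = vnorm V x" if x: "x \<in> carrier V" for x
  proof (rule antisym)
    show "vnorm (C_space K) (?T x) \<le> vnorm V x"
      by (rule K.C_norm_least) (simp add: dual_ball_bound[OF ball x])
    obtain f where f: "f \<in> dual_ball" "f x = vnorm V x" using Hahn_Banach_norming[OF x] by blast
    then have "f \<in> \<phi> ` topspace K" unfolding onto by simp
    then obtain s where s: "s \<in> topspace K" "\<phi> s = f" by blast
    then show "vnorm V x \<le> vnorm (C_space K) (?T x)"
      using K.C_norm_upper[OF T[OF x] s(1)] f(2) by simp
  qed
  moreover have "?T (vadd V x y) = vadd (C_space K) (?T x) (?T y)"
    if "x \<in> carrier V" "y \<in> carrier V" for x y
    using that by (auto simp: C_space_def dual_ball_add[OF ball])
  moreover have "?T (vscale V a x) = vscale (C_space K) a (?T x)" if "x \<in> carrier V" for a x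
    using that by (auto simp: C_space_def dual_ball_scale[OF ball])
  ultimately show ?thesis using T unfolding linear_isometry_def by blast
qed

end

section \<open>Boolean algebras represented by sets\<close>

text \<open>
  An ordered structure \<open>L\<close> that \<open>r\<close> identifies with the field of sets \<open>M\<close>. Both the clopen algebra and its
  copies on other types are of this kind, so the lattice operations need to be computed only once.
\<close>
locale set_representation = algebra \<Omega> M for \<Omega> :: "'b set" and M +
  fixes L :: "'a gorder" and r :: "'a \<Rightarrow> 'b set"
  assumes \<Omega>_nonempty: "\<Omega> \<noteq> {}"
    and bij: "bij_betw r (carrier L) M"
    and eq_L: "eq L = (=)"
    and le_L: "\<lbrakk>x \<in> carrier L; y \<in> carrier L\<rbrakk> \<Longrightarrow> le L x y \<longleftrightarrow> r x \<subseteq> r y"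
begin

lemma r_in: "x \<in> carrier L \<Longrightarrow> r x \<in> M"
  using bij by (auto simp: bij_betw_def)

lemma r_inj: "x \<in> carrier L \<Longrightarrow> y \<in> carrier L \<Longrightarrow> r x = r y \<Longrightarrow> x = y"
  using bij by (auto simp: bij_betw_def inj_on_def)

lemma r_surj:
  assumes "A \<in> M" obtains x where "x \<in> carrier L" "r x = A"
  using bij assms by (auto simp: bij_betw_def)

lemma le_antisym_L:
  assumes "x \<in> carrier L" "y \<in> carrier L" "le L x y" "le L y x"
  shows "x = y"
  using r_inj[OF assms(1,2)] le_L[OF assms(1,2)] le_L[OF assms(2,1)] assms(3,4) by blast

lemma partial_order_L: "partial_order L"
proof unfold_locales
  show "le L x x" if "x \<in> carrier L" for x using that by (simp add: le_L)
  show "eq L x y" if "le L x y" "le L y x" "x \<in> carrier L" "y \<in> carrier L" for x y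
    unfolding eq_L using that le_antisym_L by blast
  show "le L x z" if "le L x y" "le L y z" "x \<in> carrier L" "y \<in> carrier L" "z \<in> carrier L" for x y z
    using le_L[OF that(3,4)] le_L[OF that(4,5)] le_L[OF that(3,5)] that(1,2) by blast
qed (simp_all add: eq_L)

lemma least_iff:
  assumes "X \<subseteq> carrier L" "x \<in> X"
  shows "least L x X \<longleftrightarrow> (\<forall>y \<in> X. r x \<subseteq> r y)"
proof -
  have "le L x y \<longleftrightarrow> r x \<subseteq> r y" if "y \<in> X" for y
    by (rule le_L[OF subsetD[OF assms(1,2)] subsetD[OF assms(1) that]])
  then show ?thesis unfolding least_def using assms by (simp cong: ball_cong)
qed

lemma greatest_iff:
  assumes "X \<subseteq> carrier L" "x \<in> X"
  shows "greatest L x X \<longleftrightarrow> (\<forall>y \<in> X. r y \<subseteq> r x)"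
proof -
  have "le L y x \<longleftrightarrow> r y \<subseteq> r x" if "y \<in> X" for y
    by (rule le_L[OF subsetD[OF assms(1) that] subsetD[OF assms(1,2)]])
  then show ?thesis unfolding greatest_def using assms by (simp cong: ball_cong)
qed

lemma least_unique:
  assumes "least L x X" "least L y X"
  shows "x = y"
proof -
  have "le L x y" by (rule least_le[OF assms(1) least_mem[OF assms(2)]])
  moreover have "le L y x" by (rule least_le[OF assms(2) least_mem[OF assms(1)]])
  ultimately show ?thesis
    by (rule le_antisym_L[OF least_closed[OF assms(1)] least_closed[OF assms(2)]])
qed

lemma greatest_unique:
  assumes "greatest L x X" "greatest L y X"
  shows "x = y"
proof -
  have "le L x y" by (rule greatest_le[OF assms(2) greatest_mem[OF assms(1)]])
  moreover have "le L y x" by (rule greatest_le[OF assms(1) greatest_mem[OF assms(2)]])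
  ultimately show ?thesis
    by (rule le_antisym_L[OF greatest_closed[OF assms(1)] greatest_closed[OF assms(2)]])
qed

lemma Upper_pair:
  assumes "x \<in> carrier L" "y \<in> carrier L"
  shows "Upper L {x, y} = {u \<in> carrier L. r x \<subseteq> r u \<and> r y \<subseteq> r u}"
proof -
  have "le L x u \<and> le L y u \<longleftrightarrow> r x \<subseteq> r u \<and> r y \<subseteq> r u" if "u \<in> carrier L" for u
    by (simp only: le_L[OF assms(1) that] le_L[OF assms(2) that])
  moreover have "Upper L {x, y} = {u \<in> carrier L. le L x u \<and> le L y u}"
    unfolding Upper_def using assms by blast
  ultimately show ?thesis by (simp cong: conj_cong)
qed

lemma Lower_pair:
  assumes "x \<in> carrier L" "y \<in> carrier L"
  shows "Lower L {x, y} = {u \<in> carrier L. r u \<subseteq> r x \<and> r u \<subseteq> r y}"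
proof -
  have "le L u x \<and> le L u y \<longleftrightarrow> r u \<subseteq> r x \<and> r u \<subseteq> r y" if "u \<in> carrier L" for u
    by (simp only: le_L[OF that assms(1)] le_L[OF that assms(2)])
  moreover have "Lower L {x, y} = {u \<in> carrier L. le L u x \<and> le L u y}"
    unfolding Lower_def using assms by blast
  ultimately show ?thesis by (simp cong: conj_cong)
qed

lemma lub_Un:
  assumes "x \<in> carrier L" "y \<in> carrier L" "z \<in> carrier L" "r z = r x \<union> r y"
  shows "least L z (Upper L {x, y})"
  unfolding Upper_pair[OF assms(1,2)] using assms by (subst least_iff) auto

lemma glb_Int:
  assumes "x \<in> carrier L" "y \<in> carrier L" "z \<in> carrier L" "r z = r x \<inter> r y"
  shows "greatest L z (Lower L {x, y})"
  unfolding Lower_pair[OF assms(1,2)] using assms by (subst greatest_iff) auto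

lemma r_join:
  assumes "x \<in> carrier L" "y \<in> carrier L"
  shows "x \<squnion>\<^bsub>L\<^esub> y \<in> carrier L" "r (x \<squnion>\<^bsub>L\<^esub> y) = r x \<union> r y"
proof -
  obtain z where z: "z \<in> carrier L" "r z = r x \<union> r y"
    by (rule r_surj[OF Un[OF r_in[OF assms(1)] r_in[OF assms(2)]]])
  have "x \<squnion>\<^bsub>L\<^esub> y = z"
    unfolding join_def sup_def
    by (rule some_equality) (rule lub_Un[OF assms z], rule least_unique[OF _ lub_Un[OF assms z]])
  then show "x \<squnion>\<^bsub>L\<^esub> y \<in> carrier L" "r (x \<squnion>\<^bsub>L\<^esub> y) = r x \<union> r y" using z by simp_all
qed

lemma r_meet:
  assumes "x \<in> carrier L" "y \<in> carrier L"
  shows "x \<sqinter>\<^bsub>L\<^esub> y \<in> carrier L" "r (x \<sqinter>\<^bsub>L\<^esub> y) = r x \<inter> r y"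
proof -
  obtain z where z: "z \<in> carrier L" "r z = r x \<inter> r y"
    by (rule r_surj[OF Int[OF r_in[OF assms(1)] r_in[OF assms(2)]]])
  have "x \<sqinter>\<^bsub>L\<^esub> y = z"
    unfolding meet_def inf_def
    by (rule some_equality) (rule glb_Int[OF assms z], rule greatest_unique[OF _ glb_Int[OF assms z]])
  then show "x \<sqinter>\<^bsub>L\<^esub> y \<in> carrier L" "r (x \<sqinter>\<^bsub>L\<^esub> y) = r x \<inter> r y" using z by simp_all
qed

lemma least_bottom:
  assumes "x \<in> carrier L" "r x = {}" shows "least L x (carrier L)"
  using assms by (subst least_iff) auto

lemma greatest_top:
  assumes "x \<in> carrier L" "r x = \<Omega>" shows "greatest L x (carrier L)"
  using assms r_in sets_into_space by (subst greatest_iff) auto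

lemma r_bottom: "\<bottom>\<^bsub>L\<^esub> \<in> carrier L" "r \<bottom>\<^bsub>L\<^esub> = {}"
proof -
  obtain z where z: "z \<in> carrier L" "r z = {}" by (rule r_surj[OF empty_sets])
  have "\<bottom>\<^bsub>L\<^esub> = z"
    unfolding bottom_def by (rule some_equality) (rule least_bottom[OF z], rule least_unique[OF _ least_bottom[OF z]])
  then show "\<bottom>\<^bsub>L\<^esub> \<in> carrier L" "r \<bottom>\<^bsub>L\<^esub> = {}" using z by simp_all
qed

lemma r_top: "\<top>\<^bsub>L\<^esub> \<in> carrier L" "r \<top>\<^bsub>L\<^esub> = \<Omega>"
proof -
  obtain z where z: "z \<in> carrier L" "r z = \<Omega>" by (rule r_surj[OF top])
  have "\<top>\<^bsub>L\<^esub> = z"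
    unfolding top_def by (rule some_equality) (rule greatest_top[OF z], rule greatest_unique[OF _ greatest_top[OF z]])
  then show "\<top>\<^bsub>L\<^esub> \<in> carrier L" "r \<top>\<^bsub>L\<^esub> = \<Omega>" using z by simp_all
qed

lemma lattice_L: "lattice L"
proof -
  interpret partial_order L by (rule partial_order_L)
  show ?thesis
  proof
    fix x y assume xy: "x \<in> carrier L" "y \<in> carrier L"
    show "\<exists>s. least L s (Upper L {x, y})" by (rule exI[of _ "x \<squnion>\<^bsub>L\<^esub> y"]) (rule lub_Un[OF xy r_join[OF xy]])
    show "\<exists>s. greatest L s (Lower L {x, y})" by (rule exI[of _ "x \<sqinter>\<^bsub>L\<^esub> y"]) (rule glb_Int[OF xy r_meet[OF xy]])
  qed
qed

lemma boolean_algebra_L: "boolean_algebra_on L"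
proof -
  interpret lattice L by (rule lattice_L)
  show ?thesis
  proof
    show "\<exists>x. least L x (carrier L)" by (rule exI) (rule least_bottom[OF r_bottom])
    show "\<exists>x. greatest L x (carrier L)" by (rule exI) (rule greatest_top[OF r_top])
    show "x \<sqinter>\<^bsub>L\<^esub> (y \<squnion>\<^bsub>L\<^esub> z) = (x \<sqinter>\<^bsub>L\<^esub> y) \<squnion>\<^bsub>L\<^esub> (x \<sqinter>\<^bsub>L\<^esub> z)"
      if "x \<in> carrier L" "y \<in> carrier L" "z \<in> carrier L" for x y z
      using that by (intro r_inj) (auto simp: r_join r_meet)
    show "\<exists>y \<in> carrier L. x \<sqinter>\<^bsub>L\<^esub> y = \<bottom>\<^bsub>L\<^esub> \<and> x \<squnion>\<^bsub>L\<^esub> y = \<top>\<^bsub>L\<^esub>" if x: "x \<in> carrier L" for x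
    proof -
      obtain y where y: "y \<in> carrier L" "r y = \<Omega> - r x" by (rule r_surj[OF compl_sets[OF r_in[OF x]]])
      have "x \<sqinter>\<^bsub>L\<^esub> y = \<bottom>\<^bsub>L\<^esub>"
        using x y by (intro r_inj) (auto simp: r_meet r_bottom)
      moreover have "x \<squnion>\<^bsub>L\<^esub> y = \<top>\<^bsub>L\<^esub>"
        using x y sets_into_space[OF r_in[OF x]] by (intro r_inj) (auto simp: r_join r_top)
      ultimately show ?thesis using y(1) by (intro bexI[of _ y] conjI)
    qed
    show "\<bottom>\<^bsub>L\<^esub> \<noteq> \<top>\<^bsub>L\<^esub>" using r_bottom r_top \<Omega>_nonempty by metis
  qed
qed

end

lemma boolean_hom_of_representations:
  assumes A: "set_representation \<Omega> M A r" and B: "set_representation \<Omega> M B s"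
    and h: "\<And>x. x \<in> carrier A \<Longrightarrow> h x \<in> carrier B \<and> s (h x) = r x"
  shows "boolean_hom A B h"
proof -
  interpret A: set_representation \<Omega> M A r by fact
  interpret B: set_representation \<Omega> M B s by fact
  show ?thesis
    unfolding boolean_hom_def join_pres_def meet_pres_def
  proof (intro conjI ballI A.lattice_L B.lattice_L)
    show "h \<in> carrier A \<rightarrow> carrier B" using h by blast
    show "h (x \<squnion>\<^bsub>A\<^esub> y) = h x \<squnion>\<^bsub>B\<^esub> h y" if "x \<in> carrier A" "y \<in> carrier A" for x y
      using that by (intro B.r_inj) (simp_all add: h A.r_join B.r_join)
    show "h (x \<sqinter>\<^bsub>A\<^esub> y) = h x \<sqinter>\<^bsub>B\<^esub> h y" if "x \<in> carrier A" "y \<in> carrier A" for x y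
      using that by (intro B.r_inj) (simp_all add: h A.r_meet B.r_meet)
    show "h \<bottom>\<^bsub>A\<^esub> = \<bottom>\<^bsub>B\<^esub>" by (intro B.r_inj) (simp_all add: h A.r_bottom B.r_bottom)
    show "h \<top>\<^bsub>A\<^esub> = \<top>\<^bsub>B\<^esub>" by (intro B.r_inj) (simp_all add: h A.r_top B.r_top)
  qed
qed

lemma algebra_clopen: "algebra (topspace K) (carrier (clopen_algebra K))"
  unfolding algebra_iff_Un clopen_algebra_def using openin_subset by (auto intro!: openin_diff closedin_diff)

lemma clopen_representation:
  assumes "topspace K \<noteq> {}"
  shows "set_representation (topspace K) (carrier (clopen_algebra K)) (clopen_algebra K) id"
proof -
  interpret algebra "topspace K" "carrier (clopen_algebra K)" by (rule algebra_clopen)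
  show ?thesis
    by unfold_locales (use assms in \<open>auto simp: clopen_algebra_def\<close>)
qed

text \<open>The clopen algebra of \<open>K\<close>, moved to another type by a map \<open>j\<close> that is injective on it.\<close>
definition clopen_copy :: "('b set \<Rightarrow> 'a) \<Rightarrow> 'b topology \<Rightarrow> 'a gorder" where
  "clopen_copy j K = (let C = carrier (clopen_algebra K) in
     \<lparr>carrier = j ` C, eq = (=), le = (\<lambda>x y. the_inv_into C j x \<subseteq> the_inv_into C j y)\<rparr>)"

lemma clopen_copy_representation:
  assumes "topspace K \<noteq> {}" and j: "inj_on j (carrier (clopen_algebra K))"
  shows "set_representation (topspace K) (carrier (clopen_algebra K)) (clopen_copy j K)
    (the_inv_into (carrier (clopen_algebra K)) j)"
proof -
  interpret algebra "topspace K" "carrier (clopen_algebra K)" by (rule algebra_clopen)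
  show ?thesis
  proof unfold_locales
    show "bij_betw (the_inv_into (carrier (clopen_algebra K)) j) (carrier (clopen_copy j K))
        (carrier (clopen_algebra K))"
      unfolding clopen_copy_def Let_def partial_object.simps
      by (rule bij_betw_the_inv_into[OF inj_on_imp_bij_betw[OF j]])
    show "topspace K \<noteq> {}" by (rule assms(1))
  qed (simp_all add: clopen_copy_def Let_def)
qed

section \<open>Transport of well-ordered chains\<close>

lemma wellordered_chain_image:
  assumes C: "wellordered_chain A C" and e: "\<And>x. x \<in> C \<Longrightarrow> e x \<in> carrier B"
    and emb: "\<And>x y. x \<in> C \<Longrightarrow> y \<in> C \<Longrightarrow> le B (e x) (e y) \<longleftrightarrow> le A x y"
    and inj: "inj_on e C"
  shows "wellordered_chain B (e ` C)"
proof -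
  let ?r = "{(x, y). x \<in> C \<and> y \<in> C \<and> le A x y}"
  let ?s = "{(x, y). x \<in> e ` C \<and> y \<in> e ` C \<and> le B x y}"
  have wo: "well_order_on C ?r" using C by (simp add: wellordered_chain_def)
  have field: "Field ?r = C" by (rule sym[OF well_order_on_Field[OF wo]])
  have image: "dir_image ?r e = ?s"
  proof (intro subset_antisym subrelI)
    fix a b assume "(a, b) \<in> dir_image ?r e"
    then obtain x y where "a = e x" "b = e y" "x \<in> C" "y \<in> C" "le A x y"
      unfolding dir_image_def by blast
    then show "(a, b) \<in> ?s" using emb by simp
  next
    fix a b assume "(a, b) \<in> ?s"
    then obtain x y where "a = e x" "b = e y" "x \<in> C" "y \<in> C" "le B (e x) (e y)" by blast
    then show "(a, b) \<in> dir_image ?r e" unfolding dir_image_def using emb by blast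
  qed
  have "well_order_on (Field (dir_image ?r e)) (dir_image ?r e)"
    by (rule Well_order_dir_image) (simp_all only: field wo inj)
  moreover have "Field ?s = e ` C"
    using dir_image_Field[of ?r e] unfolding image field .
  ultimately have "well_order_on (e ` C) ?s"
    unfolding image by simp
  then show ?thesis using e by (auto simp: wellordered_chain_def)
qed

lemma boolean_hom_le_iff:
  assumes h: "boolean_hom B A h" "inj_on h (carrier B)" and xy: "x \<in> carrier B" "y \<in> carrier B"
  shows "le A (h x) (h y) \<longleftrightarrow> le B x y"
proof -
  interpret A: lattice A using h(1) by (simp add: boolean_hom_def join_pres_def)
  interpret B: lattice B using h(1) by (simp add: boolean_hom_def join_pres_def)
  have hA: "h z \<in> carrier A" if "z \<in> carrier B" for z using h(1) that by (auto simp: boolean_hom_def)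
  have "le A (h x) (h y) \<longleftrightarrow> h x \<squnion>\<^bsub>A\<^esub> h y = h y"
    by (rule A.le_iff_meet[OF hA[OF xy(1)] hA[OF xy(2)]])
  also have "h x \<squnion>\<^bsub>A\<^esub> h y = h (x \<squnion>\<^bsub>B\<^esub> y)"
    using h(1) xy by (simp add: boolean_hom_def join_pres_def)
  also have "h (x \<squnion>\<^bsub>B\<^esub> y) = h y \<longleftrightarrow> x \<squnion>\<^bsub>B\<^esub> y = y"
    by (rule inj_on_eq_iff[OF h(2) B.join_closed[OF xy] xy(2)])
  also have "\<dots> \<longleftrightarrow> le B x y"
    by (rule B.le_iff_meet[OF xy, symmetric])
  finally show ?thesis .
qed

lemma embedding_chain:
  assumes h: "boolean_hom B A h" "inj_on h (carrier B)"
    and C: "wellordered_chain B C" "uncountable C"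
  shows "\<exists>C'. wellordered_chain A C' \<and> uncountable C'"
proof (intro exI conjI)
  have CB: "C \<subseteq> carrier B" using C(1) by (simp add: wellordered_chain_def)
  have hA: "h z \<in> carrier A" if "z \<in> carrier B" for z using h(1) that by (auto simp: boolean_hom_def)
  have inj: "inj_on h C" using h(2) CB inj_on_subset by blast
  show "wellordered_chain A (h ` C)"
    using CB hA boolean_hom_le_iff[OF h] by (intro wellordered_chain_image[OF C(1) _ _ inj]) (simp_all add: subset_iff)
  show "uncountable (h ` C)" using C(2) inj countable_image_inj_on by blast
qed

lemma preimage_chain:
  assumes f: "continuous_map K L f" "f ` topspace K = topspace L"
    and C: "wellordered_chain (clopen_algebra L) C" "uncountable C"
  shows "\<exists>C'. wellordered_chain (clopen_algebra K) C' \<and> uncountable C'"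
proof (intro exI conjI)
  let ?e = "\<lambda>U. {x \<in> topspace K. f x \<in> U}"
  have CL: "openin L U" "closedin L U" if "U \<in> C" for U
    using C(1) that by (auto simp: wellordered_chain_def clopen_algebra_def)
  have CT: "U \<subseteq> topspace L" if "U \<in> C" for U using CL[OF that] openin_subset by blast
  have e: "?e U \<in> carrier (clopen_algebra K)" if "U \<in> C" for U
    using CL[OF that] f(1) by (simp add: clopen_algebra_def openin_continuous_map_preimage closedin_continuous_map_preimage)
  have le: "?e U \<subseteq> ?e W \<longleftrightarrow> U \<subseteq> W" if "U \<in> C" "W \<in> C" for U W
  proof
    assume sub: "?e U \<subseteq> ?e W"
    show "U \<subseteq> W"
    proof
      fix y assume y: "y \<in> U"
      then have "y \<in> f ` topspace K" using CT[OF that(1)] f(2) by blast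
      then obtain x where "x \<in> topspace K" "y = f x" by blast
      then show "y \<in> W" using sub y by blast
    qed
  qed blast
  have inj: "inj_on ?e C" by (rule inj_onI) (use le in blast)
  show "wellordered_chain (clopen_algebra K) (?e ` C)"
    by (rule wellordered_chain_image[OF C(1) e _ inj]) (simp_all add: clopen_algebra_def le)
  show "uncountable (?e ` C)" using C(2) inj countable_image_inj_on by blast
qed

section \<open>A compact space with a long chain of clopen sets\<close>

text \<open>For a well-order this space is homeomorphic to a successor ordinal with the order topology.\<close>
definition initial_segments :: "'k rel \<Rightarrow> 'k set set" where
  "initial_segments \<kappa> = {S. S \<subseteq> Field \<kappa> \<and> (\<forall>a b. (a, b) \<in> \<kappa> \<longrightarrow> b \<in> S \<longrightarrow> a \<in> S)}"

definition segment_space :: "'k rel \<Rightarrow> 'k set topology" where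
  "segment_space \<kappa> = subtopology (cantor_cube (Field \<kappa>)) (initial_segments \<kappa>)"

lemma cantor_closed_segment_space:
  "cantor_closed (Field \<kappa>) (segment_space \<kappa>) (initial_segments \<kappa>)"
proof
  show "closedin (cantor_cube (Field \<kappa>)) (initial_segments \<kappa>)"
    unfolding closedin_def
  proof
    show "openin (cantor_cube (Field \<kappa>)) (topspace (cantor_cube (Field \<kappa>)) - initial_segments \<kappa>)"
      unfolding openin_cantor_cube
    proof (intro conjI ballI)
      fix S assume "S \<in> topspace (cantor_cube (Field \<kappa>)) - initial_segments \<kappa>"
      then obtain a b where ab: "(a, b) \<in> \<kappa>" "b \<in> S" "a \<notin> S"
        unfolding initial_segments_def by auto
      have "a \<in> Field \<kappa>" "b \<in> Field \<kappa>" using ab(1) by (auto intro: FieldI1 FieldI2)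
      moreover have "S' \<notin> initial_segments \<kappa>" if "S' \<inter> {a, b} = S \<inter> {a, b}" for S'
      proof -
        have "b \<in> S'" "a \<notin> S'" using that ab(2,3) by blast+
        then show ?thesis using ab(1) unfolding initial_segments_def by blast
      qed
      ultimately show "\<exists>E. finite E \<and> E \<subseteq> Field \<kappa> \<and> (\<forall>S'. S' \<subseteq> Field \<kappa> \<and> S' \<inter> E = S \<inter> E \<longrightarrow>
          S' \<in> topspace (cantor_cube (Field \<kappa>)) - initial_segments \<kappa>)"
        by (intro exI[of _ "{a, b}"]) auto
    qed auto
  qed (auto simp: initial_segments_def)
qed (rule segment_space_def)

text \<open>
  The sets of all segments that omit \<open>a\<close> increase strictly with \<open>a\<close>, since the segment of all \<open>x\<close>
  below or equal to \<open>b\<close> omits precisely the elements above \<open>b\<close>.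
\<close>
lemma segment_space_chain:
  assumes \<kappa>: "Well_order \<kappa>" and unc: "uncountable (Field \<kappa>)"
  obtains C where "wellordered_chain (clopen_algebra (segment_space \<kappa>)) C" "uncountable C"
proof -
  interpret L: cantor_closed "Field \<kappa>" "segment_space \<kappa>" "initial_segments \<kappa>"
    by (rule cantor_closed_segment_space)
  let ?A = "\<lparr>carrier = Field \<kappa>, eq = (=), le = (\<lambda>x y. (x, y) \<in> \<kappa>)\<rparr>"
  define U where "U a = {S \<in> initial_segments \<kappa>. a \<notin> S}" for a
  have U_le: "U a \<subseteq> U b \<longleftrightarrow> (a, b) \<in> \<kappa>" if ab: "a \<in> Field \<kappa>" "b \<in> Field \<kappa>" for a b
  proof
    assume "(a, b) \<in> \<kappa>"
    then show "U a \<subseteq> U b" unfolding U_def initial_segments_def by blast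
  next
    assume sub: "U a \<subseteq> U b"
    define S where "S = {x. (x, b) \<in> \<kappa>}"
    have "trans \<kappa>" "refl_on (Field \<kappa>) \<kappa>"
      using \<kappa> by (auto simp: order_on_defs)
    then have "S \<in> initial_segments \<kappa>" "b \<in> S"
      using ab(2) unfolding initial_segments_def S_def
      by (auto simp: refl_on_def intro: FieldI1 dest: transD)
    then have "a \<in> S" using sub unfolding U_def by blast
    then show "(a, b) \<in> \<kappa>" by (simp add: S_def)
  qed
  have inj: "inj_on U (Field \<kappa>)"
  proof (rule inj_onI)
    fix a b assume ab: "a \<in> Field \<kappa>" "b \<in> Field \<kappa>" "U a = U b"
    then have "(a, b) \<in> \<kappa>" "(b, a) \<in> \<kappa>" using U_le by blast+
    moreover have "antisym \<kappa>" using \<kappa> by (simp add: order_on_defs)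
    ultimately show "a = b" by (simp add: antisymD)
  qed
  have "{(x, y). x \<in> Field \<kappa> \<and> y \<in> Field \<kappa> \<and> (x, y) \<in> \<kappa>} = \<kappa>"
    by (auto intro: FieldI1 FieldI2)
  then have chain: "wellordered_chain ?A (Field \<kappa>)"
    using \<kappa> by (simp add: wellordered_chain_def)
  have "U a \<in> carrier (clopen_algebra (segment_space \<kappa>))" if "a \<in> Field \<kappa>" for a
  proof -
    have "U a = L.pattern {a} {}" by (auto simp: U_def L.pattern_def)
    then show ?thesis
      using that L.openin_pattern[of "{a}" "{}"] L.closedin_pattern[of "{a}" "{}"]
      by (simp add: clopen_algebra_def)
  qed
  then have "wellordered_chain (clopen_algebra (segment_space \<kappa>)) (U ` Field \<kappa>)"
    using U_le by (intro wellordered_chain_image[OF chain _ _ inj]) (simp_all add: clopen_algebra_def)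
  moreover have "uncountable (U ` Field \<kappa>)"
    using unc inj countable_image_inj_on by blast
  ultimately show ?thesis by (rule that)
qed

section \<open>A universal space without uncountable well-ordered chains\<close>

theorem theorem1p1:
  fixes \<kappa> :: "'k rel" and X :: "'x normed_struct"
  assumes "Card_order \<kappa>" and "uncountable (Field \<kappa>)"
    and "universal_Banach \<kappa> X"
  shows "\<exists>(A :: 'k gorder) (K :: 'k set topology).
    A \<in> boolean_class \<kappa> \<and> Stone_space_of A K \<and>
    universal_Banach \<kappa> (C_space K) \<and>
    \<not> (\<exists>C. wellordered_chain A C \<and> uncountable C) \<and>
    \<not> universal_boolean \<kappa> A \<and>
    \<not> universal_compact \<kappa> K"
proof -
  note \<kappa> = assms(1)
  have inf: "infinite (Field \<kappa>)" using assms(2) countable_finite by blast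
  have XB: "X \<in> Banach_class \<kappa>" using assms(3) by (simp add: universal_Banach_def)
  then have nX: "normed_space_on X" by (simp add: Banach_class_def banach_on_def)
  interpret X: normed_space_on X by (rule nX)
  obtain D where D: "D \<subseteq> carrier X" "|D| \<le>o \<kappa>"
      and dense: "Metric_space.mtopology (carrier X) (vdist X) closure_of D = carrier X"
    using XB by (auto simp: Banach_class_def density_le_def)
  have \<kappa>_le: "\<kappa> \<le>o |UNIV :: 'k set|"
    using card_of_Field_ordIso[OF \<kappa>] card_of_mono1[of "Field \<kappa>" UNIV]
    by (meson ordIso_symmetric ordIso_ordLeq_trans subset_UNIV)
  have nat: "|UNIV :: nat set| \<le>o \<kappa>"
    using \<kappa> inf by (meson card_of_Field_ordIso infinite_iff_card_of_nat ordLeq_ordIso_trans)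
  have DN: "|D \<times> (UNIV :: nat set)| \<le>o \<kappa>"
    by (rule card_of_Times_ordLeq_infinite_Field[OF inf D(2) nat \<kappa>])
  then obtain p :: "'x \<times> nat \<Rightarrow> 'k" where p: "inj_on p (D \<times> UNIV)"
    using ordLeq_transitive[OF DN \<kappa>_le] by (auto simp flip: card_of_ordLeq)
  interpret convex_lift p D "X.rescaled D ` X.dual_ball"
  proof
    show "X.rescaled D ` X.dual_ball \<subseteq> D \<rightarrow>\<^sub>E {0..1}" using X.rescaled_bounds D(1) by blast
    show "restrict (\<lambda>j. (1 - t) * b j + t * c j) D \<in> X.rescaled D ` X.dual_ball"
      if "b \<in> X.rescaled D ` X.dual_ball" "c \<in> X.rescaled D ` X.dual_ball" "0 \<le> t" "t \<le> 1" for b c t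
      using X.rescaled_convex that D(1) by blast
  qed (rule p, rule X.closedin_rescaled[OF D(1)])
  let ?K = lift_space
  have I: "|p ` (D \<times> UNIV)| \<le>o \<kappa>" by (rule ordLeq_transitive[OF card_of_image DN])
  have small: "|carrier (clopen_algebra ?K)| \<le>o \<kappa>" by (rule lift.card_of_clopen[OF \<kappa> inf I])
  obtain j :: "'k set set \<Rightarrow> 'k" where j: "inj_on j (carrier (clopen_algebra ?K))"
    using ordLeq_transitive[OF small \<kappa>_le] by (auto simp flip: card_of_ordLeq)
  have "\<exists>f. f \<in> X.dual_ball \<and> X.rescaled D f = restrict (coord S) D" if "S \<in> lift" for S
    using coord_lift_in_B[OF that] by auto
  then obtain \<phi> where \<phi>: "\<And>S. S \<in> lift \<Longrightarrow> \<phi> S \<in> X.dual_ball"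
      "\<And>S. S \<in> lift \<Longrightarrow> X.rescaled D (\<phi> S) = restrict (coord S) D"
    by metis
  \<comment> \<open>\<open>\<phi>\<close> sends a family of expansions to the functional that it describes. That functional is unique
    because \<open>D\<close> is dense, so every element of the dual ball is reached.\<close>
  have onto: "\<phi> ` topspace ?K = X.dual_ball"
    unfolding lift.topspace_K
  proof (intro subset_antisym subsetI)
    fix f assume f: "f \<in> X.dual_ball"
    then have "X.rescaled D f \<in> X.rescaled D ` X.dual_ball" by (rule imageI)
    then obtain S where S: "S \<in> lift" "restrict (coord S) D = X.rescaled D f" by (rule lift_surj)
    then have "\<phi> S = f"
      by (intro X.rescaled_inj[OF \<phi>(1)[OF S(1)] f _ D(1) dense]) (rule trans[OF \<phi>(2)[OF S(1)] S(2)])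
    then show "f \<in> \<phi> ` lift" using S(1) by blast
  qed (use \<phi>(1) in blast)
  have ne: "topspace ?K \<noteq> {}" using onto X.zero_in_dual_ball by blast
  interpret CK: C_space_on ?K by unfold_locales (rule lift.compact_K, rule ne)
  have "continuous_map ?K euclideanreal (\<lambda>S. \<phi> S d)" if d: "d \<in> D" for d
  proof -
    have "continuous_map ?K euclideanreal (\<lambda>S. coord S d)"
      unfolding lift_space_def by (rule continuous_map_from_subtopology[OF coord_continuous[OF d]])
    then have "continuous_map ?K euclideanreal (\<lambda>S. vnorm X d * (2 * coord S d - 1))"
      by (intro continuous_map_real_mult_left continuous_map_diff) auto
    moreover have "vnorm X d * (2 * coord S d - 1) = \<phi> S d" if "S \<in> topspace ?K" for S
      using X.rescaled_inverse[OF \<phi>(1) d D(1), of S] \<phi>(2)[of S] that d by (simp add: lift.topspace_K)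
    ultimately show ?thesis by (rule continuous_map_eq)
  qed
  then have T: "linear_isometry X (C_space ?K) (\<lambda>x. restrict (\<lambda>S. \<phi> S x) (topspace ?K))"
    by (rule X.isometry_into_C_space[OF CK.C_space_on_axioms D(1) dense onto])
  have base: "\<exists>B. openin ?K B \<and> closedin ?K B \<and> S \<in> B \<and> B \<subseteq> U" if "openin ?K U" "S \<in> U" for U S
    using lift.clopen_base[OF that] by blast
  have "C_space ?K \<in> Banach_class \<kappa>"
    using CK.banach_C CK.density_le_C[OF \<kappa> inf small base] by (simp add: Banach_class_def)
  moreover have "\<exists>T. linear_isometry Y (C_space ?K) T" if Y: "Y \<in> Banach_class \<kappa>" for Y :: "'k set normed_struct"
  proof -
    obtain T' where "linear_isometry Y X T'" using assms(3) Y unfolding universal_Banach_def by blast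
    then have "linear_isometry Y (C_space ?K) ((\<lambda>x. restrict (\<lambda>S. \<phi> S x) (topspace ?K)) \<circ> T')"
      using T unfolding linear_isometry_def by (simp add: Pi_iff)
    then show ?thesis by blast
  qed
  ultimately have univ: "universal_Banach \<kappa> (C_space ?K)" by (simp add: universal_Banach_def)
  have noK: "\<not> (\<exists>C. wellordered_chain (clopen_algebra ?K) C \<and> uncountable C)"
  proof
    assume "\<exists>C. wellordered_chain (clopen_algebra ?K) C \<and> uncountable C"
    then obtain C where C: "wellordered_chain (clopen_algebra ?K) C" "uncountable C" by blast
    have "countable C"
      by (rule no_uncountable_wellordered_clopen_chain)
         (use C(1) in \<open>simp_all add: wellordered_chain_def clopen_algebra_def\<close>)
    then show False using C(2) by simp
  qed
  let ?A = "clopen_copy j ?K"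
  let ?h = "the_inv_into (carrier (clopen_algebra ?K)) j"
  have repA: "set_representation (topspace ?K) (carrier (clopen_algebra ?K)) ?A ?h"
    by (rule clopen_copy_representation[OF ne j])
  interpret A: set_representation "topspace ?K" "carrier (clopen_algebra ?K)" ?A ?h by (rule repA)
  have hom: "boolean_hom ?A (clopen_algebra ?K) ?h"
    by (rule boolean_hom_of_representations[OF repA clopen_representation[OF ne]]) (simp add: A.r_in)
  have A: "?A \<in> boolean_class \<kappa>"
  proof -
    have "carrier ?A = j ` carrier (clopen_algebra ?K)" by (simp add: clopen_copy_def Let_def)
    then show ?thesis
      using A.boolean_algebra_L ordLeq_transitive[OF card_of_image small]
      by (simp add: boolean_class_def)
  qed
  have Stone: "Stone_space_of ?A ?K"
    unfolding Stone_space_of_def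
    using lift.compact_K lift.Hausdorff_K lift.connected_component_K hom A.bij by blast
  have noA: "\<not> (\<exists>C. wellordered_chain ?A C \<and> uncountable C)"
    using noK embedding_chain[OF hom bij_betw_imp_inj_on[OF A.bij]] by blast
  let ?L = "segment_space \<kappa>"
  interpret L: cantor_closed "Field \<kappa>" ?L "initial_segments \<kappa>" by (rule cantor_closed_segment_space)
  have neL: "topspace ?L \<noteq> {}"
    unfolding L.topspace_K by (auto simp: initial_segments_def)
  have FI: "|Field \<kappa>| \<le>o \<kappa>" using card_of_Field_ordIso[OF \<kappa>] ordIso_imp_ordLeq by blast
  have "Well_order \<kappa>" using \<kappa> by (simp add: card_order_on_def)
  then obtain C where C: "wellordered_chain (clopen_algebra ?L) C" "uncountable C"
    using segment_space_chain assms(2) by blast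
  have smallL: "|carrier (clopen_algebra ?L)| \<le>o \<kappa>" by (rule L.card_of_clopen[OF \<kappa> inf FI])
  have "\<not> universal_compact \<kappa> ?K"
  proof
    assume "universal_compact \<kappa> ?K"
    moreover have "?L \<in> compact_class \<kappa>"
      using neL L.compact_K L.Hausdorff_K L.weight_le_K[OF \<kappa> inf FI] by (simp add: compact_class_def)
    ultimately obtain f where "continuous_map ?K ?L f" "f ` topspace ?K = topspace ?L"
      unfolding universal_compact_def by blast
    then show False using preimage_chain C noK by blast
  qed
  moreover have "\<not> universal_boolean \<kappa> ?A"
  proof
    assume univA: "universal_boolean \<kappa> ?A"
    obtain i :: "'k set set \<Rightarrow> 'k" where i: "inj_on i (carrier (clopen_algebra ?L))"
      using ordLeq_transitive[OF smallL \<kappa>_le] by (auto simp flip: card_of_ordLeq)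
    let ?B = "clopen_copy i ?L"
    interpret B: set_representation "topspace ?L" "carrier (clopen_algebra ?L)" ?B
      "the_inv_into (carrier (clopen_algebra ?L)) i"
      by (rule clopen_copy_representation[OF neL i])
    have carB: "carrier ?B = i ` carrier (clopen_algebra ?L)" by (simp add: clopen_copy_def Let_def)
    have "?B \<in> boolean_class \<kappa>"
      using B.boolean_algebra_L ordLeq_transitive[OF card_of_image smallL]
      by (simp add: boolean_class_def carB)
    then obtain h where "boolean_hom ?B ?A h" "inj_on h (carrier ?B)"
      using univA unfolding universal_boolean_def by blast
    moreover have homi: "boolean_hom (clopen_algebra ?L) ?B i"
      by (rule boolean_hom_of_representations[OF clopen_representation[OF neL] B.set_representation_axioms])
         (simp add: carB the_inv_into_f_f[OF i])
    have "\<exists>C'. wellordered_chain ?B C' \<and> uncountable C'"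
      by (rule embedding_chain[OF homi i C])
    ultimately show False using embedding_chain noA by blast
  qed
  ultimately show ?thesis using A Stone univ noA by blast
qed

end
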